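(* There is an algorithm that, given a LoadCVRP or LoadGasCVRP instance with no zero-weight edges and $r\in\mathbb N$, decides whether there exists a routing of weight at most $r$ in $f(r)\cdot n^{O(1)}$ steps, for some computable function $f$, where $n=|V(G)|$ is the number of vertices of the input graph.
   Context: All graphs are finite and undirected, and $\mathbb N = \{0,1,2,\dots\}$, $\mathbb N^+=\{1,2,\dots\}$. A walk in $G$ is a sequence of vertices $(v_1,\dots,v_m)$ with consecutive vertices adjacent; vertices and edges may be repeated. It is closed if $v_1 = v_m$. The weight of a walk is $w(p)=\sum_{i=1}^{m-1} w(v_i,v_{i+1})$. LoadCVRP (Load-Capacitated Vehicle Routing Problem): An instance contains a graph $G$ with edge weights $w\colon E(G)\to\mathbb N$, a nonempty set of depots $D\subseteq V(G)$, a set of clients $C\subseteq V(G)$, a number of vehicles $k\in\mathbb N$, a load capacity $\ell\in\mathbb N$, and demands $\Lambda\colon C\to\mathbb N^+$. A routing is a set of $k'$ walks $R=\{p_1,\dots,p_{k'}\}$ (one walk per vehicle) together with an assignment $A\colon C\to[k']$ such that $k'\le k$, every walk starts at a vertex of $D$, every client $c\in C$ is a vertex of $p_{A(c)}$, every walk in $R$ is closed, and $\sum_{c\in A^{-1}(i)}\Lambda(c)\le\ell$ for every $i\in[k']$. Its weight is $w(R)=\sum_{p\in R}w(p)$. LoadGasCVRP (Load-and-Gas-Capacitated Vehicle Routing Problem): as LoadCVRP, but the instance additionally contains a gas capacity $g\in\mathbb N$, and a routing must additionally satisfy $w(p)\le g$ for every $p\in R$. *)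

theory Defs
  imports Main
begin

section \<open>Random access machines\<close>

text \<open>
  Running times are measured in the number of vertices only, however large the weights, demands
  and capacities are, so every register and every memory cell holds an arbitrary natural number
  and every instruction costs one step. Multiplication is left out on purpose: in \<open>t\<close> steps
  the machine can lengthen numbers by at most \<open>t\<close> bits, so unit cost is not abused.
  All operands are register numbers except the constant in \<open>Const i c\<close> and the target in
  \<open>JumpZero i a\<close>. The machine halts when the program counter leaves the program.
\<close>

datatype instr =
    Const nat nat
  | Add nat nat nat
  | Sub nat nat nat
  | Load nat nat
  | Store nat nat
  | JumpZero nat nat

text \<open>A configuration consists of the program counter, the registers and the memory.\<close>

type_synonym config = "nat \<times> (nat \<Rightarrow> nat) \<times> (nat \<Rightarrow> nat)"

fun exec :: "instr \<Rightarrow> config \<Rightarrow> config" where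
  "exec (Const i c) (pc, R, M) = (Suc pc, R(i := c), M)"
| "exec (Add i j k) (pc, R, M) = (Suc pc, R(i := R j + R k), M)"
| "exec (Sub i j k) (pc, R, M) = (Suc pc, R(i := R j - R k), M)"
| "exec (Load i j) (pc, R, M) = (Suc pc, R(i := M (R j)), M)"
| "exec (Store i j) (pc, R, M) = (Suc pc, R, M(R i := R j))"
| "exec (JumpZero i a) (pc, R, M) = (if R i = 0 then a else Suc pc, R, M)"

definition halted :: "instr list \<Rightarrow> config \<Rightarrow> bool" where
  "halted P s \<longleftrightarrow> length P \<le> fst s"

definition step :: "instr list \<Rightarrow> config \<Rightarrow> config" where
  "step P s = (if halted P s then s else exec (P ! fst s) s)"

definition initial :: "nat list \<Rightarrow> config" where
  "initial xs = (0, (\<lambda>_. 0), (\<lambda>i. if i < length xs then xs ! i else 0))"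

text \<open>The output is the content of register 0. Halted configurations are fixed by \<^const>\<open>step\<close>,
  so being halted after \<open>t\<close> steps means having halted within \<open>t\<close> steps.\<close>

definition outputs_within :: "instr list \<Rightarrow> nat list \<Rightarrow> nat \<Rightarrow> nat \<Rightarrow> bool" where
  "outputs_within P xs t y \<longleftrightarrow>
     (let s = (step P ^^ t) (initial xs) in halted P s \<and> fst (snd s) 0 = y)"

definition decides_within :: "instr list \<Rightarrow> nat list \<Rightarrow> nat \<Rightarrow> bool \<Rightarrow> bool" where
  "decides_within P xs t b \<longleftrightarrow> outputs_within P xs t (if b then 1 else 0)"

definition computable :: "(nat \<Rightarrow> nat) \<Rightarrow> bool" where
  "computable f \<longleftrightarrow> (\<exists>P. \<forall>x. \<exists>t. outputs_within P [x] t (f x))"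


section \<open>Capacitated vehicle routing\<close>

text \<open>Both problems share one type of instances, in which \<open>gas\<close> is \<^const>\<open>None\<close> for LoadCVRP and
  \<open>Some g\<close> for LoadGasCVRP. Edges are unordered pairs \<open>{u, v}\<close>. The values of \<open>weight\<close>
  outside the edges and of \<open>demand\<close> outside the clients are irrelevant.\<close>

record 'v cvrp =
  verts :: "'v set"
  edges :: "'v set set"
  weight :: "'v set \<Rightarrow> nat"
  depots :: "'v set"
  clients :: "'v set"
  vehicles :: nat
  capacity :: nat
  demand :: "'v \<Rightarrow> nat"
  gas :: "nat option"

text \<open>Loops are not excluded; simple graphs are the special case without them.\<close>

definition wf_cvrp :: "'v cvrp \<Rightarrow> bool" where
  "wf_cvrp I \<longleftrightarrow>
     finite (verts I) \<and>
     edges I \<subseteq> {{u, v} | u v. u \<in> verts I \<and> v \<in> verts I} \<and>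
     depots I \<subseteq> verts I \<and> depots I \<noteq> {} \<and>
     clients I \<subseteq> verts I \<and>
     (\<forall>c\<in>clients I. demand I c > 0)"

definition LoadCVRP :: "'v cvrp \<Rightarrow> bool" where
  "LoadCVRP I \<longleftrightarrow> wf_cvrp I \<and> gas I = None"

definition LoadGasCVRP :: "'v cvrp \<Rightarrow> bool" where
  "LoadGasCVRP I \<longleftrightarrow> wf_cvrp I \<and> (\<exists>g. gas I = Some g)"

definition no_zero_weight_edges :: "'v cvrp \<Rightarrow> bool" where
  "no_zero_weight_edges I \<longleftrightarrow> (\<forall>e\<in>edges I. weight I e \<noteq> 0)"

text \<open>A single vertex is a closed walk of weight 0.\<close>

definition walk :: "'v cvrp \<Rightarrow> 'v list \<Rightarrow> bool" where
  "walk I p \<longleftrightarrow> p \<noteq> [] \<and> set p \<subseteq> verts I \<and> successively (\<lambda>u v. {u, v} \<in> edges I) p"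

definition closed_walk :: "'v cvrp \<Rightarrow> 'v list \<Rightarrow> bool" where
  "closed_walk I p \<longleftrightarrow> walk I p \<and> hd p = last p"

definition walk_weight :: "'v cvrp \<Rightarrow> 'v list \<Rightarrow> nat" where
  "walk_weight I p = (\<Sum>i<length p - 1. weight I {p ! i, p ! Suc i})"

text \<open>The walks form a list, one entry per vehicle in use: two vehicles may take the same walk,
  which then counts twice for the weight. Vehicles are numbered from 0.\<close>

definition routing :: "'v cvrp \<Rightarrow> 'v list list \<Rightarrow> ('v \<Rightarrow> nat) \<Rightarrow> bool" where
  "routing I ps A \<longleftrightarrow>
     length ps \<le> vehicles I \<and>
     (\<forall>p\<in>set ps. closed_walk I p \<and> hd p \<in> depots I) \<and>
     (\<forall>c\<in>clients I. A c < length ps \<and> c \<in> set (ps ! A c)) \<and>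
     (\<forall>i<length ps. (\<Sum>c\<in>{c \<in> clients I. A c = i}. demand I c) \<le> capacity I) \<and>
     (\<forall>g. gas I = Some g \<longrightarrow> (\<forall>p\<in>set ps. walk_weight I p \<le> g))"

definition routing_weight :: "'v cvrp \<Rightarrow> 'v list list \<Rightarrow> nat" where
  "routing_weight I ps = (\<Sum>p\<leftarrow>ps. walk_weight I p)"

text \<open>
  The machine input for an instance whose vertices are listed, in any order, by \<open>vs\<close>, and for a
  weight bound \<open>r\<close>. A missing edge is stored as 0 and an edge of weight \<open>x\<close> as \<open>x + 1\<close>;
  demand 0 marks a vertex that is not a client.
\<close>

definition encode :: "'v list \<Rightarrow> 'v cvrp \<Rightarrow> nat \<Rightarrow> nat list" where
  "encode vs I r =
     [r, length vs, vehicles I, capacity I] @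
     (case gas I of None \<Rightarrow> [0, 0] | Some g \<Rightarrow> [1, g]) @
     map (\<lambda>v. if v \<in> depots I then 1 else 0) vs @
     map (\<lambda>v. if v \<in> clients I then demand I v else 0) vs @
     concat (map (\<lambda>u. map (\<lambda>v. if {u, v} \<in> edges I then weight I {u, v} + 1 else 0) vs) vs)"

end

theory Submission imports Defs begin

text \<open>
  Since edges have positive weight, a routing of weight at most \<open>r\<close> has at most \<open>r\<close> edges. Its walks
  of length 0 stay at a depot and serve at most the client there. So only a bounded number of clients
  is served on walks with edges; all clients that are not depots must be among them, and the question
  is how many depots can be served there in addition.

  The sequence of edge weights, services and ends of walks is guessed; it has length \<open>O(r)\<close> over an
  alphabet of size \<open>O(r)\<close>. For a fixed sequence a table over pairs of vertices with the least load
  of the current walk decides whether it can be realised, except that a depot might be served twice.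
  To prevent this without remembering the served vertices, one also guesses for each pair of
  services a bit position, out of \<open>O(log n)\<close>, at which the two vertex indices differ, and with which
  values. There are \<open>(r + log n) ^ O(r\<^sup>2)\<close> guesses, which is at most \<open>f(r) * n\<^sup>2\<close>.
\<close>

section \<open>Loop programs and their compilation\<close>

text \<open>A guess contains the weight of every edge, so total weight, gas and the numbers of walks
  and services can be read off its codes; of the numerical limits only the capacity depends on the
  vertices visited. For the load one minimum per pair of vertices suffices, since a smaller load
  passes every later test that a larger one passes. Distinctness is not local, and a table over sets
  of served vertices would have about n ^ (2 * r) entries; a function that vanishes on one served
  vertex and not on the other splits it into two tests, each on a single vertex. Guessing bit
  positions is cheap enough because (log n) ^ m is at most m ^ m * n: the exponent m, which depends
  on r, ends up in the factor that depends on r alone. If s clients are served on q closed walks,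
  the others take one vehicle each, so that card C - s + q vehicles are in use; this is how k
  enters. Demands and weights may be huge compared with n, so they are only added, subtracted and
  compared and never bound a loop; hence the time depends on r and n alone.\<close>

datatype exp = N nat | V nat | Plus exp exp | Minus exp exp | Mul exp nat | Mem exp

text \<open>Every loop is bounded by a variable read on entry, so all programs terminate, and effect
  and running time can both be defined by recursion on the syntax.\<close>

datatype com =
    Skip
  | Assign nat exp
  | Put nat exp exp
  | Seq com com (infixr ";;" 60)
  | Cond exp com com
  | For nat nat com

type_synonym state = "(nat \<Rightarrow> nat) \<times> (nat \<Rightarrow> nat)"

primrec ev :: "exp \<Rightarrow> state \<Rightarrow> nat" where
  "ev (N c) s = c"
| "ev (V x) s = fst s x"
| "ev (Plus a b) s = ev a s + ev b s"
| "ev (Minus a b) s = ev a s - ev b s"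
| "ev (Mul a z) s = ev a s * fst s z"
| "ev (Mem a) s = snd s (ev a s)"

text \<open>
  Variable 2 holds the length of the input; the memory above it is interleaved into three arrays:
  0 for the guess, 1 for the load table, 2 for the separating functions.
\<close>

definition cell :: "nat \<Rightarrow> nat \<Rightarrow> nat \<Rightarrow> nat" where
  "cell b a i = b + (i + i + i + a)"

definition adr :: "nat \<Rightarrow> exp \<Rightarrow> exp" where
  "adr a e = Plus (V 2) (Plus (Plus (Plus e e) e) (N a))"

definition Arr :: "nat \<Rightarrow> exp \<Rightarrow> exp" where
  "Arr a e = Mem (adr a e)"

lemma ev_adr [simp]: "ev (adr a e) s = cell (fst s 2) a (ev e s)"
  by (simp add: adr_def cell_def)

lemma ev_Arr [simp]: "ev (Arr a e) s = snd s (cell (fst s 2) a (ev e s))"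
  by (simp add: Arr_def)

lemma cell_eq_iff [simp]: "a < 3 \<Longrightarrow> a' < 3 \<Longrightarrow> cell b a i = cell b a' i' \<longleftrightarrow> a = a' \<and> i = i'"
  unfolding cell_def by presburger

lemma cell_neq [simp]: "x < b \<Longrightarrow> cell b a i \<noteq> x" "x < b \<Longrightarrow> x \<noteq> cell b a i"
  by (simp_all add: cell_def)

section \<open>Semantics and exact running time\<close>

primrec iter :: "(nat \<Rightarrow> 'a \<Rightarrow> 'a) \<Rightarrow> nat \<Rightarrow> 'a \<Rightarrow> 'a" where
  "iter f 0 s = s"
| "iter f (Suc i) s = f i (iter f i s)"

definition setv :: "nat \<Rightarrow> nat \<Rightarrow> state \<Rightarrow> state" where
  "setv x i s = ((fst s)(x := i), snd s)"

lemma fst_setv [simp]: "fst (setv x i s) = (fst s)(x := i)"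
  and snd_setv [simp]: "snd (setv x i s) = snd s"
  by (simp_all add: setv_def)

primrec den :: "com \<Rightarrow> state \<Rightarrow> state" where
  "den Skip s = s"
| "den (Assign x e) s = setv x (ev e s) s"
| "den (Put a e e') s = (fst s, (snd s)(cell (fst s 2) a (ev e s) := ev e' s))"
| "den (c ;; c') s = den c' (den c s)"
| "den (Cond e c c') s = (if ev e s \<noteq> 0 then den c s else den c' s)"
| "den (For x z c) s = iter (\<lambda>i s. den c (setv x i s)) (fst s z) s"

text \<open>Exact instruction counts for \<open>cexp\<close>. A copy takes two instructions because
  the machine has no move; a product costs 2 for initialising, 6 for each round of repeated addition
  and 1 for the final test.\<close>

primrec etm :: "exp \<Rightarrow> state \<Rightarrow> nat" where
  "etm (N c) s = 1"
| "etm (V x) s = 2"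
| "etm (Plus a b) s = etm a s + etm b s + 1"
| "etm (Minus a b) s = etm a s + etm b s + 1"
| "etm (Mul a z) s = etm a s + 3 + 6 * fst s z"
| "etm (Mem a) s = etm a s + 1"

text \<open>The matching counts for \<open>ccom\<close>. A round of a loop has 8 instructions
  besides its body: the test, five that update the counters and the loop variable, and two for the
  jump back. The 3 are two for initialising and the last test.\<close>

primrec tm :: "com \<Rightarrow> state \<Rightarrow> nat" where
  "tm Skip s = 0"
| "tm (Assign x e) s = etm e s + 2"
| "tm (Put a e e') s = etm (adr a e) s + etm e' s + 1"
| "tm (c ;; c') s = tm c s + tm c' (den c s)"
| "tm (Cond e c c') s = etm e s + (if ev e s \<noteq> 0 then tm c s + 3 else tm c' s + 1)"
| "tm (For x z c) s =
     3 + (\<Sum>i<fst s z. 8 + tm c (setv x i (iter (\<lambda>i s. den c (setv x i s)) i s)))"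

text \<open>
  Even registers hold the variables, so that the output register 0 is variable 0, and odd registers
  form the evaluation stack, on which an enclosing loop keeps its counter and its remaining rounds.
\<close>

definition var :: "nat \<Rightarrow> nat" where "var x = 2 * x"
definition tmp :: "nat \<Rightarrow> nat" where "tmp d = Suc (2 * d)"

lemma var_tmp [simp]:
  "var x = var y \<longleftrightarrow> x = y" "tmp d = tmp e \<longleftrightarrow> d = e" "var x \<noteq> tmp d" "tmp d \<noteq> var x"
  unfolding var_def tmp_def by presburger+

text \<open>Jump targets are absolute, hence the parameter \<open>a\<close> for the address of the
  first instruction; \<open>d\<close> is the stack slot that receives the value. An unconditional
  jump is a \<open>JumpZero\<close> on a register just set to 0.\<close>

primrec cexp :: "exp \<Rightarrow> nat \<Rightarrow> nat \<Rightarrow> instr list" where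
  "cexp (N c) d a = [Const (tmp d) c]"
| "cexp (V x) d a = [Const (tmp d) 0, Add (tmp d) (tmp d) (var x)]"
| "cexp (Plus e e') d a =
     (let p = cexp e d a in
      p @ cexp e' (Suc d) (a + length p) @ [Add (tmp d) (tmp d) (tmp (Suc d))])"
| "cexp (Minus e e') d a =
     (let p = cexp e d a in
      p @ cexp e' (Suc d) (a + length p) @ [Sub (tmp d) (tmp d) (tmp (Suc d))])"
| "cexp (Mul e z) d a =
     (let p = cexp e (Suc d) a; l = a + length p in
      p @ [Const (tmp d) 0, Add (tmp (d + 2)) (var z) (tmp d),
           JumpZero (tmp (d + 2)) (l + 8), Const (tmp (d + 3)) 1,
           Sub (tmp (d + 2)) (tmp (d + 2)) (tmp (d + 3)), Add (tmp d) (tmp d) (tmp (Suc d)),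
           Const (tmp (d + 3)) 0, JumpZero (tmp (d + 3)) (l + 2)])"
| "cexp (Mem e) d a = cexp e d a @ [Load (tmp d) (tmp d)]"

primrec ccom :: "com \<Rightarrow> nat \<Rightarrow> nat \<Rightarrow> instr list" where
  "ccom Skip d a = []"
| "ccom (Assign x e) d a = cexp e d a @ [Const (tmp (Suc d)) 0, Add (var x) (tmp d) (tmp (Suc d))]"
| "ccom (Put i e e') d a =
     (let p = cexp (adr i e) d a in
      p @ cexp e' (Suc d) (a + length p) @ [Store (tmp d) (tmp (Suc d))])"
| "ccom (c ;; c') d a = (let p = ccom c d a in p @ ccom c' d (a + length p))"
| "ccom (Cond e c c') d a =
     (let p = cexp e d a; q = ccom c d (a + length p + 1); l = a + length p + length q + 3;
          q' = ccom c' d l in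
      p @ [JumpZero (tmp d) l] @ q @ [Const (tmp d) 0, JumpZero (tmp d) (l + length q')] @ q')"
| "ccom (For x z c) d a =
     (let q = ccom c (d + 2) (a + 8) in
      [Const (tmp d) 0, Add (tmp (d + 1)) (var z) (tmp d),
       JumpZero (tmp (d + 1)) (a + length q + 10),
       Const (tmp (d + 2)) 1, Sub (tmp (d + 1)) (tmp (d + 1)) (tmp (d + 2)),
       Const (tmp (d + 3)) 0, Add (var x) (tmp d) (tmp (d + 3)),
       Add (tmp d) (tmp d) (tmp (d + 2))] @ q @
      [Const (tmp (d + 2)) 0, JumpZero (tmp (d + 2)) (a + 2)])"

section \<open>Correctness of the compiled code\<close>

definition code_at :: "instr list \<Rightarrow> nat \<Rightarrow> instr list \<Rightarrow> bool" where
  "code_at P a cs \<longleftrightarrow> (\<exists>u w. P = u @ cs @ w \<and> length u = a)"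

lemma code_at_append: "code_at P a (xs @ ys) \<Longrightarrow> code_at P a xs \<and> code_at P (a + length xs) ys"
  unfolding code_at_def by (metis append.assoc length_append)

lemma code_at_Cons: "code_at P a (i # xs) \<Longrightarrow> code_at P a [i] \<and> code_at P (Suc a) xs"
  using code_at_append[of P a "[i]" xs] by simp

definition reach :: "instr list \<Rightarrow> nat \<Rightarrow> config \<Rightarrow> config \<Rightarrow> bool" where
  "reach P t c c' \<longleftrightarrow> (step P ^^ t) c = c'"

lemma reach_refl: "reach P 0 c c"
  by (simp add: reach_def)

lemma reach_trans: "reach P s a b \<Longrightarrow> reach P t b c \<Longrightarrow> reach P (s + t) a c"
  by (auto simp: reach_def funpow_add add.commute[of s t])

lemma reach_instr:
  assumes "code_at P a [i]"
  shows "reach P 1 (a, R, M) (exec i (a, R, M))"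
proof -
  obtain u w where "P = u @ i # w" "length u = a"
    using assms by (auto simp: code_at_def)
  then show ?thesis
    by (auto simp: reach_def step_def halted_def)
qed

lemma reach_step:
  "code_at P a (i # is) \<Longrightarrow> reach P t (exec i (a, R, M)) c \<Longrightarrow> reach P (Suc t) (a, R, M) c"
  using reach_trans[OF reach_instr[of P a i R M], of t c] code_at_Cons[of P a i "is"] by simp

primrec no_jump :: "instr \<Rightarrow> bool" where
  "no_jump (Const i c) = True"
| "no_jump (Add i j k) = True"
| "no_jump (Sub i j k) = True"
| "no_jump (Load i j) = True"
| "no_jump (Store i j) = True"
| "no_jump (JumpZero i a) = False"

lemma fst_exec_no_jump: "no_jump i \<Longrightarrow> fst (exec i (a, R, M)) = Suc a"
  by (cases i) auto

text \<open>Only the last instruction may jump: up to there the program counter advances by one, so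
  execution is a fold.\<close>

lemma reach_fold:
  "code_at P a is \<Longrightarrow> list_all no_jump (butlast is) \<Longrightarrow>
   reach P (length is) (a, R, M) (fold exec is (a, R, M))"
proof (induction "is" arbitrary: a R M)
  case (Cons i js)
  show ?case
  proof (cases "js = []")
    case False
    obtain R' M' where e: "exec i (a, R, M) = (Suc a, R', M')"
      using fst_exec_no_jump[of i a R M] Cons.prems(2) False
      by (cases "exec i (a, R, M)") auto
    have "reach P (length js) (Suc a, R', M') (fold exec js (Suc a, R', M'))"
      using Cons.IH[of "Suc a" R' M'] Cons.prems code_at_Cons[of P a i js] False by simp
    then show ?thesis
      using reach_step[OF Cons.prems(1), of "length js" R M] e by simp
  qed (use Cons.prems reach_instr[of P a i R M] in simp)
qed (simp add: reach_refl)

definition vars_are :: "(nat \<Rightarrow> nat) \<Rightarrow> (nat \<Rightarrow> nat) \<Rightarrow> bool" where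
  "vars_are R \<sigma> \<longleftrightarrow> (\<forall>x. R (var x) = \<sigma> x)"

text \<open>The stack discipline: code working from slot \<open>d\<close> on leaves the slots below
  to the surrounding code, which keeps operands and loop counters there.\<close>

definition same_below :: "nat \<Rightarrow> (nat \<Rightarrow> nat) \<Rightarrow> (nat \<Rightarrow> nat) \<Rightarrow> bool" where
  "same_below d R R' \<longleftrightarrow> (\<forall>j<d. R' (tmp j) = R (tmp j))"

lemma vars_are_tmp [simp]: "vars_are (R(tmp d := x)) \<sigma> = vars_are R \<sigma>"
  by (simp add: vars_are_def)

lemma vars_are_var: "vars_are R \<sigma> \<Longrightarrow> vars_are (R(var x := y)) (\<sigma>(x := y))"
  by (simp add: vars_are_def)

lemma vars_areD: "vars_are R \<sigma> \<Longrightarrow> R (var x) = \<sigma> x"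
  by (simp add: vars_are_def)

lemma same_below_refl: "same_below d R R"
  by (simp add: same_below_def)

lemma same_below_trans: "same_below d R R' \<Longrightarrow> same_below d R' R'' \<Longrightarrow> same_below d R R''"
  by (simp add: same_below_def)

lemma same_below_Suc: "same_below (Suc d) R R' \<Longrightarrow> same_below d R R'"
  by (simp add: same_below_def)

lemma same_below_tmp [simp]: "d \<le> j \<Longrightarrow> same_below d R (R'(tmp j := x)) = same_below d R R'"
  by (auto simp: same_below_def)

lemma same_below_var [simp]: "same_below d R (R'(var j := x)) = same_below d R R'"
  by (auto simp: same_below_def)

text \<open>The accumulator \<open>tmp d\<close> starts with an arbitrary value, as the induction on
  the remaining rounds enters the loop in the middle.\<close>

lemma mul_loop:
  assumes "code_at P l [JumpZero (tmp (d + 2)) (l + 6), Const (tmp (d + 3)) 1,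
           Sub (tmp (d + 2)) (tmp (d + 2)) (tmp (d + 3)), Add (tmp d) (tmp d) (tmp (Suc d)),
           Const (tmp (d + 3)) 0, JumpZero (tmp (d + 3)) l]"
    and "R (tmp (d + 2)) = m"
  shows "\<exists>R'. reach P (6 * m + 1) (l, R, M) (l + 6, R', M) \<and>
      R' (tmp d) = R (tmp d) + R (tmp (Suc d)) * m \<and>
      (\<forall>\<sigma>. vars_are R \<sigma> \<longrightarrow> vars_are R' \<sigma>) \<and> same_below d R R'"
  using assms(2)
proof (induction m arbitrary: R)
  case 0
  have "reach P 1 (l, R, M) (l + 6, R, M)"
    using reach_instr[of P l _ R M] code_at_Cons[OF assms(1)] 0 by fastforce
  then show ?case
    by (auto simp: same_below_refl)
next
  case (Suc m)
  let ?R = "R(tmp (d + 3) := 0, tmp (d + 2) := m, tmp d := R (tmp d) + R (tmp (Suc d)))"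
  have "?R (tmp (d + 2)) = m"
    by simp
  from Suc.IH[of ?R, OF this] obtain R' where R': "reach P (6 * m + 1) (l, ?R, M) (l + 6, R', M)"
      "R' (tmp d) = ?R (tmp d) + ?R (tmp (Suc d)) * m"
      "\<forall>\<sigma>. vars_are ?R \<sigma> \<longrightarrow> vars_are R' \<sigma>" "same_below d ?R R'"
    by blast
  have one: "reach P 6 (l, R, M) (l, ?R, M)"
  proof -
    have "reach P 5 (Suc l, R, M) (l, ?R, M)"
      using reach_fold[OF conjunct2[OF code_at_Cons[OF assms(1)]], of R M] Suc.prems
      by (simp add: fun_upd_twist numeral_eq_Suc)
    then show ?thesis
      using reach_step[OF assms(1), of 5 R M] Suc.prems by simp
  qed
  show ?case
  proof (intro exI conjI)
    show "reach P (6 * Suc m + 1) (l, R, M) (l + 6, R', M)"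
      using reach_trans[OF one R'(1)] by (simp add: algebra_simps)
    show "R' (tmp d) = R (tmp d) + R (tmp (Suc d)) * Suc m"
      using R'(2) by simp
    show "\<forall>\<sigma>. vars_are R \<sigma> \<longrightarrow> vars_are R' \<sigma>"
      using R'(3) by simp
    show "same_below d R R'"
      using R'(4) by (simp add: same_below_def)
  qed
qed

lemma cexp_correct:
  assumes "code_at P a (cexp e d a)" "vars_are R (fst s)" "snd s = M"
  shows "\<exists>R'. reach P (etm e s) (a, R, M) (a + length (cexp e d a), R', M) \<and>
      R' (tmp d) = ev e s \<and> vars_are R' (fst s) \<and> same_below d R R'"
  using assms(1,2)
proof (induction e arbitrary: d a R)
  case (N c)
  then show ?case
    using reach_instr[of P a "Const (tmp d) c" R M]
    by (simp add: exI[where x = "R(tmp d := c)"] same_below_refl)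
next
  case (V x)
  then show ?case
    using reach_fold[of P a "cexp (V x) d a" R M]
    by (simp add: exI[where x = "R(tmp d := fst s x)"] same_below_refl vars_areD numeral_2_eq_2)
next
  case (Plus e1 e2)
  let ?p = "cexp e1 d a" and ?q = "cexp e2 (Suc d) (a + length (cexp e1 d a))"
  have c: "code_at P a ?p" "code_at P (a + length ?p) ?q"
      "code_at P (a + length ?p + length ?q) [Add (tmp d) (tmp d) (tmp (Suc d))]"
    using Plus.prems(1) by (auto simp: Let_def dest!: code_at_append)
  obtain R1 where R1: "reach P (etm e1 s) (a, R, M) (a + length ?p, R1, M)"
      "R1 (tmp d) = ev e1 s" "vars_are R1 (fst s)" "same_below d R R1"
    using Plus.IH(1)[OF c(1) Plus.prems(2)] by blast
  obtain R2 where R2: "reach P (etm e2 s) (a + length ?p, R1, M) (a + length ?p + length ?q, R2, M)"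
      "R2 (tmp (Suc d)) = ev e2 s" "vars_are R2 (fst s)" "same_below (Suc d) R1 R2"
    using Plus.IH(2)[OF c(2) R1(3)] by blast
  have "R2 (tmp d) = ev e1 s"
    using R2(4) R1(2) by (simp add: same_below_def)
  then show ?case
    using reach_trans[OF reach_trans[OF R1(1) R2(1)] reach_instr[OF c(3)]] R2
      same_below_trans[OF R1(4) same_below_Suc[OF R2(4)]]
    by (simp add: exI[where x = "R2(tmp d := ev e1 s + ev e2 s)"] Let_def add.assoc)
next
  case (Minus e1 e2)
  let ?p = "cexp e1 d a" and ?q = "cexp e2 (Suc d) (a + length (cexp e1 d a))"
  have c: "code_at P a ?p" "code_at P (a + length ?p) ?q"
      "code_at P (a + length ?p + length ?q) [Sub (tmp d) (tmp d) (tmp (Suc d))]"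
    using Minus.prems(1) by (auto simp: Let_def dest!: code_at_append)
  obtain R1 where R1: "reach P (etm e1 s) (a, R, M) (a + length ?p, R1, M)"
      "R1 (tmp d) = ev e1 s" "vars_are R1 (fst s)" "same_below d R R1"
    using Minus.IH(1)[OF c(1) Minus.prems(2)] by blast
  obtain R2 where R2: "reach P (etm e2 s) (a + length ?p, R1, M) (a + length ?p + length ?q, R2, M)"
      "R2 (tmp (Suc d)) = ev e2 s" "vars_are R2 (fst s)" "same_below (Suc d) R1 R2"
    using Minus.IH(2)[OF c(2) R1(3)] by blast
  have "R2 (tmp d) = ev e1 s"
    using R2(4) R1(2) by (simp add: same_below_def)
  then show ?case
    using reach_trans[OF reach_trans[OF R1(1) R2(1)] reach_instr[OF c(3)]] R2
      same_below_trans[OF R1(4) same_below_Suc[OF R2(4)]]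
    by (simp add: exI[where x = "R2(tmp d := ev e1 s - ev e2 s)"] Let_def add.assoc)
next
  case (Mul e z)
  let ?p = "cexp e (Suc d) a"
  define l where "l = a + length ?p"
  have c: "code_at P a ?p" "code_at P l [Const (tmp d) 0, Add (tmp (d + 2)) (var z) (tmp d)]"
      "code_at P (l + 2) [JumpZero (tmp (d + 2)) (l + 2 + 6), Const (tmp (d + 3)) 1,
        Sub (tmp (d + 2)) (tmp (d + 2)) (tmp (d + 3)), Add (tmp d) (tmp d) (tmp (Suc d)),
        Const (tmp (d + 3)) 0, JumpZero (tmp (d + 3)) (l + 2)]"
    using Mul.prems(1) code_at_append[of P l "[Const (tmp d) 0, Add (tmp (d + 2)) (var z) (tmp d)]"]
    by (auto simp: Let_def l_def add.assoc add.commute[of 8] dest!: code_at_append)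
  obtain R1 where R1: "reach P (etm e s) (a, R, M) (l, R1, M)"
      "R1 (tmp (Suc d)) = ev e s" "vars_are R1 (fst s)" "same_below (Suc d) R R1"
    using Mul.IH[OF c(1) Mul.prems(2)] by (auto simp: l_def)
  let ?R2 = "R1(tmp d := 0, tmp (d + 2) := fst s z)"
  have 2: "reach P 2 (l, R1, M) (l + 2, ?R2, M)"
    using reach_fold[OF c(2), of R1 M] R1(3) by (simp add: vars_areD numeral_2_eq_2)
  have "?R2 (tmp (d + 2)) = fst s z"
    by simp
  from mul_loop[OF c(3), of ?R2, OF this, of M] obtain R3 where
    R3: "reach P (6 * fst s z + 1) (l + 2, ?R2, M) (l + 2 + 6, R3, M)"
      "R3 (tmp d) = ev e s * fst s z" "vars_are R3 (fst s)" "same_below d ?R2 R3"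
    using R1(2,3) by auto
  have "same_below d R R3"
    using R3(4) same_below_Suc[OF R1(4)] by (simp add: same_below_def)
  moreover have "reach P (etm (Mul e z) s) (a, R, M) (a + length (cexp (Mul e z) d a), R3, M)"
    using reach_trans[OF reach_trans[OF R1(1) 2] R3(1)]
    by (simp add: Let_def l_def algebra_simps numeral_eq_Suc)
  ultimately show ?case
    using R3 by auto
next
  case (Mem e)
  let ?p = "cexp e d a"
  have c: "code_at P a ?p" "code_at P (a + length ?p) [Load (tmp d) (tmp d)]"
    using Mem.prems(1) by (auto dest!: code_at_append)
  obtain R1 where R1: "reach P (etm e s) (a, R, M) (a + length ?p, R1, M)"
      "R1 (tmp d) = ev e s" "vars_are R1 (fst s)" "same_below d R R1"
    using Mem.IH[OF c(1) Mem.prems(2)] by blast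
  then show ?case
    using reach_trans[OF R1(1) reach_instr[OF c(2)]] assms(3)
    by (simp add: exI[where x = "R1(tmp d := M (ev e s))"])
qed

lemma ccom_correct:
  assumes "code_at P a (ccom c d a)" "vars_are R (fst s)"
  shows "\<exists>R'. reach P (tm c s) (a, R, snd s) (a + length (ccom c d a), R', snd (den c s)) \<and>
      vars_are R' (fst (den c s)) \<and> same_below d R R'"
  using assms
proof (induction c arbitrary: d a R s)
  case Skip
  then show ?case
    by (intro exI[of _ R]) (simp add: reach_refl same_below_refl)
next
  case (Assign x e)
  let ?p = "cexp e d a"
  have c: "code_at P a ?p"
      "code_at P (a + length ?p) [Const (tmp (Suc d)) 0, Add (var x) (tmp d) (tmp (Suc d))]"
    using Assign.prems(1) by (auto dest!: code_at_append)
  obtain R1 where R1: "reach P (etm e s) (a, R, snd s) (a + length ?p, R1, snd s)"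
      "R1 (tmp d) = ev e s" "vars_are R1 (fst s)" "same_below d R R1"
    using cexp_correct[OF c(1) Assign.prems(2) refl] by blast
  let ?R = "R1(tmp (Suc d) := 0, var x := ev e s)"
  have "vars_are ?R (fst (den (Assign x e) s))"
    using vars_are_var[of "R1(tmp (Suc d) := 0)" "fst s" x "ev e s"] R1(3) by simp
  moreover have "same_below d R ?R"
    using R1(4) by simp
  moreover have "reach P (tm (Assign x e) s) (a, R, snd s)
      (a + length (ccom (Assign x e) d a), ?R, snd (den (Assign x e) s))"
    using reach_trans[OF R1(1) reach_fold[OF c(2), of R1 "snd s"]] R1(2) by simp
  ultimately show ?case
    by blast
next
  case (Put i e1 e2)
  let ?p = "cexp (adr i e1) d a" and ?q = "cexp e2 (Suc d) (a + length (cexp (adr i e1) d a))"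
  have c: "code_at P a ?p" "code_at P (a + length ?p) ?q"
      "code_at P (a + length ?p + length ?q) [Store (tmp d) (tmp (Suc d))]"
    using Put.prems(1) by (auto simp: Let_def dest!: code_at_append)
  obtain R1 where R1: "reach P (etm (adr i e1) s) (a, R, snd s) (a + length ?p, R1, snd s)"
      "R1 (tmp d) = ev (adr i e1) s" "vars_are R1 (fst s)" "same_below d R R1"
    using cexp_correct[OF c(1) Put.prems(2) refl] by blast
  obtain R2 where R2:
      "reach P (etm e2 s) (a + length ?p, R1, snd s) (a + length ?p + length ?q, R2, snd s)"
      "R2 (tmp (Suc d)) = ev e2 s" "vars_are R2 (fst s)" "same_below (Suc d) R1 R2"
    using cexp_correct[OF c(2) R1(3) refl] by blast
  have "R2 (tmp d) = ev (adr i e1) s"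
    using R2(4) R1(2) by (simp add: same_below_def)
  then have "reach P (tm (Put i e1 e2) s) (a, R, snd s)
      (a + length (ccom (Put i e1 e2) d a), R2, snd (den (Put i e1 e2) s))"
    using reach_trans[OF reach_trans[OF R1(1) R2(1)] reach_instr[OF c(3)]] R2(2)
    by (simp add: Let_def add.assoc)
  moreover have "same_below d R R2"
    using same_below_trans[OF R1(4) same_below_Suc[OF R2(4)]] .
  moreover have "vars_are R2 (fst (den (Put i e1 e2) s))"
    using R2(3) by simp
  ultimately show ?case
    by blast
next
  case (Seq c1 c2)
  let ?p = "ccom c1 d a"
  have c: "code_at P a ?p" "code_at P (a + length ?p) (ccom c2 d (a + length ?p))"
    using Seq.prems(1) by (auto simp: Let_def dest!: code_at_append)
  obtain R1 where R1: "reach P (tm c1 s) (a, R, snd s) (a + length ?p, R1, snd (den c1 s))"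
      "vars_are R1 (fst (den c1 s))" "same_below d R R1"
    using Seq.IH(1)[OF c(1) Seq.prems(2)] by blast
  obtain R2 where R2: "reach P (tm c2 (den c1 s)) (a + length ?p, R1, snd (den c1 s))
        (a + length ?p + length (ccom c2 d (a + length ?p)), R2, snd (den c2 (den c1 s)))"
      "vars_are R2 (fst (den c2 (den c1 s)))" "same_below d R1 R2"
    using Seq.IH(2)[OF c(2) R1(2)] by blast
  show ?case
    using reach_trans[OF R1(1) R2(1)] R2 same_below_trans[OF R1(3) R2(3)]
    by (intro exI[of _ R2]) (simp add: Let_def add.assoc)
next
  case (Cond e c1 c2)
  let ?p = "cexp e d a"
  let ?q = "ccom c1 d (a + length ?p + 1)"
  let ?l = "a + length ?p + length ?q + 3"
  let ?r = "ccom c2 d ?l"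
  have c: "code_at P a ?p" "code_at P (a + length ?p) [JumpZero (tmp d) ?l]"
      "code_at P (a + length ?p + 1) ?q"
      "code_at P (a + length ?p + 1 + length ?q) [Const (tmp d) 0, JumpZero (tmp d) (?l + length ?r)]"
      "code_at P ?l ?r"
  proof -
    have "code_at P a (?p @ [JumpZero (tmp d) ?l] @ ?q @
        [Const (tmp d) 0, JumpZero (tmp d) (?l + length ?r)] @ ?r)"
      using Cond.prems(1) by (simp add: Let_def)
    from code_at_append[OF this] have 1: "code_at P a ?p"
      and 2: "code_at P (a + length ?p) ([JumpZero (tmp d) ?l] @ ?q @
        [Const (tmp d) 0, JumpZero (tmp d) (?l + length ?r)] @ ?r)"
      by blast+
    from code_at_append[OF 2] have 3: "code_at P (a + length ?p) [JumpZero (tmp d) ?l]"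
      and 4: "code_at P (a + length ?p + 1) (?q @
        [Const (tmp d) 0, JumpZero (tmp d) (?l + length ?r)] @ ?r)"
      by simp_all
    from code_at_append[OF 4] have 5: "code_at P (a + length ?p + 1) ?q"
      and 6: "code_at P (a + length ?p + 1 + length ?q)
        ([Const (tmp d) 0, JumpZero (tmp d) (?l + length ?r)] @ ?r)"
      by blast+
    from code_at_append[OF 6] 1 3 5 show
      "code_at P a ?p" "code_at P (a + length ?p) [JumpZero (tmp d) ?l]"
      "code_at P (a + length ?p + 1) ?q"
      "code_at P (a + length ?p + 1 + length ?q) [Const (tmp d) 0, JumpZero (tmp d) (?l + length ?r)]"
      "code_at P ?l ?r"
      by (simp_all add: numeral_eq_Suc)
  qed
  obtain R1 where R1: "reach P (etm e s) (a, R, snd s) (a + length ?p, R1, snd s)"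
      "R1 (tmp d) = ev e s" "vars_are R1 (fst s)" "same_below d R R1"
    using cexp_correct[OF c(1) Cond.prems(2) refl] by blast
  note 1 = reach_trans[OF R1(1) reach_instr[OF c(2)]]
  show ?case
  proof (cases "ev e s = 0")
    case True
    obtain R2 where R2: "reach P (tm c2 s) (?l, R1, snd s) (?l + length ?r, R2, snd (den c2 s))"
        "vars_are R2 (fst (den c2 s))" "same_below d R1 R2"
      using Cond.IH(2)[OF c(5) R1(3)] by blast
    show ?thesis
      using reach_trans[OF 1, of "tm c2 s"] R2 same_below_trans[OF R1(4) R2(3)] True R1(2)
      by (intro exI[of _ R2]) (simp add: Let_def add.assoc add.commute add.left_commute numeral_eq_Suc)
  next
    case False
    obtain R2 where R2: "reach P (tm c1 s) (a + length ?p + 1, R1, snd s)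
          (a + length ?p + 1 + length ?q, R2, snd (den c1 s))"
        "vars_are R2 (fst (den c1 s))" "same_below d R1 R2"
      using Cond.IH(1)[OF c(3) R1(3)] by blast
    have "reach P (etm e s + 1 + tm c1 s) (a, R, snd s)
        (a + length ?p + 1 + length ?q, R2, snd (den c1 s))"
      using reach_trans[OF 1, of "tm c1 s"] R2(1) False R1(2) by simp
    from reach_trans[OF this reach_fold[OF c(4), of R2 "snd (den c1 s)"]]
    show ?thesis
      using R2 same_below_trans[OF R1(4) R2(3)] False
      by (simp add: exI[where x = "R2(tmp d := 0)"] Let_def add.assoc add.commute add.left_commute numeral_eq_Suc)
  qed
next
  case (For x z c)
  let ?q = "ccom c (d + 2) (a + 8)"
  let ?n = "fst s z"
  let ?it = "\<lambda>i. iter (\<lambda>i s. den c (setv x i s)) i s"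
  let ?T = "\<lambda>j. \<Sum>i<j. 8 + tm c (setv x i (?it i))"
  define hd1 where "hd1 = [Const (tmp d) 0, Add (tmp (d + 1)) (var z) (tmp d)]"
  define hd2 where "hd2 = [Const (tmp (d + 2)) 1, Sub (tmp (d + 1)) (tmp (d + 1)) (tmp (d + 2)),
       Const (tmp (d + 3)) 0, Add (var x) (tmp d) (tmp (d + 3)),
       Add (tmp d) (tmp d) (tmp (d + 2))]"
  define tl where "tl = [Const (tmp (d + 2)) 0, JumpZero (tmp (d + 2)) (a + 2)]"
  let ?jz = "JumpZero (tmp (d + 1)) (a + length ?q + 10)"
  have len: "length hd1 = 2" "length hd2 = 5"
    by (simp_all add: hd1_def hd2_def)
  have c: "code_at P a hd1" "code_at P (a + 2) [?jz]" "code_at P (a + 3) hd2"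
    "code_at P (a + 8) ?q" "code_at P (a + 8 + length ?q) tl"
  proof -
    have 1: "code_at P a (hd1 @ [?jz] @ hd2 @ ?q @ tl)"
      using For.prems(1) by (simp add: Let_def hd1_def hd2_def tl_def)
    from code_at_append[OF 1] len have 2: "code_at P (a + 2) ([?jz] @ hd2 @ ?q @ tl)"
      by simp
    from code_at_append[OF 2] have 3: "code_at P (a + 3) (hd2 @ ?q @ tl)"
      by (simp add: numeral_eq_Suc)
    from code_at_append[OF 3] len have 4: "code_at P (a + 8) (?q @ tl)"
      by (simp add: add.assoc)
    from code_at_append[OF 1] code_at_append[OF 2] code_at_append[OF 3] code_at_append[OF 4]
    show "code_at P a hd1" "code_at P (a + 2) [?jz]" "code_at P (a + 3) hd2"
      "code_at P (a + 8) ?q" "code_at P (a + 8 + length ?q) tl"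
      by blast+
  qed
  \<comment> \<open>The invariant at the loop test after \<open>j\<close> rounds. Counter and
    remaining rounds sit in slots \<open>d\<close> and \<open>d + 1\<close>, below those of the
    body, so the number of rounds is unaffected if the body assigns \<open>x\<close> or
    \<open>z\<close>.\<close>
  have loop: "\<exists>R'. reach P (2 + ?T j) (a, R, snd s) (a + 2, R', snd (?it j)) \<and>
      vars_are R' (fst (?it j)) \<and> same_below d R R' \<and> R' (tmp d) = j \<and> R' (tmp (d + 1)) = ?n - j"
    if "j \<le> ?n" for j
    using that
  proof (induction j)
    case 0
    show ?case
      using reach_fold[OF c(1), of R "snd s"] For.prems(2)
      by (simp add: exI[where x = "R(tmp d := 0, tmp (d + 1) := ?n)"] hd1_def vars_areD numeral_2_eq_2 same_below_refl)
  next
    case (Suc j)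
    then obtain R1 where R1: "reach P (2 + ?T j) (a, R, snd s) (a + 2, R1, snd (?it j))"
        "vars_are R1 (fst (?it j))" "same_below d R R1" "R1 (tmp d) = j" "R1 (tmp (d + 1)) = ?n - j"
      by auto
    let ?s = "setv x j (?it j)"
    let ?R2 = "R1(tmp (d + 2) := 1, tmp (d + 1) := ?n - Suc j, tmp (d + 3) := 0, var x := j,
        tmp d := Suc j)"
    have v: "vars_are ?R2 (fst ?s)"
      using R1(2) by (simp add: vars_are_def)
    have 2: "reach P 1 (a + 2, R1, snd (?it j)) (a + 3, R1, snd ?s)"
      using reach_instr[OF c(2), of R1 "snd (?it j)"] R1(5) Suc.prems by (simp add: numeral_eq_Suc)
    have 3: "reach P 5 (a + 3, R1, snd ?s) (a + 8, ?R2, snd ?s)"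
      using reach_fold[OF c(3), of R1 "snd ?s"] R1(4,5)
      by (simp add: hd2_def numeral_eq_Suc)
    obtain R3 where R3: "reach P (tm c ?s) (a + 8, ?R2, snd ?s)
          (a + 8 + length ?q, R3, snd (den c ?s))"
        "vars_are R3 (fst (den c ?s))" "same_below (d + 2) ?R2 R3"
      using For.IH[OF c(4) v] by blast
    let ?R4 = "R3(tmp (d + 2) := 0)"
    have 4: "reach P 2 (a + 8 + length ?q, R3, snd (den c ?s)) (a + 2, ?R4, snd (den c ?s))"
      using reach_fold[OF c(5), of R3 "snd (den c ?s)"]
      by (simp add: tl_def numeral_2_eq_2)
    have "reach P (2 + ?T (Suc j)) (a, R, snd s) (a + 2, ?R4, snd (?it (Suc j)))"
      using reach_trans[OF reach_trans[OF reach_trans[OF reach_trans[OF R1(1) 2] 3] R3(1)] 4]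
      by (simp add: algebra_simps)
    moreover have "same_below d R ?R4"
      using R3(3) R1(3) by (auto simp: same_below_def)
    moreover have "?R4 (tmp d) = Suc j" "?R4 (tmp (d + 1)) = ?n - Suc j"
      using R3(3) by (auto simp: same_below_def)
    moreover have "vars_are ?R4 (fst (?it (Suc j)))"
      using R3(2) by simp
    ultimately show ?case
      by blast
  qed
  obtain R1 where R1: "reach P (2 + ?T ?n) (a, R, snd s) (a + 2, R1, snd (?it ?n))"
      "vars_are R1 (fst (?it ?n))" "same_below d R R1" "R1 (tmp (d + 1)) = 0"
    using loop[of ?n] by auto
  show ?case
    using reach_trans[OF R1(1) reach_instr[OF c(2), of R1]] R1(2-4)
    by (intro exI[of _ R1]) (simp add: Let_def algebra_simps numeral_eq_Suc)
qed

text \<open>Compiled code halts by running past its own end, where further steps change nothing, so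
  any upper bound on the exact time will do. All registers start as 0, which makes all variables
  0.\<close>

lemma outputs_within_ccom:
  assumes "s = ((\<lambda>_. 0), (\<lambda>i. if i < length xs then xs ! i else 0))" "tm c s \<le> t"
  shows "outputs_within (ccom c 0 0) xs t (fst (den c s) 0)"
proof -
  let ?P = "ccom c 0 0"
  have "code_at ?P 0 ?P"
    by (auto simp: code_at_def)
  moreover have "vars_are (\<lambda>_. 0) (fst s)"
    by (simp add: vars_are_def assms(1))
  ultimately obtain R where R:
    "reach ?P (tm c s) (0, (\<lambda>_. 0), snd s) (length ?P, R, snd (den c s))"
    "vars_are R (fst (den c s))"
    using ccom_correct[of ?P 0 c 0 "\<lambda>_. 0" s] by auto
  have halt: "reach ?P u (length ?P, R, M) (length ?P, R, M)" for u M
    unfolding reach_def by (induction u) (auto simp: step_def halted_def)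
  have "reach ?P t (initial xs) (length ?P, R, snd (den c s))"
    using reach_trans[OF R(1) halt, of "t - tm c s"] assms by (simp add: initial_def)
  then show ?thesis
    using vars_areD[OF R(2), of 0]
    by (simp add: outputs_within_def reach_def halted_def var_def)
qed

section \<open>Frame conditions and loop invariants\<close>

primrec wr :: "com \<Rightarrow> nat set" where
  "wr Skip = {}"
| "wr (Assign x e) = {x}"
| "wr (Put a e e') = {}"
| "wr (c ;; c') = wr c \<union> wr c'"
| "wr (Cond e c c') = wr c \<union> wr c'"
| "wr (For x z c) = insert x (wr c)"

primrec awr :: "com \<Rightarrow> nat set" where
  "awr Skip = {}"
| "awr (Assign x e) = {}"
| "awr (Put a e e') = {a}"
| "awr (c ;; c') = awr c \<union> awr c'"
| "awr (Cond e c c') = awr c \<union> awr c'"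
| "awr (For x z c) = awr c"

lemma den_wr: "x \<notin> wr c \<Longrightarrow> fst (den c s) x = fst s x"
proof (induction c arbitrary: s)
  case (For y z c)
  have "fst (iter (\<lambda>i s. den c (setv y i s)) n s) x = fst s x" for n
    using For by (induction n) auto
  then show ?case
    by simp
qed auto

text \<open>Variable 2 is the base address of the arrays, so it has to stay fixed; array cells lie
  at or above it, and array numbers below 3 keep the three arrays disjoint.\<close>

lemma den_awr:
  assumes "2 \<notin> wr c" "\<And>a. a \<in> awr c \<Longrightarrow> a < 3" "b = fst s 2"
  shows "a < 3 \<Longrightarrow> a \<notin> awr c \<Longrightarrow> snd (den c s) (cell b a i) = snd s (cell b a i)"
    and "x < b \<Longrightarrow> snd (den c s) x = snd s x"
proof -
  have "(a < 3 \<longrightarrow> a \<notin> awr c \<longrightarrow> snd (den c s) (cell b a i) = snd s (cell b a i)) \<and>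
        (x < b \<longrightarrow> snd (den c s) x = snd s x)"
    using assms
  proof (induction c arbitrary: s)
    case (Seq c1 c2)
    then show ?case
      using Seq.IH(1)[of s] Seq.IH(2)[of "den c1 s"] den_wr[of 2 c1 s] by simp
  next
    case (For y z c)
    let ?it = "\<lambda>n. iter (\<lambda>i s. den c (setv y i s)) n s"
    have "fst (?it n) 2 = b \<and>
       (a < 3 \<longrightarrow> a \<notin> awr c \<longrightarrow> snd (?it n) (cell b a i) = snd s (cell b a i)) \<and>
        (x < b \<longrightarrow> snd (?it n) x = snd s x)" for n
    proof (induction n)
      case (Suc n)
      have "fst (setv y n (?it n)) 2 = b"
        using Suc For.prems by auto
      with Suc For.IH[of "setv y n (?it n)"] For.prems den_wr[of 2 c "setv y n (?it n)"]
      show ?case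
        by auto
    qed (use For.prems in simp)
    from this[of "fst s z"] show ?case
      by simp
  qed auto
  then show "a < 3 \<Longrightarrow> a \<notin> awr c \<Longrightarrow> snd (den c s) (cell b a i) = snd s (cell b a i)"
    and "x < b \<Longrightarrow> snd (den c s) x = snd s x"
    by blast+
qed

lemma den_For_induct:
  assumes "Q 0 s" "\<And>i t. i < fst s z \<Longrightarrow> Q i t \<Longrightarrow> Q (Suc i) (den c (setv x i t))"
  shows "Q (fst s z) (den (For x z c) s)"
proof -
  have "Q j (iter (\<lambda>i s. den c (setv x i s)) j s)" if "j \<le> fst s z" for j
    using that by (induction j) (use assms in auto)
  then show ?thesis
    by simp
qed

subsection \<open>Time bounds for loop programs\<close>

text \<open>
  Loop bounds and multipliers are variables: if those in \<open>Z\<close> are never assigned and are at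
  most \<open>B\<close>, the time is polynomial in \<open>B\<close> with degree the nesting depth.
\<close>

primrec ebounded :: "nat set \<Rightarrow> exp \<Rightarrow> bool" where
  "ebounded Z (N c) = True"
| "ebounded Z (V x) = True"
| "ebounded Z (Plus a b) = (ebounded Z a \<and> ebounded Z b)"
| "ebounded Z (Minus a b) = (ebounded Z a \<and> ebounded Z b)"
| "ebounded Z (Mul a z) = (z \<in> Z \<and> ebounded Z a)"
| "ebounded Z (Mem a) = ebounded Z a"

primrec cbounded :: "nat set \<Rightarrow> com \<Rightarrow> bool" where
  "cbounded Z Skip = True"
| "cbounded Z (Assign x e) = (x \<notin> Z \<and> ebounded Z e)"
| "cbounded Z (Put a e e') = (ebounded Z e \<and> ebounded Z e')"
| "cbounded Z (c ;; c') = (cbounded Z c \<and> cbounded Z c')"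
| "cbounded Z (Cond e c c') = (ebounded Z e \<and> cbounded Z c \<and> cbounded Z c')"
| "cbounded Z (For x z c) = (x \<notin> Z \<and> z \<in> Z \<and> cbounded Z c)"

lemma cbounded_wr: "cbounded Z c \<Longrightarrow> z \<in> Z \<Longrightarrow> z \<notin> wr c"
  by (induction c) auto

primrec ecost :: "exp \<Rightarrow> nat" where
  "ecost (N c) = 1"
| "ecost (V x) = 2"
| "ecost (Plus a b) = ecost a + ecost b + 1"
| "ecost (Minus a b) = ecost a + ecost b + 1"
| "ecost (Mul a z) = ecost a + 9"
| "ecost (Mem a) = ecost a + 1"

lemma etm_le: "ebounded Z e \<Longrightarrow> \<forall>z\<in>Z. fst s z \<le> B \<Longrightarrow> 0 < B \<Longrightarrow> etm e s \<le> ecost e * B"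
proof (induction e)
  case (Mul e z)
  then have "etm e s \<le> ecost e * B" "fst s z \<le> B" "3 \<le> 3 * B"
    by auto
  then show ?case
    by (simp add: add_mult_distrib)
qed (auto simp: add_mult_distrib intro!: add_mono)

primrec ccost :: "com \<Rightarrow> nat" where
  "ccost Skip = 1"
| "ccost (Assign x e) = ecost e + 2"
| "ccost (Put a e e') = ecost (adr a e) + ecost e' + 1"
| "ccost (c ;; c') = ccost c + ccost c'"
| "ccost (Cond e c c') = ecost e + ccost c + ccost c' + 4"
| "ccost (For x z c) = 11 + ccost c"

text \<open>Loop-free code gets degree 1, since a multiplication inside an expression takes time
  linear in the multiplier.\<close>

primrec depth :: "com \<Rightarrow> nat" where
  "depth Skip = 1"
| "depth (Assign x e) = 1"
| "depth (Put a e e') = 1"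
| "depth (c ;; c') = max (depth c) (depth c')"
| "depth (Cond e c c') = max (depth c) (depth c')"
| "depth (For x z c) = Suc (depth c)"

lemma depth_pos: "0 < depth c"
  by (induction c) auto

lemma tm_le:
  "cbounded Z c \<Longrightarrow> \<forall>z\<in>Z. fst s z \<le> B \<Longrightarrow> 0 < B \<Longrightarrow> tm c s \<le> ccost c * B ^ depth c"
proof (induction c arbitrary: s)
  case (Put a e e')
  have "ebounded Z (adr a e)"
    using Put by (simp add: adr_def)
  then show ?case
    using Put etm_le[of Z "adr a e" s B] etm_le[of Z e' s B] by (simp add: add_mult_distrib)
next
  case (Seq c1 c2)
  have le: "B ^ depth c1 \<le> B ^ max (depth c1) (depth c2)" "B ^ depth c2 \<le> B ^ max (depth c1) (depth c2)"
    using Seq.prems by (auto intro!: power_increasing)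
  have "\<forall>z\<in>Z. fst (den c1 s) z \<le> B"
    using Seq.prems by (auto simp: den_wr cbounded_wr)
  then have "tm c1 s \<le> ccost c1 * B ^ depth c1" "tm c2 (den c1 s) \<le> ccost c2 * B ^ depth c2"
    using Seq by auto
  then have "tm c1 s \<le> ccost c1 * B ^ max (depth c1) (depth c2)"
    "tm c2 (den c1 s) \<le> ccost c2 * B ^ max (depth c1) (depth c2)"
    using le by (meson le_trans mult_le_mono2)+
  then show ?case
    by (simp add: add_mult_distrib)
next
  case (Cond e c1 c2)
  let ?D = "max (depth c1) (depth c2)"
  have le: "B ^ depth c1 \<le> B ^ ?D" "B ^ depth c2 \<le> B ^ ?D" "B ^ 1 \<le> B ^ ?D" "1 \<le> B ^ ?D"
    using Cond.prems depth_pos[of c1] by (intro power_increasing one_le_power; simp)+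
  have "tm c1 s \<le> ccost c1 * B ^ depth c1" "tm c2 s \<le> ccost c2 * B ^ depth c2"
    "etm e s \<le> ecost e * B ^ 1"
    using Cond etm_le[of Z e s B] by auto
  then have "tm c1 s \<le> ccost c1 * B ^ ?D" "tm c2 s \<le> ccost c2 * B ^ ?D"
    "etm e s \<le> ecost e * B ^ ?D"
    using le by (meson le_trans mult_le_mono2)+
  then show ?case
    using le(4) by (auto simp: add_mult_distrib)
next
  case (For x z c)
  let ?it = "\<lambda>i. iter (\<lambda>i s. den c (setv x i s)) i s"
  have it: "\<forall>y\<in>Z. fst (?it i) y \<le> B" for i
    using For.prems cbounded_wr[of Z c] by (induction i) (auto simp: den_wr)
  have "(\<Sum>i<fst s z. 8 + tm c (setv x i (?it i))) \<le> (\<Sum>i<fst s z. 8 + ccost c * B ^ depth c)"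
    using For.prems it by (intro sum_mono add_left_mono For.IH) auto
  also have "\<dots> = fst s z * (8 + ccost c * B ^ depth c)"
    by simp
  also have "\<dots> \<le> B * (8 * B ^ depth c + ccost c * B ^ depth c)"
    using For.prems by (intro mult_mono add_right_mono) auto
  finally have "tm (For x z c) s \<le> 3 + B * (8 * B ^ depth c + ccost c * B ^ depth c)"
    by simp
  \<comment> \<open>As \<open>B\<close> is positive, the constants 3 and 8 can be multiplied by
    powers of \<open>B\<close>; their sum is the 11 in \<open>ccost\<close>.\<close>
  also have "\<dots> \<le> 3 * B ^ Suc (depth c) + B * (8 * B ^ depth c + ccost c * B ^ depth c)"
    using one_le_power[of B "Suc (depth c)"] For.prems by (intro add_right_mono) auto
  also have "\<dots> = ccost (For x z c) * B ^ depth (For x z c)"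
    by (simp add: algebra_simps)
  finally show ?case .
next
  case (Assign x e)
  then show ?case
    using etm_le[of Z e s B] by (simp add: add_mult_distrib)
qed auto

section \<open>Guesses and the load table\<close>

text \<open>The instance with vertices replaced by indices. On edges \<open>adj\<close> is the
  weight plus 1, so \<open>adj_neq_1\<close> says that no edge has weight 0; \<open>gb\<close>
  limits the weight of each walk. \<open>separated\<close> concerns ordered pairs: the function must
  vanish on the one and not on the other. \<open>Q\<close> is the base in which guesses are written,
  and \<open>Q_ge\<close> makes room for the largest move code \<open>r + 3\<close>.\<close>

locale inst =
  fixes n k cap gb r :: nat
    and dep :: "nat \<Rightarrow> bool" and dem :: "nat \<Rightarrow> nat" and adj :: "nat \<Rightarrow> nat \<Rightarrow> nat"
    and phi :: "nat \<Rightarrow> nat \<Rightarrow> nat" and Q :: nat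
  assumes depot_ex: "\<exists>d<n. dep d"
    and adj_neq_1: "u < n \<Longrightarrow> v < n \<Longrightarrow> adj u v \<noteq> 1"
    and separated: "u < n \<Longrightarrow> v < n \<Longrightarrow> u \<noteq> v \<Longrightarrow> \<exists>t<Q. phi t u = 0 \<and> phi t v \<noteq> 0"
    and Q_ge: "r + 4 \<le> Q"
begin

definition iwalk :: "nat list \<Rightarrow> bool" where
  "iwalk p \<longleftrightarrow> p \<noteq> [] \<and> set p \<subseteq> {..<n} \<and> successively (\<lambda>u v. adj u v \<noteq> 0) p"

definition iclosed :: "nat list \<Rightarrow> bool" where
  "iclosed p \<longleftrightarrow> iwalk p \<and> hd p = last p \<and> dep (hd p)"

definition iweight :: "nat list \<Rightarrow> nat" where
  "iweight p = (\<Sum>i<length p - 1. adj (p ! i) (p ! Suc i) - 1)"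

definition C :: "nat set" where "C = {v. v < n \<and> dem v \<noteq> 0}"
text \<open>The clients that a walk without edges cannot serve, as it stays at a depot.\<close>

definition T :: "nat set" where "T = {v \<in> C. \<not> dep v}"

definition iroute :: "nat list list \<Rightarrow> (nat \<Rightarrow> nat) \<Rightarrow> bool" where
  "iroute ps A \<longleftrightarrow>
     length ps \<le> k \<and>
     (\<forall>p\<in>set ps. iclosed p \<and> iweight p \<le> gb) \<and>
     (\<forall>c\<in>C. A c < length ps \<and> c \<in> set (ps ! A c)) \<and>
     (\<forall>i<length ps. (\<Sum>c\<in>{c \<in> C. A c = i}. dem c) \<le> cap) \<and>
     (\<Sum>p\<leftarrow>ps. iweight p) \<le> r"

text \<open>
  A guess \<open>g\<close> consists of \<open>L\<close> action codes followed by an \<open>L\<close> by \<open>L\<close> array of indices of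
  separating functions. Code 0 does nothing, 1 closes the current walk and starts another one at
  any depot, 2 and 3 serve the current vertex, which is a depot for 2 and not for 3, and
  \<open>a \<ge> 4\<close> moves along an edge of weight \<open>a - 3\<close>. A routing has at most \<open>r\<close> moves, hence
  at most \<open>r\<close> walks with an edge and at most \<open>2 * r\<close> services on them.
\<close>

definition L :: nat where "L = 4 * r"

definition serve :: "nat \<Rightarrow> bool" where "serve a \<longleftrightarrow> a = 2 \<or> a = 3"

definition nclose :: "(nat \<Rightarrow> nat) \<Rightarrow> nat \<Rightarrow> nat" where
  "nclose g t = (\<Sum>s<t. if g s = 1 then 1 else 0)"
definition nserve :: "(nat \<Rightarrow> nat) \<Rightarrow> nat \<Rightarrow> nat" where
  "nserve g t = (\<Sum>s<t. if serve (g s) then 1 else 0)"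
definition nfar :: "(nat \<Rightarrow> nat) \<Rightarrow> nat \<Rightarrow> nat" where
  "nfar g t = (\<Sum>s<t. if g s = 3 then 1 else 0)"
definition wsum :: "(nat \<Rightarrow> nat) \<Rightarrow> nat \<Rightarrow> nat" where
  "wsum g t = (\<Sum>s<t. g s - 3)"

text \<open>
  The pair holds the weight of the current walk and the number of clients served on it; services
  on a walk that is never closed do not count, so this number must end up as 0.
\<close>

definition mst :: "nat \<Rightarrow> nat \<times> nat \<Rightarrow> nat \<times> nat" where
  "mst a c = (if a = 1 then (0, 0) else (fst c + (a - 3), snd c + (if serve a then 1 else 0)))"

definition st :: "(nat \<Rightarrow> nat) \<Rightarrow> nat \<Rightarrow> nat \<times> nat" where
  "st g t = fold mst (map g [0..<t]) (0, 0)"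

text \<open>Within a walk the weight only grows, so testing it after each action amounts to testing
  it at the end of each walk, including the one left open.\<close>

primrec okl :: "nat \<times> nat \<Rightarrow> nat list \<Rightarrow> bool" where
  "okl c [] = True"
| "okl c (a # as) = (fst (mst a c) \<le> gb \<and> okl (mst a c) as)"

definition ok :: "(nat \<Rightarrow> nat) \<Rightarrow> nat \<Rightarrow> bool" where
  "ok g t = okl (0, 0) (map g [0..<t])"

text \<open>
  For \<open>s < t\<close> the entry in row \<open>s\<close> and column \<open>t\<close> certifies that the clients served at times \<open>s\<close> and
  \<open>t\<close> are distinct: the function it names vanishes on the first and not on the second.
\<close>

definition sep :: "(nat \<Rightarrow> nat) \<Rightarrow> nat \<Rightarrow> nat \<Rightarrow> bool" where
  "sep g t v \<longleftrightarrow> (\<forall>s<L. serve (g s) \<longrightarrow>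
     (s < t \<longrightarrow> phi (g (L + (s * L + t))) v \<noteq> 0) \<and>
     (t < s \<longrightarrow> phi (g (L + (t * L + s))) v = 0))"

text \<open>A minimum in which 0 stands for infinity, in accordance with the coding of
  \<open>E\<close>.\<close>

primrec mn :: "(nat \<Rightarrow> nat) \<Rightarrow> nat \<Rightarrow> nat" where
  "mn h 0 = 0"
| "mn h (Suc u) = (if h u \<noteq> 0 \<and> (mn h u = 0 \<or> h u < mn h u) then h u else mn h u)"

text \<open>
  \<open>E g t d v\<close> is 0 if no walk from the depot \<open>d\<close> to \<open>v\<close> follows the first \<open>t\<close> codes, and otherwise
  the least load of such a walk plus 1.
\<close>

primrec E :: "(nat \<Rightarrow> nat) \<Rightarrow> nat \<Rightarrow> nat \<Rightarrow> nat \<Rightarrow> nat" where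
  "E g 0 d v = (if d = v \<and> dep v then 1 else 0)"
| "E g (Suc t) d v =
     (if g t = 0 then E g t d v
      else if g t = 1 then (if d = v \<and> dep v \<and> (\<exists>d'<n. E g t d' d' \<noteq> 0) then 1 else 0)
      else if g t \<le> 3 then
        (if E g t d v \<noteq> 0 \<and> dem v \<noteq> 0 \<and> (dep v \<longleftrightarrow> g t = 2) \<and> sep g t v \<and>
            E g t d v + dem v \<le> cap + 1
         then E g t d v + dem v else 0)
      else mn (\<lambda>u. if adj u v = g t - 2 then E g t d u else 0) n)"

text \<open>
  Each client left unserved must be a depot and takes a vehicle of its own on a walk of length 0.
\<close>

definition accept :: "(nat \<Rightarrow> nat) \<Rightarrow> bool" where
  "accept g \<longleftrightarrow> ok g L \<and> wsum g L \<le> r \<and> (\<exists>d<n. \<exists>v<n. E g L d v \<noteq> 0) \<and>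
     snd (st g L) = 0 \<and> nfar g L = card T \<and> card C + nclose g L \<le> k + nserve g L \<and>
     (\<forall>v<n. dem v \<le> cap)"

lemma finite_C: "finite C"
  by (simp add: C_def)

lemma st_0 [simp]: "st g 0 = (0, 0)"
  by (simp add: st_def)

lemma st_Suc [simp]: "st g (Suc t) = mst (g t) (st g t)"
  by (simp add: st_def)

lemma okl_append: "okl c (as @ bs) \<longleftrightarrow> okl c as \<and> okl (fold mst as c) bs"
  by (induction as arbitrary: c) auto

lemma ok_0 [simp]: "ok g 0"
  by (simp add: ok_def)

lemma ok_Suc [simp]: "ok g (Suc t) \<longleftrightarrow> ok g t \<and> fst (st g (Suc t)) \<le> gb"
  by (simp add: ok_def okl_append st_def)

lemma nclose_simps [simp]: "nclose g 0 = 0" "nclose g (Suc t) = nclose g t + (if g t = 1 then 1 else 0)"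
  by (simp_all add: nclose_def)

lemma nserve_simps [simp]:
  "nserve g 0 = 0" "nserve g (Suc t) = nserve g t + (if serve (g t) then 1 else 0)"
  by (simp_all add: nserve_def)

lemma nfar_simps [simp]: "nfar g 0 = 0" "nfar g (Suc t) = nfar g t + (if g t = 3 then 1 else 0)"
  by (simp_all add: nfar_def)

lemma wsum_simps [simp]: "wsum g 0 = 0" "wsum g (Suc t) = wsum g t + (g t - 3)"
  by (simp_all add: wsum_def)

lemma nclose_mono: "s \<le> t \<Longrightarrow> nclose g s \<le> nclose g t"
  unfolding nclose_def by (intro sum_mono2) auto

lemma mn_attained: "mn h m \<noteq> 0 \<Longrightarrow> \<exists>u<m. h u = mn h m"
  by (induction m) (auto simp: less_Suc_eq split: if_splits)

lemma mn_le: "u < m \<Longrightarrow> h u \<noteq> 0 \<Longrightarrow> mn h m \<noteq> 0 \<and> mn h m \<le> h u"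
  by (induction m) (auto simp: less_Suc_eq)

section \<open>Traces of a guess and the table of least loads\<close>

abbreviation dof :: "nat \<times> nat \<times> nat \<Rightarrow> nat" where "dof c \<equiv> fst c"
abbreviation vof :: "nat \<times> nat \<times> nat \<Rightarrow> nat" where "vof c \<equiv> fst (snd c)"
abbreviation xof :: "nat \<times> nat \<times> nat \<Rightarrow> nat" where "xof c \<equiv> snd (snd c)"

text \<open>
  A configuration consists of the first vertex, the current vertex and the load of the current walk.
\<close>

definition tstep :: "nat \<Rightarrow> nat \<times> nat \<times> nat \<Rightarrow> nat \<times> nat \<times> nat \<Rightarrow> bool" where
  "tstep a c c' \<longleftrightarrow> dof c' < n \<and> vof c' < n \<and>
     (if a = 0 then c' = c
      else if a = 1 then vof c = dof c \<and> vof c' = dof c' \<and> dep (dof c') \<and> xof c' = 0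
      else if a \<le> 3 then dof c' = dof c \<and> vof c' = vof c \<and> dem (vof c) \<noteq> 0 \<and>
        (dep (vof c) \<longleftrightarrow> a = 2) \<and> xof c' = xof c + dem (vof c) \<and> xof c' \<le> cap
      else dof c' = dof c \<and> xof c' = xof c \<and> adj (vof c) (vof c') = a - 2)"

definition trace :: "(nat \<Rightarrow> nat) \<Rightarrow> nat \<Rightarrow> (nat \<Rightarrow> nat \<times> nat \<times> nat) \<Rightarrow> bool" where
  "trace g t c \<longleftrightarrow> (\<exists>d<n. dep d \<and> c 0 = (d, d, 0)) \<and>
     (\<forall>s<t. tstep (g s) (c s) (c (Suc s)) \<and> (serve (g s) \<longrightarrow> sep g s (vof (c s))))"

lemma trace_extend:
  assumes "trace g t c" "tstep (g t) (c t) c'" "serve (g t) \<longrightarrow> sep g t (vof (c t))"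
  shows "trace g (Suc t) (c(Suc t := c'))"
  using assms by (auto simp: trace_def less_Suc_eq)

text \<open>Every nonzero entry arises from a nonzero entry for the preceding time; the trace
  belonging to that one is prolonged by one configuration. The load is exact because minima are
  attained.\<close>

lemma E_sound:
  "d < n \<Longrightarrow> v < n \<Longrightarrow> E g t d v \<noteq> 0 \<Longrightarrow> \<exists>c. trace g t c \<and> c t = (d, v, E g t d v - 1)"
proof (induction t arbitrary: d v)
  case 0
  then show ?case
    by (intro exI[of _ "\<lambda>_. (d, d, 0)"]) (auto simp: trace_def split: if_splits)
next
  case (Suc t)
  let ?e = "E g (Suc t) d v"
  have ext: ?case if "trace g t c" "tstep (g t) (c t) (d, v, ?e - 1)"
    "serve (g t) \<longrightarrow> sep g t (vof (c t))" for c
    using trace_extend[OF that] fun_upd_same by metis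
  consider "g t = 0" | "g t = 1" | "g t = 2 \<or> g t = 3" | "g t > 3"
    by linarith
  then show ?case
  proof cases
    case 1
    then obtain c where "trace g t c" "c t = (d, v, ?e - 1)"
      using Suc.IH[OF Suc.prems(1,2)] Suc.prems(3) by auto
    then show ?thesis
      using 1 Suc.prems by (intro ext[of c]) (simp_all add: tstep_def serve_def)
  next
    case 2
    \<comment> \<open>A new walk starts with load 0, so any walk that can be closed at this time is
      as good as any other.\<close>
    then obtain d' where d': "d' < n" "E g t d' d' \<noteq> 0" "d = v" "dep v"
      using Suc.prems(3) by (auto split: if_splits)
    then have "?e = 1"
      using 2 by auto
    obtain c where "trace g t c" "c t = (d', d', E g t d' d' - 1)"
      using Suc.IH d'(1,2) by blast
    then show ?thesis
      using 2 Suc.prems(1,2) d' \<open>?e = 1\<close>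
      by (intro ext[of c]) (auto simp: tstep_def serve_def simp del: E.simps)
  next
    case 3
    then have *: "E g t d v \<noteq> 0" "dem v \<noteq> 0" "dep v \<longleftrightarrow> g t = 2" "sep g t v"
      "E g t d v + dem v \<le> cap + 1" "?e = E g t d v + dem v"
      using Suc.prems(3) by (auto split: if_splits)
    then obtain c where "trace g t c" "c t = (d, v, E g t d v - 1)"
      using Suc.IH[OF Suc.prems(1,2)] by blast
    then show ?thesis
      using 3 Suc.prems(1,2) * by (intro ext[of c]) (auto simp: tstep_def simp del: E.simps)
  next
    case 4
    let ?h = "\<lambda>u. if adj u v = g t - 2 then E g t d u else 0"
    have e: "?e = mn ?h n"
      using 4 by simp
    have "mn ?h n \<noteq> 0"
      using Suc.prems(3) unfolding e .
    from mn_attained[OF this] obtain u where u: "u < n" "?h u = ?e"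
      unfolding e by blast
    have a: "adj u v = g t - 2"
      using u(2) Suc.prems(3) by (cases "adj u v = g t - 2") simp_all
    then have E_u: "E g t d u = ?e"
      using u(2) by (simp del: E.simps)
    with Suc.prems(3) have "E g t d u \<noteq> 0"
      by (simp only:) simp
    from Suc.IH[OF Suc.prems(1) u(1) this] obtain c where "trace g t c" "c t = (d, u, ?e - 1)"
      unfolding E_u by blast
    moreover have "\<not> serve (g t)" "g t \<noteq> 0" "g t \<noteq> 1" "\<not> g t \<le> 3"
      using 4 by (auto simp: serve_def)
    ultimately show ?thesis
      using Suc.prems(1,2) a by (intro ext[of c]) (simp_all add: tstep_def del: E.simps)
  qed
qed

lemma trace_bounds: "trace g t c \<Longrightarrow> s \<le> t \<Longrightarrow> dof (c s) < n \<and> vof (c s) < n"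
  by (cases s) (auto simp: trace_def tstep_def Suc_le_eq)

lemma traceD:
  "trace g t c \<Longrightarrow> s < t \<Longrightarrow> tstep (g s) (c s) (c (Suc s))"
  "trace g t c \<Longrightarrow> s < t \<Longrightarrow> serve (g s) \<Longrightarrow> sep g s (vof (c s))"
  by (simp_all add: trace_def)

text \<open>Only an inequality is claimed, since another trace may reach the same vertices with less
  load; less load passes the capacity test too, which carries the induction through
  services.\<close>

lemma E_complete:
  assumes "trace g t c" "s \<le> t"
  shows "E g s (dof (c s)) (vof (c s)) \<noteq> 0 \<and> E g s (dof (c s)) (vof (c s)) \<le> xof (c s) + 1"
  using assms(2)
proof (induction s)
  case 0
  then show ?case
    using assms(1) by (auto simp: trace_def)
next
  case (Suc s)
  then have "s < t"
    by simp
  note ts = traceD(1)[OF assms(1) this] and sp = traceD(2)[OF assms(1) this]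
  have b: "dof (c s) < n" "vof (c s) < n"
    using trace_bounds[OF assms(1), of s] Suc.prems by auto
  have IH: "E g s (dof (c s)) (vof (c s)) \<noteq> 0" "E g s (dof (c s)) (vof (c s)) \<le> xof (c s) + 1"
    using Suc by auto
  consider "g s = 0" | "g s = 1" | "g s = 2 \<or> g s = 3" | "g s > 3"
    by linarith
  then show ?case
  proof cases
    case 1
    then show ?thesis
      using ts IH by (simp add: tstep_def)
  next
    case 2
    then have "vof (c s) = dof (c s) \<and> vof (c (Suc s)) = dof (c (Suc s)) \<and> dep (dof (c (Suc s)))"
      using ts unfolding tstep_def by simp
    moreover from this IH(1) b have "\<exists>d<n. E g s d d \<noteq> 0"
      by auto
    ultimately show ?thesis
      using 2 by simp
  next
    case 3
    then have "dof (c (Suc s)) = dof (c s)" "vof (c (Suc s)) = vof (c s)" "dem (vof (c s)) \<noteq> 0"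
      "dep (vof (c s)) \<longleftrightarrow> g s = 2" "xof (c (Suc s)) = xof (c s) + dem (vof (c s))"
      "xof (c (Suc s)) \<le> cap"
      using ts by (auto simp: tstep_def)
    moreover have "sep g s (vof (c s))"
      using sp 3 by (simp add: serve_def)
    ultimately show ?thesis
      using 3 IH by (elim disjE) simp_all
  next
    case 4
    let ?h = "\<lambda>u. if adj u (vof (c (Suc s))) = g s - 2 then E g s (dof (c s)) u else 0"
    have "dof (c (Suc s)) = dof (c s)" "xof (c (Suc s)) = xof (c s)"
      "adj (vof (c s)) (vof (c (Suc s))) = g s - 2"
      using ts 4 by (simp_all add: tstep_def)
    moreover from this have "mn ?h n \<noteq> 0 \<and> mn ?h n \<le> ?h (vof (c s))"
      using IH(1) b by (intro mn_le) simp_all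
    ultimately show ?thesis
      using 4 IH(2) by simp
  qed
qed

section \<open>Walks and loads along a trace\<close>

lemma iweight_simps [simp]:
  "iweight [] = 0" "iweight [v] = 0" "iweight (v # u # p) = adj v u - 1 + iweight (u # p)"
  by (simp_all add: iweight_def sum.lessThan_Suc_shift del: sum.lessThan_Suc)

lemma iweight_snoc: "p \<noteq> [] \<Longrightarrow> iweight (p @ [u]) = iweight p + (adj (last p) u - 1)"
  by (induction p rule: induct_list012) auto

lemma iwalk_snoc: "iwalk p \<Longrightarrow> u < n \<Longrightarrow> adj (last p) u \<noteq> 0 \<Longrightarrow> iwalk (p @ [u])"
  by (auto simp: iwalk_def successively_append_iff)

text \<open>\<open>ps\<close> are the walks closed within the first \<open>t\<close> actions and
  \<open>p\<close> is the current one. An action at time \<open>s\<close> concerns the walk with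
  number \<open>nclose g s\<close> in \<open>ps @ [p]\<close>, which is how services are attributed
  to vehicles.\<close>

definition walks_upto ::
    "(nat \<Rightarrow> nat) \<Rightarrow> (nat \<Rightarrow> nat \<times> nat \<times> nat) \<Rightarrow> nat \<Rightarrow> nat list list \<Rightarrow> nat list \<Rightarrow> bool" where
  "walks_upto g c t ps p \<longleftrightarrow> length ps = nclose g t \<and>
     (\<forall>q\<in>set ps. iclosed q) \<and>
     iwalk p \<and> hd p = dof (c t) \<and> last p = vof (c t) \<and> dep (hd p) \<and>
     iweight p = fst (st g t) \<and> (\<Sum>q\<leftarrow>ps. iweight q) + iweight p = wsum g t \<and>
     (ok g t \<longrightarrow> (\<forall>q\<in>set ps. iweight q \<le> gb) \<and> iweight p \<le> gb) \<and>
     (\<forall>s<t. serve (g s) \<longrightarrow> vof (c s) \<in> set ((ps @ [p]) ! nclose g s))"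

lemma trace_walks: "trace g t c \<Longrightarrow> \<exists>ps p. walks_upto g c t ps p"
proof (induction t)
  case 0
  then obtain d where "d < n" "dep d" "c 0 = (d, d, 0)"
    by (auto simp: trace_def)
  then have "walks_upto g c 0 [] [d]"
    by (simp add: walks_upto_def iwalk_def)
  then show ?case
    by blast
next
  case (Suc t)
  then have tr: "trace g t c"
    by (simp add: trace_def)
  have ts: "tstep (g t) (c t) (c (Suc t))"
    using traceD(1)[OF Suc.prems] by simp
  obtain ps p where "walks_upto g c t ps p"
    using Suc.IH[OF tr] by blast
  then have len: "length ps = nclose g t"
    and ps: "\<forall>q\<in>set ps. iclosed q"
    and p: "iwalk p" "hd p = dof (c t)" "last p = vof (c t)" "dep (hd p)"
    and wt: "iweight p = fst (st g t)" "(\<Sum>q\<leftarrow>ps. iweight q) + iweight p = wsum g t"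
    and gas: "ok g t \<longrightarrow> (\<forall>q\<in>set ps. iweight q \<le> gb) \<and> iweight p \<le> gb"
    and mem: "\<And>s. s < t \<Longrightarrow> serve (g s) \<Longrightarrow> vof (c s) \<in> set ((ps @ [p]) ! nclose g s)"
    unfolding walks_upto_def by blast+
  have ne: "p \<noteq> []"
    using p(1) by (simp add: iwalk_def)
  have nc: "nclose g s \<le> length ps" if "s \<le> t" for s
    using nclose_mono[OF that, of g] len by simp
  consider "g t = 0" | "g t = 1" | "g t = 2 \<or> g t = 3" | "g t > 3"
    by linarith
  then show ?case
  proof cases
    case 1
    then have "c (Suc t) = c t"
      using ts by (simp add: tstep_def)
    moreover have "vof (c s) \<in> set ((ps @ [p]) ! nclose g s)" if "s < Suc t" "serve (g s)" for s
      using mem[of s] that 1 by (auto simp: serve_def less_Suc_eq)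
    ultimately have "walks_upto g c (Suc t) ps p"
      using len ps p wt gas 1 unfolding walks_upto_def by (simp add: mst_def serve_def)
    then show ?thesis
      by blast
  next
    case 2
    then have d: "vof (c (Suc t)) = dof (c (Suc t)) \<and> dof (c (Suc t)) < n \<and> dep (dof (c (Suc t))) \<and>
        vof (c t) = dof (c t)"
      using ts unfolding tstep_def by simp
    let ?d = "dof (c (Suc t))"
    \<comment> \<open>Closing moves \<open>p\<close> to the end of the finished walks, so all walks
      keep their numbers.\<close>
    have m: "vof (c s) \<in> set (((ps @ [p]) @ [[?d]]) ! nclose g s)" if "s < Suc t" "serve (g s)" for s
    proof -
      have "s < t"
        using that 2 by (auto simp: less_Suc_eq serve_def)
      then show ?thesis
        using mem[OF _ that(2)] nc[of s]
        by (cases "nclose g s = length ps") (auto simp: nth_append)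
    qed
    have "walks_upto g c (Suc t) (ps @ [p]) [?d]"
      unfolding walks_upto_def
    proof (intro conjI)
      show "\<forall>q\<in>set (ps @ [p]). iclosed q"
      proof -
        have "iclosed p"
          using p d by (simp add: iclosed_def)
        then show ?thesis
          using ps by simp
      qed
      show "ok g (Suc t) \<longrightarrow> (\<forall>q\<in>set (ps @ [p]). iweight q \<le> gb) \<and> iweight [?d] \<le> gb"
        using gas by simp
    qed (use len wt 2 d m in \<open>simp_all add: mst_def iwalk_def\<close>)
    then show ?thesis
      by blast
  next
    case 3
    then have c: "dof (c (Suc t)) = dof (c t)" "vof (c (Suc t)) = vof (c t)"
      using ts by (auto simp: tstep_def)
    have "vof (c t) \<in> set p"
      using p(3) ne last_in_set by metis
    then have m: "vof (c s) \<in> set ((ps @ [p]) ! nclose g s)" if "s < Suc t" "serve (g s)" for s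
      using mem[of s] that len by (auto simp: less_Suc_eq nth_append)
    have "mst (g t) (st g t) = (fst (st g t), Suc (snd (st g t)))" "g t - 3 = 0" "g t \<noteq> 1"
      using 3 by (auto simp: mst_def serve_def)
    then have "walks_upto g c (Suc t) ps p"
      using len ps p wt gas c m unfolding walks_upto_def by simp
    then show ?thesis
      by blast
  next
    case 4
    then have v: "dof (c (Suc t)) = dof (c t)" "vof (c (Suc t)) < n"
      "adj (vof (c t)) (vof (c (Suc t))) = g t - 2"
      using ts by (simp_all add: tstep_def)
    let ?p = "p @ [vof (c (Suc t))]"
    have w: "iwalk ?p"
      using p(1,3) v 4 by (intro iwalk_snoc) auto
    have iw: "iweight ?p = iweight p + (g t - 3)"
      using iweight_snoc[OF ne] p(3) v(3) by simp
    have m: "vof (c s) \<in> set ((ps @ [?p]) ! nclose g s)" if "s < Suc t" "serve (g s)" for s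
    proof -
      have "s < t"
        using that 4 by (auto simp: less_Suc_eq serve_def)
      then have "vof (c s) \<in> set ((ps @ [p]) ! nclose g s)"
        using mem that by auto
      then show ?thesis
        using nc[of s] \<open>s < t\<close> by (cases "nclose g s = length ps") (auto simp: nth_append)
    qed
    have mst: "mst (g t) (st g t) = (fst (st g t) + (g t - 3), snd (st g t))" "g t \<noteq> 1"
      using 4 by (auto simp: mst_def serve_def)
    have "walks_upto g c (Suc t) ps ?p"
      unfolding walks_upto_def
    proof (intro conjI)
      show "ok g (Suc t) \<longrightarrow> (\<forall>q\<in>set ps. iweight q \<le> gb) \<and> iweight ?p \<le> gb"
        using gas mst iw wt by simp
      show "hd ?p = dof (c (Suc t))" "dep (hd ?p)"
        using p v ne by simp_all
    qed (use len ps w wt iw mst m in simp_all)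
    then show ?thesis
      by blast
  qed
qed

text \<open>The equation carries the induction: it identifies the third component of a
  configuration, which \<open>tstep\<close> keeps within \<open>cap\<close> at services, as the sum
  of the demands served on the current walk. The loads of earlier walks no longer change.\<close>

lemma trace_loads:
  assumes "trace g t c"
  shows "(\<Sum>s\<in>{s. s < t \<and> serve (g s) \<and> nclose g s = i}. dem (vof (c s))) \<le> cap \<and>
    (\<Sum>s\<in>{s. s < t \<and> serve (g s) \<and> nclose g s = nclose g t}. dem (vof (c s))) = xof (c t)"
  using assms
proof (induction t)
  case 0
  then show ?case
    by (auto simp: trace_def)
next
  case (Suc t)
  then have "trace g t c" and ts: "tstep (g t) (c t) (c (Suc t))"
    by (auto simp: trace_def)
  then have IH: "(\<Sum>s\<in>{s. s < t \<and> serve (g s) \<and> nclose g s = i}. dem (vof (c s))) \<le> cap"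
    "(\<Sum>s\<in>{s. s < t \<and> serve (g s) \<and> nclose g s = nclose g t}. dem (vof (c s))) = xof (c t)"
    using Suc.IH by auto
  have split: "{s. s < Suc t \<and> serve (g s) \<and> nclose g s = j} =
      (if serve (g t) \<and> nclose g t = j then insert t {s. s < t \<and> serve (g s) \<and> nclose g s = j}
       else {s. s < t \<and> serve (g s) \<and> nclose g s = j})" for j
    by (auto simp: less_Suc_eq)
  show ?case
  proof (cases "serve (g t)")
    case True
    then have x: "xof (c (Suc t)) = xof (c t) + dem (vof (c t))" "xof (c (Suc t)) \<le> cap" "g t \<noteq> 1"
      using ts by (auto simp: tstep_def serve_def)
    then show ?thesis
      using IH True by (cases "nclose g t = i") (auto simp: split)
  next
    case False
    \<comment> \<open>A walk that has just been opened has no services yet, matching the reset of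
      the load to 0.\<close>
    have e: "{s. s < t \<and> serve (g s) \<and> nclose g s = Suc (nclose g t)} = {}"
      by (auto dest!: nclose_mono[OF less_imp_le, of _ t g])
    have x: "xof (c (Suc t)) = (if g t = 1 then 0 else xof (c t))"
    proof -
      consider "g t = 0" | "g t = 1" | "g t > 3"
        using False by (auto simp: serve_def) linarith
      then show ?thesis
        by cases (use ts in \<open>auto simp: tstep_def\<close>)
    qed
    show ?thesis
      using IH False e x by (auto simp: split)
  qed
qed

lemma st_open_0:
  "snd (st g t) = 0 \<Longrightarrow> s < t \<Longrightarrow> serve (g s) \<Longrightarrow> nclose g s < nclose g t"
proof (induction t)
  case (Suc t)
  show ?case
  proof (cases "g t = 1")
    case True
    then have "s < t"
      using Suc.prems by (auto simp: less_Suc_eq serve_def)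
    then show ?thesis
      using nclose_mono[of s t g] True by simp
  next
    case False
    then have "s < t" "snd (st g t) = 0"
      using Suc.prems by (auto simp: mst_def less_Suc_eq)
    then show ?thesis
      using Suc by simp
  qed
qed simp

section \<open>Accepted guesses yield routings\<close>

lemma nserve_card: "nserve g t = card {s. s < t \<and> serve (g s)}"
  unfolding nserve_def by (simp add: sum.If_cases Int_def)

lemma nfar_card: "nfar g t = card {s. s < t \<and> g s = 3}"
  unfolding nfar_def by (simp add: sum.If_cases Int_def)

text \<open>The routing consists of the closed walks of a trace and a one-vertex walk for each
  client not served on them. Those clients are depots because the services with code 3 are distinct,
  hit only \<open>T\<close> and are as many as \<open>T\<close> has elements.\<close>

lemma accept_sound:
  assumes "accept g"
  shows "\<exists>ps A. iroute ps A"
proof -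
  obtain d v where "d < n" "v < n" "E g L d v \<noteq> 0"
    using assms by (auto simp: accept_def)
  then obtain c where tr: "trace g L c"
    using E_sound by blast
  define vs where "vs s = vof (c s)" for s
  define S where "S = {s. s < L \<and> serve (g s)}"
  let ?q = "nclose g L"
  have acc: "ok g L" "wsum g L \<le> r" "snd (st g L) = 0" "nfar g L = card T"
    "card C + ?q \<le> k + nserve g L" "\<forall>v<n. dem v \<le> cap"
    using assms by (auto simp: accept_def)
  have ts: "tstep (g s) (c s) (c (Suc s))" "serve (g s) \<Longrightarrow> sep g s (vs s)" if "s < L" for s
    using traceD[OF tr that] by (simp_all add: vs_def)
  obtain ps p where H: "length ps = ?q"
     "\<forall>q\<in>set ps. iclosed q"
     "(\<Sum>q\<leftarrow>ps. iweight q) + iweight p = wsum g L"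
     "\<forall>q\<in>set ps. iweight q \<le> gb"
     "\<And>s. s \<in> S \<Longrightarrow> vs s \<in> set ((ps @ [p]) ! nclose g s)"
    using trace_walks[OF tr] acc(1) unfolding walks_upto_def S_def vs_def by blast
  have finS: "finite S"
    by (simp add: S_def)
  have nc: "nclose g s < ?q" if "s \<in> S" for s
    using st_open_0[OF acc(3)] that by (auto simp: S_def)
  \<comment> \<open>For \<open>s < t\<close> the certificate in row \<open>s\<close> and column
    \<open>t\<close> is tested at both times, with value 0 at \<open>s\<close> and a nonzero value
    at \<open>t\<close>.\<close>
  have inj: "inj_on vs S"
  proof -
    have "vs s \<noteq> vs t" if "s \<in> S" "t \<in> S" "s < t" for s t
    proof -
      have "s < L" "t < L" "serve (g s)" "serve (g t)"
        using that by (auto simp: S_def)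
      then have "phi (g (L + (s * L + t))) (vs s) = 0" "phi (g (L + (s * L + t))) (vs t) \<noteq> 0"
        using ts(2)[of s] ts(2)[of t] \<open>s < t\<close> unfolding sep_def by blast+
      then show ?thesis
        by auto
    qed
    then show ?thesis
      by (intro inj_onI) (metis nat_neq_iff)
  qed
  have vsC: "vs s \<in> C" "g s = 3 \<longleftrightarrow> \<not> dep (vs s)" if "s \<in> S" for s
  proof -
    have s: "s < L" "g s = 2 \<or> g s = 3"
      using that by (auto simp: S_def serve_def)
    have "dem (vs s) \<noteq> 0 \<and> (dep (vs s) \<longleftrightarrow> g s = 2)"
      using ts(1)[OF s(1)] s(2) unfolding tstep_def vs_def by (elim disjE) simp_all
    moreover have "vs s < n"
      using trace_bounds[OF tr, of s] s(1) by (simp add: vs_def)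
    ultimately show "vs s \<in> C" "g s = 3 \<longleftrightarrow> \<not> dep (vs s)"
      using s(2) by (auto simp: C_def)
  qed
  have T: "T \<subseteq> vs ` S"
  proof -
    let ?S3 = "{s \<in> S. g s = 3}"
    have "?S3 = {s. s < L \<and> g s = 3}"
      by (auto simp: S_def serve_def)
    then have "card (vs ` ?S3) = card T"
      using acc(4) nfar_card[of g L] card_image[OF inj_on_subset[OF inj, of ?S3]] by force
    moreover have "vs ` ?S3 \<subseteq> T"
      using vsC unfolding T_def by blast
    moreover have "finite T"
      using finite_C by (simp add: T_def)
    ultimately have "vs ` ?S3 = T"
      by (intro card_subset_eq)
    then show ?thesis
      by blast
  qed
  define us where "us = sorted_list_of_set (C - vs ` S)"
  have us: "set us = C - vs ` S" "distinct us"
    using finite_C by (auto simp: us_def)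
  have len_us: "length us = card C - card S"
    using us distinct_card[OF us(2)] card_Diff_subset[of "vs ` S" C] vsC finS card_image[OF inj] by auto
  have "card S \<le> card C"
    using vsC card_image[OF inj] card_mono[OF finite_C, of "vs ` S"] by auto
  then have len: "length us + ?q \<le> k"
    using len_us acc(5) nserve_card[of g L] by (simp add: S_def)
  define ix where "ix v = (THE i. i < length us \<and> us ! i = v)" for v
  have ix: "ix v < length us \<and> us ! ix v = v" if "v \<in> C - vs ` S" for v
  proof -
    have "\<exists>!i. i < length us \<and> us ! i = v"
      using that us distinct_Ex1[of us v] by simp
    then show ?thesis
      unfolding ix_def by (rule theI')
  qed
  \<comment> \<open>The remaining clients get the vehicle numbers from \<open>?q\<close> on, in the
    order of \<open>us\<close>.\<close>
  define A where "A v = (if v \<in> vs ` S then nclose g (the_inv_into S vs v) else ?q + ix v)" for v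
  define R where "R = ps @ map (\<lambda>u. [u]) us"
  have A_vs: "A (vs s) = nclose g s" if "s \<in> S" for s
    using that by (simp add: A_def the_inv_into_f_f[OF inj])
  have A_us: "A v = ?q + ix v" if "v \<in> C - vs ` S" for v
    using that by (simp add: A_def)
  have us_dep: "dep u" "u < n" if "u \<in> set us" for u
    using that us T by (auto simp: T_def C_def)
  have "iroute R A"
    unfolding iroute_def
  proof (intro conjI ballI allI impI)
    show "length R \<le> k"
      using len H(1) by (simp add: R_def)
    fix q assume "q \<in> set R"
    then have "q \<in> set ps \<or> (\<exists>u\<in>set us. q = [u])"
      by (auto simp: R_def)
    then show "iclosed q" "iweight q \<le> gb"
    proof (atomize(full), elim disjE bexE)
      assume "q \<in> set ps"
      then show "iclosed q \<and> iweight q \<le> gb"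
        using H(2,4) by blast
    next
      fix u assume "u \<in> set us" "q = [u]"
      then show "iclosed q \<and> iweight q \<le> gb"
        using us_dep[of u] by (simp add: iclosed_def iwalk_def)
    qed
  next
    fix v assume v: "v \<in> C"
    have "A v < length R \<and> v \<in> set (R ! A v)"
    proof (cases "v \<in> vs ` S")
      case True
      then obtain s where s: "s \<in> S" "v = vs s"
        by auto
      then show ?thesis
        using nc[OF s(1)] H(1) H(5)[OF s(1)] A_vs[OF s(1)] by (simp add: R_def nth_append)
    next
      case False
      then show ?thesis
        using ix[of v] A_us[of v] v H(1) by (simp add: R_def nth_append)
    qed
    then show "A v < length R" "v \<in> set (R ! A v)"
      by auto
  next
    fix i assume i: "i < length R"
    show "(\<Sum>v\<in>{v \<in> C. A v = i}. dem v) \<le> cap"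
    proof (cases "i < ?q")
      case True
      have "{v \<in> C. A v = i} = vs ` {s \<in> S. nclose g s = i}"
      proof (intro equalityI subsetI)
        fix v assume "v \<in> {v \<in> C. A v = i}"
        then have v: "v \<in> C" "A v = i"
          by auto
        then have "v \<in> vs ` S"
          using True A_us[of v] by (metis DiffI not_add_less1)
        then show "v \<in> vs ` {s \<in> S. nclose g s = i}"
          using A_vs v(2) by auto
      next
        fix v assume "v \<in> vs ` {s \<in> S. nclose g s = i}"
        then show "v \<in> {v \<in> C. A v = i}"
          using vsC(1) A_vs by auto
      qed
      moreover have "inj_on vs {s \<in> S. nclose g s = i}"
        by (rule inj_on_subset[OF inj]) blast
      note sum.reindex[OF this, of dem]
      ultimately have "(\<Sum>v\<in>{v \<in> C. A v = i}. dem v) = (\<Sum>s\<in>{s \<in> S. nclose g s = i}. dem (vs s))"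
        by (simp only: comp_def)
      also have "{s \<in> S. nclose g s = i} = {s. s < L \<and> serve (g s) \<and> nclose g s = i}"
        by (auto simp: S_def)
      finally show ?thesis
        using trace_loads[OF tr, of i] by (simp add: vs_def)
    next
      case False
      \<comment> \<open>Such a vehicle serves at most one client, whose demand \<open>accept\<close>
        has compared with the capacity.\<close>
      have "{v \<in> C. A v = i} \<subseteq> {us ! (i - ?q)}"
      proof (intro subsetI)
        fix v assume v: "v \<in> {v \<in> C. A v = i}"
        have "v \<notin> vs ` S"
        proof
          assume "v \<in> vs ` S"
          then obtain s where "s \<in> S" "v = vs s"
            by blast
          then show False
            using A_vs[of s] nc[of s] v False by simp
        qed
        then show "v \<in> {us ! (i - ?q)}"
          using A_us[of v] ix[of v] v by auto
      qed
      then have "(\<Sum>v\<in>{v \<in> C. A v = i}. dem v) \<le> (\<Sum>v\<in>{us ! (i - ?q)}. dem v)"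
        by (intro sum_mono2) auto
      also have "\<dots> \<le> cap"
      proof -
        have "i - ?q < length us"
          using i False H(1) by (simp add: R_def)
        then have "us ! (i - ?q) < n"
          by (intro us_dep(2) nth_mem)
        then show ?thesis
          using acc(6) by simp
      qed
      finally show ?thesis .
    qed
  next
    have "(\<Sum>u\<leftarrow>us. iweight [u]) = 0"
      by simp
    then show "(\<Sum>q\<leftarrow>R. iweight q) \<le> r"
      using H(3) acc(2) by (simp add: R_def comp_def)
  qed
  then show ?thesis
    by blast
qed

end

section \<open>From routings to guesses\<close>

lemma distinct_map_filter_nth:
  "distinct (map f (filter P xs)) \<Longrightarrow> i < j \<Longrightarrow> j < length xs \<Longrightarrow> P (xs ! i) \<Longrightarrow> P (xs ! j) \<Longrightarrow>
   f (xs ! i) \<noteq> f (xs ! j)"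
proof (induction xs arbitrary: i j)
  case (Cons x xs)
  obtain j' where j': "j = Suc j'"
    using Cons.prems(2) by (cases j) auto
  show ?case
  proof (cases i)
    case 0
    have "f (xs ! j') \<in> f ` {y \<in> set xs. P y}"
      using Cons.prems j' by auto
    then show ?thesis
      using Cons.prems 0 j' by (auto simp: image_iff)
  next
    case (Suc i')
    have "distinct (map f (filter P xs))"
      using Cons.prems(1) by (cases "P x") auto
    then show ?thesis
      using Cons.IH[of i' j'] Cons.prems Suc j' by simp
  qed
qed simp

context inst
begin

section \<open>Event lists for a single walk\<close>

type_synonym cfg = "nat \<times> nat \<times> nat"

text \<open>An event is an action code with the configuration it leads to. Lists of events can be
  concatenated, which suits the assembly of a guess from walks better than functions of
  time.\<close>

primrec steps :: "cfg \<Rightarrow> (nat \<times> cfg) list \<Rightarrow> bool" where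
  "steps c [] = True"
| "steps c (e # es) = (tstep (fst e) c (snd e) \<and> steps (snd e) es)"

primrec endc :: "cfg \<Rightarrow> (nat \<times> cfg) list \<Rightarrow> cfg" where
  "endc c [] = c"
| "endc c (e # es) = endc (snd e) es"

definition served :: "(nat \<times> cfg) list \<Rightarrow> nat list" where
  "served es = map (\<lambda>e. vof (snd e)) (filter (\<lambda>e. serve (fst e)) es)"

definition wlen :: "(nat \<times> cfg) list \<Rightarrow> nat" where
  "wlen es = (\<Sum>e\<leftarrow>es. fst e - 3)"

lemma steps_append: "steps c (es @ es') \<longleftrightarrow> steps c es \<and> steps (endc c es) es'"
  by (induction es arbitrary: c) auto

lemma endc_append: "endc c (es @ es') = endc (endc c es) es'"
  by (induction es arbitrary: c) auto

lemma served_append [simp]: "served (es @ es') = served es @ served es'"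
  by (simp add: served_def)

lemma served_Nil [simp]: "served [] = []"
  by (simp add: served_def)

lemma served_Cons: "served (e # es) = (if serve (fst e) then [vof (snd e)] else []) @ served es"
  by (simp add: served_def)

lemma wlen_simps [simp]:
  "wlen [] = 0" "wlen (e # es) = fst e - 3 + wlen es" "wlen (es @ es') = wlen es + wlen es'"
  by (simp_all add: wlen_def)

definition srv :: "nat \<Rightarrow> nat set \<Rightarrow> nat \<Rightarrow> nat \<Rightarrow> (nat \<times> cfg) list" where
  "srv d F x v = (if v \<in> F then [(if dep v then 2 else 3, (d, v, x + dem v))] else [])"

definition dmd :: "nat set \<Rightarrow> nat \<Rightarrow> nat" where
  "dmd F v = (if v \<in> F then dem v else 0)"

text \<open>
  The actions along the walk \<open>p\<close> that serve the clients in \<open>F\<close>, each at its first occurrence.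
\<close>

fun seg :: "nat \<Rightarrow> nat set \<Rightarrow> nat \<Rightarrow> nat list \<Rightarrow> (nat \<times> cfg) list" where
  "seg d F x [] = []"
| "seg d F x [v] = srv d F x v"
| "seg d F x (v # u # p) =
     srv d F x v @ (adj v u + 2, (d, u, x + dmd F v)) # seg d (F - {v}) (x + dmd F v) (u # p)"

lemma sum_dmd:
  assumes "finite F"
  shows "(\<Sum>c\<in>F. dem c) = dmd F v + (\<Sum>c\<in>F - {v}. dem c)"
  using assms by (cases "v \<in> F") (auto simp: dmd_def sum.remove)

lemma srv_props:
  assumes "d < n" "v < n" "F \<subseteq> C" "x + dmd F v \<le> cap"
  shows "steps (d, v, x) (srv d F x v)" "endc (d, v, x) (srv d F x v) = (d, v, x + dmd F v)"
  using assms by (auto simp: srv_def dmd_def tstep_def C_def)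

lemma srv_simps [simp]:
  "served (srv d F x v) = (if v \<in> F then [v] else [])" "wlen (srv d F x v) = 0"
  "length (srv d F x v) \<le> 1"
  "filter (\<lambda>e. fst e = Suc 0) (srv d F x v) = []"
  "length (filter (\<lambda>e. fst e = 3) (srv d F x v)) = (if v \<in> F \<and> \<not> dep v then 1 else 0)"
  by (auto simp: srv_def served_def serve_def)

lemma srv_mst:
  "fold mst (map fst (srv d F x v)) (y, j) = (y, j + (if v \<in> F then 1 else 0))"
  "okl (y, j) (map fst (srv d F x v)) \<longleftrightarrow> v \<notin> F \<or> y \<le> gb"
  by (auto simp: srv_def mst_def serve_def)

lemma iwalk_Cons2:
  "iwalk (v # u # p) \<longleftrightarrow> v < n \<and> adj v u \<noteq> 0 \<and> iwalk (u # p)"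
  by (auto simp: iwalk_def)

lemma adj_ge_2: "u < n \<Longrightarrow> v < n \<Longrightarrow> adj u v \<noteq> 0 \<Longrightarrow> 2 \<le> adj u v"
  using adj_neq_1[of u v] by linarith

lemma seg_steps:
  assumes "iwalk p" "d < n" "finite F" "F \<subseteq> C" "x + (\<Sum>c\<in>F. dem c) \<le> cap"
  shows "steps (d, hd p, x) (seg d F x p) \<and>
    dof (endc (d, hd p, x) (seg d F x p)) = d \<and> vof (endc (d, hd p, x) (seg d F x p)) = last p"
  using assms
proof (induction d F x p rule: seg.induct)
  case (1 d F x)
  then show ?case
    by (simp add: iwalk_def)
next
  case (2 d F x v)
  have "x + dmd F v \<le> cap"
    using 2 sum_dmd[of F v] by linarith
  then show ?case
    using srv_props[of d v F x] 2 by (simp add: iwalk_def)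
next
  case (3 d F x v u p)
  have w: "v < n" "adj v u \<noteq> 0" "iwalk (u # p)"
    using 3(2) by (auto simp: iwalk_Cons2)
  then have u: "u < n"
    by (auto simp: iwalk_def)
  have x: "x + dmd F v + (\<Sum>c\<in>F - {v}. dem c) \<le> cap"
    using 3 sum_dmd[of F v] by linarith
  \<comment> \<open>The code of a move is the weight plus 3, here \<open>adj v u + 2\<close>;
    positive weights make it at least 4, so it is not read as one of the other actions.\<close>
  have "tstep (adj v u + 2) (d, v, x + dmd F v) (d, u, x + dmd F v)"
    using adj_ge_2[of v u] w u 3 by (simp add: tstep_def)
  then show ?case
    using srv_props[of d v F x] 3(1)[OF w(3)] 3(3-5) w x
    by (simp add: steps_append endc_append subset_iff)
qed

lemma seg_served:
  "iwalk p \<Longrightarrow> distinct (served (seg d F x p)) \<and> set (served (seg d F x p)) = F \<inter> set p"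
proof (induction d F x p rule: seg.induct)
  case (3 d F x v u p)
  have "2 \<le> adj v u" "iwalk (u # p)"
    using 3(2) adj_ge_2[of v u] by (auto simp: iwalk_def)
  then show ?case
    using 3(1) by (auto simp: served_Cons serve_def)
qed auto

text \<open>A walk with m vertices has m - 1 moves and at most m services. The action left of 2 * m
  pays for the closing action in \<open>plan_counts\<close>.\<close>

lemma seg_counts:
  "iwalk p \<Longrightarrow> length (seg d F x p) + 1 \<le> 2 * length p \<and> wlen (seg d F x p) = iweight p \<and>
    filter (\<lambda>e. fst e = Suc 0) (seg d F x p) = [] \<and>
    length (filter (\<lambda>e. fst e = 3) (seg d F x p)) =
      length (filter (\<lambda>v. \<not> dep v) (served (seg d F x p)))"
proof (induction d F x p rule: seg.induct)
  case (1 d F x)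
  then show ?case
    by (simp add: iwalk_def)
next
  case (2 d F x v)
  then show ?case
    using srv_simps(3)[of d F x v] by simp
next
  case (3 d F x v u p)
  have "2 \<le> adj v u" "iwalk (u # p)"
    using 3(2) adj_ge_2[of v u] by (auto simp: iwalk_def)
  then show ?case
    using 3(1) srv_simps(3)[of d F x v] by (auto simp: served_Cons serve_def)
qed

lemma seg_mst:
  "iwalk p \<Longrightarrow> y + iweight p \<le> gb \<Longrightarrow>
    fst (fold mst (map fst (seg d F x p)) (y, j)) = y + iweight p \<and>
    okl (y, j) (map fst (seg d F x p))"
proof (induction d F x p arbitrary: y j rule: seg.induct)
  case (3 d F x v u p)
  have w: "2 \<le> adj v u" "iwalk (u # p)"
    using 3(2) adj_ge_2[of v u] by (auto simp: iwalk_def)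
  then have "mst (adj v u + 2) (y, i) = (y + (adj v u - 1), i)" for i
    by (auto simp: mst_def serve_def)
  then show ?case
    using 3(1)[OF w(2), of "y + (adj v u - 1)"] 3(3) w
    by (auto simp: okl_append srv_mst add.assoc)
qed (auto simp: iwalk_def srv_mst)

text \<open>Closing a walk opens another one, which must start where the next planned walk starts;
  after the last planned walk this is an arbitrary depot \<open>d0\<close>.\<close>

fun nxt :: "nat \<Rightarrow> (nat list \<times> nat set) list \<Rightarrow> nat" where
  "nxt d0 [] = d0"
| "nxt d0 (q # qs) = hd (fst q)"

primrec plan :: "nat \<Rightarrow> (nat list \<times> nat set) list \<Rightarrow> (nat \<times> cfg) list" where
  "plan d0 [] = []"
| "plan d0 (q # qs) =
     seg (hd (fst q)) (snd q) 0 (fst q) @ (1, (nxt d0 qs, nxt d0 qs, 0)) # plan d0 qs"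

definition good :: "nat list \<times> nat set \<Rightarrow> bool" where
  "good q \<longleftrightarrow> iclosed (fst q) \<and> iweight (fst q) \<le> gb \<and> snd q \<subseteq> C \<and> snd q \<subseteq> set (fst q) \<and>
     (\<Sum>c\<in>snd q. dem c) \<le> cap"

lemma good_iwalk: "good q \<Longrightarrow> iwalk (fst q)"
  by (simp add: good_def iclosed_def)

lemma plan_steps:
  assumes "d0 < n" "dep d0"
  shows "\<forall>q\<in>set qs. good q \<Longrightarrow> steps (nxt d0 qs, nxt d0 qs, 0) (plan d0 qs)"
proof (induction qs)
  case (Cons q qs)
  let ?p = "fst q" and ?F = "snd q" and ?e = "nxt d0 qs"
  have q: "iwalk ?p" "hd ?p = last ?p" "finite ?F" "?F \<subseteq> C" "0 + (\<Sum>c\<in>?F. dem c) \<le> cap"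
    using Cons.prems by (auto simp: good_def iclosed_def intro: finite_subset[OF _ finite_C])
  then have "hd ?p < n"
    by (cases ?p) (auto simp: iwalk_def)
  moreover have "?e < n \<and> dep ?e"
    using Cons.prems assms by (cases qs) (auto simp: good_def iclosed_def iwalk_def subset_iff)
  ultimately show ?case
    using seg_steps[OF q(1) _ q(3-5), of "hd ?p"] Cons q(2) by (simp add: steps_append tstep_def)
qed simp

lemma plan_counts:
  "\<forall>q\<in>set qs. good q \<Longrightarrow>
    okl (0, 0) (map fst (plan d0 qs)) \<and> fold mst (map fst (plan d0 qs)) (0, 0) = (0, 0) \<and>
    wlen (plan d0 qs) = (\<Sum>q\<leftarrow>qs. iweight (fst q)) \<and>
    length (filter (\<lambda>e. fst e = Suc 0) (plan d0 qs)) = length qs \<and>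
    length (filter (\<lambda>e. fst e = 3) (plan d0 qs)) =
      length (filter (\<lambda>v. \<not> dep v) (served (plan d0 qs))) \<and>
    length (plan d0 qs) \<le> (\<Sum>q\<leftarrow>qs. 2 * length (fst q))"
proof (induction qs)
  case (Cons q qs)
  have q: "iwalk (fst q)" "0 + iweight (fst q) \<le> gb"
    using Cons.prems by (auto simp: good_def iclosed_def)
  have mst: "mst 1 c = (0, 0)" for c
    by (simp add: mst_def)
  have s: "\<not> serve 1"
    by (simp add: serve_def)
  show ?case
    using Cons seg_mst[OF q, of "hd (fst q)" "snd q" 0 0]
      seg_counts[OF q(1), of "hd (fst q)" "snd q" 0]
    by (auto simp: okl_append mst[simplified] served_Cons s[simplified])
qed simp

lemma plan_served:
  "\<forall>q\<in>set qs. good q \<Longrightarrow> set (served (plan d0 qs)) = (\<Union>q\<in>set qs. snd q) \<and>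
   (sorted_wrt (\<lambda>q q'. snd q \<inter> snd q' = {}) qs \<longrightarrow> distinct (served (plan d0 qs)))"
proof (induction qs)
  case (Cons q qs)
  have q: "iwalk (fst q)" "snd q \<inter> set (fst q) = snd q"
    using Cons.prems by (auto simp: good_def iclosed_def)
  have s: "\<not> serve 1"
    by (simp add: serve_def)
  have IH: "set (served (plan d0 qs)) = (\<Union>q\<in>set qs. snd q)"
    "sorted_wrt (\<lambda>q q'. snd q \<inter> snd q' = {}) qs \<longrightarrow> distinct (served (plan d0 qs))"
    using Cons by auto
  have sg: "distinct (served (seg (hd (fst q)) (snd q) 0 (fst q)))"
    "set (served (seg (hd (fst q)) (snd q) 0 (fst q))) = snd q"
    using seg_served[OF q(1), of "hd (fst q)" "snd q" 0] q(2) by auto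
  show ?case
  proof (intro conjI impI)
    show "set (served (plan d0 (q # qs))) = (\<Union>q\<in>set (q # qs). snd q)"
      using IH(1) sg(2) s by (simp add: served_Cons)
    assume d: "sorted_wrt (\<lambda>q q'. snd q \<inter> snd q' = {}) (q # qs)"
    then have "distinct (served (plan d0 qs))"
      using IH(2) by simp
    moreover have "snd q \<inter> (\<Union>q\<in>set qs. snd q) = {}"
      using d by auto
    ultimately show "distinct (served (plan d0 (q # qs)))"
      using IH(1) sg s by (simp add: served_Cons)
  qed
qed simp

section \<open>From event lists to accepted guesses\<close>

lemma endc_bounds:
  "steps c es \<Longrightarrow> dof c < n \<and> vof c < n \<Longrightarrow> dof (endc c es) < n \<and> vof (endc c es) < n"
  by (induction es arbitrary: c) (auto simp: tstep_def)

lemma steps_nth: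
  "steps c es \<Longrightarrow> i < length es \<Longrightarrow>
   tstep (fst (es ! i)) ((c # map snd es) ! i) ((c # map snd es) ! Suc i)"
proof (induction es arbitrary: c i)
  case (Cons e es)
  then show ?case
    by (cases i) auto
qed simp

text \<open>The codes are taken from the events, and the certificates are chosen to fit: since the
  served clients are distinct, \<open>separated\<close> provides one for every pair of
  services.\<close>

lemma steps_accept:
  assumes es: "steps (e, e, 0) es" "length es = L" "e < n" "dep e" "okl (0, 0) (map fst es)"
    "snd (fold mst (map fst es) (0, 0)) = 0" "wlen es \<le> r" "distinct (served es)"
    "length (filter (\<lambda>e. fst e = 3) es) = card T"
    "card C + length (filter (\<lambda>e. fst e = Suc 0) es) \<le> k + length (served es)"
    and cap: "\<forall>v<n. dem v \<le> cap"
  shows "\<exists>g. (\<forall>i. g i < Q) \<and> (\<forall>i\<ge>L + L * L. g i = 0) \<and> accept g"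
proof -
  define c where "c s = ((e, e, 0) # map snd es) ! s" for s
  define w where "w s = vof (c s)" for s
  \<comment> \<open>Entries that no test reads are 0, which keeps all digits below
    \<open>Q\<close>.\<close>
  define h where "h s t = (if s < t \<and> t < L \<and> serve (fst (es ! s)) \<and> serve (fst (es ! t))
    then SOME b. b < Q \<and> phi b (w s) = 0 \<and> phi b (w t) \<noteq> 0 else 0)" for s t
  define g where "g i = (if i < L then fst (es ! i) else h ((i - L) div L) ((i - L) mod L))" for i
  have g_low: "g s = fst (es ! s)" if "s < L" for s
    using that by (simp add: g_def)
  have g_high: "g (L + (s * L + t)) = h s t" if "t < L" for s t
    using that by (simp add: g_def)
  have map_g: "map g [0..<L] = map fst es"
    by (rule nth_equalityI) (use es(2) g_low in auto)
  have count: "(\<Sum>s<L. if P (g s) then 1 else 0) = length (filter (\<lambda>e. P (fst e)) es)" for P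
  proof -
    have "(\<Sum>s<L. if P (g s) then 1 else 0) = card {s. s < L \<and> P (g s)}"
      by (simp add: sum.If_cases Int_def)
    also have "{s. s < L \<and> P (g s)} = {s. s < length es \<and> P (fst (es ! s))}"
      using g_low es(2) by auto
    finally show ?thesis
      by (simp add: length_filter_conv_card)
  qed
  have ts: "tstep (g s) (c s) (c (Suc s))" if "s < L" for s
    using steps_nth[OF es(1), of s] that es(2) g_low by (simp add: c_def)
  have c_bd: "w s < n" if "s \<le> L" for s
    using ts[of "s - 1"] that es(3) by (cases s) (auto simp: tstep_def w_def c_def)
  have w_serve: "w s = vof (snd (es ! s))" if "s < L" "serve (g s)" for s
  proof -
    have "vof (c (Suc s)) = vof (c s)"
      using ts[OF that(1)] that(2) by (auto simp: tstep_def serve_def)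
    then show ?thesis
      using that(1) es(2) by (simp add: w_def c_def)
  qed
  have w_neq: "w s \<noteq> w t" if "s < t" "t < L" "serve (g s)" "serve (g t)" for s t
    using distinct_map_filter_nth[OF es(8)[unfolded served_def] that(1)] that es(2)
      w_serve[of s] w_serve[of t] g_low[of s] g_low[of t] by simp
  have h: "h s t < Q \<and> phi (h s t) (w s) = 0 \<and> phi (h s t) (w t) \<noteq> 0"
    if "s < t" "t < L" "serve (g s)" "serve (g t)" for s t
  proof -
    have "\<exists>b. b < Q \<and> phi b (w s) = 0 \<and> phi b (w t) \<noteq> 0"
      using separated[OF c_bd c_bd w_neq[OF that]] that by auto
    from someI_ex[OF this] show ?thesis
      using that g_low by (simp add: h_def)
  qed
  have h_lt: "h s t < Q" for s t
    using h[of s t] g_low[of s] g_low[of t] Q_ge by (cases "s < t \<and> t < L \<and> serve (fst (es ! s)) \<and> serve (fst (es ! t))")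
      (auto simp: h_def)
  have "g i < Q" for i
  proof (cases "i < L")
    case True
    \<comment> \<open>A code exceeds 3 only by an edge weight, which is at most the total weight, so
      codes are at most \<open>r + 3 < Q\<close>.\<close>
    then have "fst (es ! i) - 3 \<in> set (map (\<lambda>e. fst e - 3) es)"
      using es(2) by auto
    then have "fst (es ! i) - 3 \<le> wlen es"
      unfolding wlen_def by (intro member_le_sum_list) auto
    then show ?thesis
      using es(7) Q_ge g_low[OF True] by linarith
  next
    case False
    then show ?thesis
      using h_lt by (simp add: g_def)
  qed
  moreover have "g i = 0" if i: "L + L * L \<le> i" for i
  proof (cases "L = 0")
    case False
    \<comment> \<open>Past the array the row number is at least \<open>L\<close> and so exceeds the
      column number, while \<open>h\<close> is nonzero only for rows below the column
      number.\<close>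
    then have "L * L div L \<le> (i - L) div L"
      using i by (intro div_le_mono) simp
    moreover have "(i - L) mod L < L"
      using False by simp
    ultimately have "\<not> (i - L) div L < (i - L) mod L"
      using nonzero_mult_div_cancel_right[OF False, of L] by linarith
    then show ?thesis
      using i by (simp add: g_def h_def)
  qed (simp add: g_def h_def)
  moreover have "accept g"
  proof -
    have tr: "trace g L c"
      unfolding trace_def
    proof (intro conjI allI impI)
      show "\<exists>d<n. dep d \<and> c 0 = (d, d, 0)"
        using es(3,4) by (auto simp: c_def)
      fix s assume s: "s < L"
      show "tstep (g s) (c s) (c (Suc s))"
        by (rule ts[OF s])
      assume "serve (g s)"
      then show "sep g s (vof (c s))"
        using h s g_high by (auto simp: sep_def w_def)
    qed
    have "wsum g L = wlen es"
    proof -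
      have "wsum g L = (\<Sum>s<length es. map (\<lambda>e. fst e - 3) es ! s)"
        unfolding wsum_def using g_low es(2) by (intro sum.cong) auto
      then show ?thesis
        by (simp add: wlen_def sum_list_sum_nth atLeast0LessThan)
    qed
    moreover have "\<exists>d<n. \<exists>v<n. E g L d v \<noteq> 0"
      using E_complete[OF tr order_refl] trace_bounds[OF tr order_refl] by blast
    moreover have "nserve g L = length (served es)"
      unfolding nserve_def count by (simp add: served_def)
    moreover have "nfar g L = card T" "nclose g L = length (filter (\<lambda>e. fst e = Suc 0) es)"
      using count[of "\<lambda>a. a = 3"] count[of "\<lambda>a. a = 1"] es(9)
      by (simp_all add: nfar_def nclose_def)
    ultimately show ?thesis
      unfolding accept_def using es cap map_g by (simp add: ok_def st_def)
  qed
  ultimately show ?thesis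
    by blast
qed

text \<open>Positive edge weights are what bounds the length of a guess in terms of
  \<open>r\<close>.\<close>

lemma iweight_ge: "iwalk p \<Longrightarrow> length p \<le> iweight p + 1"
proof (induction p rule: induct_list012)
  case (3 v u p)
  then have "iwalk (u # p)" "2 \<le> adj v u"
    using adj_ge_2[of v u] by (auto simp: iwalk_def)
  then show ?case
    using 3 by auto
qed auto

text \<open>Only the walks with an edge enter the plan. What is lost are one-vertex walks with at
  most one client each, and they come back in the vehicle count of \<open>accept\<close>.\<close>

lemma accept_complete:
  assumes "iroute ps A"
  shows "\<exists>g. (\<forall>i. g i < Q) \<and> (\<forall>i\<ge>L + L * L. g i = 0) \<and> accept g"
proof -
  have R: "length ps \<le> k" "\<And>p. p \<in> set ps \<Longrightarrow> iclosed p \<and> iweight p \<le> gb"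
    "\<And>c. c \<in> C \<Longrightarrow> A c < length ps \<and> c \<in> set (ps ! A c)"
    "\<And>i. i < length ps \<Longrightarrow> (\<Sum>c\<in>{c \<in> C. A c = i}. dem c) \<le> cap"
    "(\<Sum>p\<leftarrow>ps. iweight p) \<le> r"
    using assms by (auto simp: iroute_def)
  define js where "js = filter (\<lambda>i. 2 \<le> length (ps ! i)) [0..<length ps]"
  define F where "F i = {c \<in> C. A c = i}" for i
  define qs where "qs = map (\<lambda>i. (ps ! i, F i)) js"
  obtain d0 where d0: "d0 < n" "dep d0"
    using depot_ex by blast
  let ?e = "nxt d0 qs"
  have js: "set js = {i. i < length ps \<and> 2 \<le> length (ps ! i)}" "distinct js"
    by (auto simp: js_def)
  have good: "\<forall>q\<in>set qs. good q"
    using R by (auto simp: qs_def js good_def F_def)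
  have e: "?e < n" "dep ?e"
  proof -
    have "?e < n \<and> dep ?e"
      using good d0 by (cases qs) (auto simp: good_def iclosed_def iwalk_def subset_iff)
    then show "?e < n" "dep ?e"
      by auto
  qed
  note cnt = plan_counts[OF good, of d0]
  have S: "set (served (plan d0 qs)) = {c \<in> C. 2 \<le> length (ps ! A c)}"
    using plan_served[OF good, of d0] R(3) by (auto simp: qs_def js F_def)
  have "sorted_wrt (<) js"
    unfolding js_def by (intro sorted_wrt_filter) simp
  then have "sorted_wrt (\<lambda>i j. F i \<inter> F j = {}) js"
    by (rule sorted_wrt_mono_rel[rotated]) (auto simp: F_def)
  then have dist: "distinct (served (plan d0 qs))"
    using plan_served[OF good, of d0] by (simp add: qs_def sorted_wrt_map)
  \<comment> \<open>A one-vertex walk consists of a depot, so a client that is no depot lies on a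
    walk with an edge.\<close>
  have far: "2 \<le> length (ps ! A c)" if "c \<in> T" for c
  proof (rule ccontr)
    assume short: "\<not> 2 \<le> length (ps ! A c)"
    have c: "c \<in> C" "\<not> dep c"
      using that by (auto simp: T_def)
    then have "c \<in> set (ps ! A c)" "iclosed (ps ! A c)"
      using R(2,3) by auto
    moreover from this have "ps ! A c = [c]"
      using short by (cases "ps ! A c" rule: remdups_adj.cases) auto
    ultimately show False
      using c by (simp add: iclosed_def)
  qed
  have nT: "length (filter (\<lambda>v. \<not> dep v) (served (plan d0 qs))) = card T"
  proof -
    have "set (filter (\<lambda>v. \<not> dep v) (served (plan d0 qs))) = T"
      using S far by (auto simp: T_def)
    then show ?thesis
      using distinct_card[OF distinct_filter[OF dist]] by metis
  qed
  \<comment> \<open>The other clients are mapped injectively by \<open>A\<close> to vehicles with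
    one-vertex walks, so there are at most \<open>length ps - length qs\<close> of them.\<close>
  have nC: "card C + length qs \<le> k + length (served (plan d0 qs))"
  proof -
    let ?S = "{c \<in> C. 2 \<le> length (ps ! A c)}" and ?J = "{i. i < length ps \<and> length (ps ! i) < 2}"
    have "inj_on A (C - ?S)"
    proof (rule inj_onI)
      fix a b assume ab: "a \<in> C - ?S" "b \<in> C - ?S" "A a = A b"
      then have "a \<in> set (ps ! A a)" "b \<in> set (ps ! A a)" "length (ps ! A a) < 2"
        using R(3)[of a] R(3)[of b] by auto
      then show "a = b"
        by (cases "ps ! A a") auto
    qed
    moreover have "A ` (C - ?S) \<subseteq> ?J"
      using R(3) by auto
    ultimately have "card (C - ?S) \<le> card ?J"
      by (intro card_inj_on_le) auto
    moreover have "card (C - ?S) = card C - card ?S" "card ?S \<le> card C"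
      using finite_C by (auto intro!: card_Diff_subset card_mono finite_subset[of _ C])
    moreover have "length (served (plan d0 qs)) = card ?S"
      using distinct_card[OF dist] S by simp
    moreover have "length qs = card {i. i < length ps \<and> 2 \<le> length (ps ! i)}"
      using js distinct_card[of "js"] by (simp add: qs_def)
    moreover have "card {i. i < length ps \<and> 2 \<le> length (ps ! i)} + card ?J = length ps"
    proof -
      have "{i. i < length ps \<and> 2 \<le> length (ps ! i)} \<union> ?J = {..<length ps}"
        by auto
      moreover have "{i. i < length ps \<and> 2 \<le> length (ps ! i)} \<inter> ?J = {}"
        by auto
      ultimately show ?thesis
        using card_Un_disjoint[of "{i. i < length ps \<and> 2 \<le> length (ps ! i)}" ?J] by simp
    qed
    ultimately show ?thesis
      using R(1) by linarith
  qed
  have wq: "(\<Sum>q\<leftarrow>qs. iweight (fst q)) \<le> r"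
  proof -
    have "(\<Sum>q\<leftarrow>qs. iweight (fst q)) = (\<Sum>i\<leftarrow>js. iweight (ps ! i))"
      by (simp add: qs_def comp_def)
    also have "\<dots> \<le> (\<Sum>i\<leftarrow>[0..<length ps]. iweight (ps ! i))"
      unfolding js_def by (rule sum_list_filter_le_nat)
    also have "map (\<lambda>i. iweight (ps ! i)) [0..<length ps] = map iweight ps"
      by (rule nth_equalityI) auto
    finally show ?thesis
      using R(5) by simp
  qed
  have len: "length (plan d0 qs) \<le> L"
  proof -
    \<comment> \<open>With at least two vertices, a walk of weight w has at most w + 1 <= 2 * w of
      them. Summing the bound 2 * length on the actions gives 4 * r, the value of
      \<open>L\<close>.\<close>
    have "2 * length (fst q) \<le> 4 * iweight (fst q)" if "q \<in> set qs" for q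
    proof -
      obtain i where "i \<in> set js" "q = (ps ! i, F i)"
        using \<open>q \<in> set qs\<close> unfolding qs_def by auto
      then have "2 \<le> length (fst q)"
        unfolding js by simp
      moreover have "length (fst q) \<le> iweight (fst q) + 1"
        by (rule iweight_ge[OF good_iwalk[OF bspec[OF good that]]])
      ultimately show ?thesis
        by linarith
    qed
    then have "(\<Sum>q\<leftarrow>qs. 2 * length (fst q)) \<le> (\<Sum>q\<leftarrow>qs. 4 * iweight (fst q))"
      by (rule sum_list_mono)
    also have "\<dots> = 4 * (\<Sum>q\<leftarrow>qs. iweight (fst q))"
      by (rule sum_list_const_mult)
    finally have "(\<Sum>q\<leftarrow>qs. 2 * length (fst q)) \<le> 4 * (\<Sum>q\<leftarrow>qs. iweight (fst q))" .
    moreover have "length (plan d0 qs) \<le> (\<Sum>q\<leftarrow>qs. 2 * length (fst q))"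
      using cnt by (elim conjE)
    ultimately show ?thesis
      using wq unfolding L_def by linarith
  qed
  define c' where "c' = endc (?e, ?e, 0) (plan d0 qs)"
  \<comment> \<open>Padding with idle codes brings the list to length exactly
    \<open>L\<close>.\<close>
  define es where "es = plan d0 qs @ replicate (L - length (plan d0 qs)) (0, c')"
  note ps = plan_steps[OF d0 good]
  have c': "dof c' < n" "vof c' < n"
    using endc_bounds[OF ps] e by (simp_all add: c'_def)
  have pad: "steps c' (replicate m (0, c'))" "wlen (replicate m (0, c')) = 0"
    "served (replicate m (0, c')) = []" "okl (0, 0) (map fst (replicate m (0, c')))"
    "fold mst (map fst (replicate m (0, c'))) (0, 0) = (0, 0)" for m
    by (induction m) (use c' in \<open>simp_all add: tstep_def served_Cons serve_def mst_def\<close>)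
  have cap: "dem v \<le> cap" if "v < n" for v
  proof (cases "v \<in> C")
    case True
    then have "dem v \<le> (\<Sum>c\<in>{c \<in> C. A c = A v}. dem c)"
      using finite_C by (intro member_le_sum) auto
    then show ?thesis
      using R(3)[OF True] R(4)[of "A v"] by linarith
  qed (use that in \<open>simp add: C_def\<close>)
  show ?thesis
  proof (rule steps_accept)
    show "steps (?e, ?e, 0) es"
      using ps pad by (simp add: es_def steps_append c'_def)
    show "length es = L"
      using len by (simp add: es_def)
    show "?e < n" "dep ?e"
      using e by auto
    show "okl (0, 0) (map fst es)" "snd (fold mst (map fst es) (0, 0)) = 0"
      using cnt pad by (simp_all add: es_def okl_append del: map_replicate)
    show "wlen es \<le> r"
      using cnt pad wq by (simp add: es_def)
    show "distinct (served es)"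
      using dist pad by (simp add: es_def)
    show "length (filter (\<lambda>e. fst e = 3) es) = card T"
      using cnt nT by (simp add: es_def)
    show "card C + length (filter (\<lambda>e. fst e = Suc 0) es) \<le> k + length (served es)"
      using cnt nC pad by (simp add: es_def)
  qed (use cap in simp)
qed

end

section \<open>The search program\<close>

text \<open>Subtraction is truncated at 0, so 1 - a is negation, and a - b is 0 exactly when a is at
  most b.\<close>

definition NotE :: "exp \<Rightarrow> exp" where "NotE a = Minus (N 1) a"
definition AndE :: "exp \<Rightarrow> exp \<Rightarrow> exp" where "AndE a b = NotE (Plus (NotE a) (NotE b))"
definition EqE :: "exp \<Rightarrow> exp \<Rightarrow> exp" where "EqE a b = NotE (Plus (Minus a b) (Minus b a))"
definition LeE :: "exp \<Rightarrow> exp \<Rightarrow> exp" where "LeE a b = NotE (Minus a b)"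

lemma ev_bool [simp]:
  "ev (NotE a) s = of_bool (ev a s = 0)"
  "ev (AndE a b) s = of_bool (ev a s \<noteq> 0 \<and> ev b s \<noteq> 0)"
  "ev (EqE a b) s = of_bool (ev a s = ev b s)"
  "ev (LeE a b) s = of_bool (ev a s \<le> ev b s)"
  by (auto simp: NotE_def AndE_def EqE_def LeE_def)

declare den.simps(6) [simp del]

text \<open>Division by repeated subtraction. As loops are bounded, \<open>z\<close> has to hold at
  least the quotient; rounds after that do nothing.\<close>

definition divmod :: "nat \<Rightarrow> nat \<Rightarrow> nat \<Rightarrow> nat \<Rightarrow> nat \<Rightarrow> com" where
  "divmod x y q j z =
     Assign q (N 0) ;;
     For j z (Cond (LeE (V y) (V x))
       (Assign x (Minus (V x) (V y)) ;; Assign q (Plus (V q) (N 1))) Skip)"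

lemma den_divmod:
  assumes dist: "distinct [x, y, q, j, z]"
    and y: "0 < fst s y" and z: "fst s x div fst s y \<le> fst s z"
  shows "fst (den (divmod x y q j z) s) x = fst s x mod fst s y"
    "fst (den (divmod x y q j z) s) q = fst s x div fst s y"
    "snd (den (divmod x y q j z) s) = snd s"
proof -
  let ?body = "Cond (LeE (V y) (V x))
       (Assign x (Minus (V x) (V y)) ;; Assign q (Plus (V q) (N 1))) Skip"
  let ?s = "setv q 0 s"
  let ?a = "fst s x" and ?b = "fst s y"
  define P where "P i t \<longleftrightarrow> fst t y = ?b \<and> fst t x + fst t q * ?b = ?a \<and>
      fst t q = min i (?a div ?b) \<and> snd t = snd s" for i t
  have "P (fst ?s z) (den (For j z ?body) ?s)"
  proof (rule den_For_induct[where Q = P])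
    show "P 0 ?s"
      using dist by (simp add: P_def)
    fix i t assume "P i t"
    then have t: "fst t y = ?b" "fst t x + fst t q * ?b = ?a" "fst t q = min i (?a div ?b)"
      "snd t = snd s"
      by (auto simp: P_def)
    show "P (Suc i) (den ?body (setv j i t))"
    proof (cases "i < ?a div ?b")
      case True
      then have q: "fst t q = i"
        using t(3) by simp
      have "Suc i * ?b \<le> ?a div ?b * ?b"
        using True by (intro mult_le_mono1) simp
      then have "Suc i * ?b \<le> ?a"
        using div_times_less_eq_dividend le_trans by blast
      then have x: "?b \<le> fst t x"
        using t(2) q by simp
      have d: "den ?body (setv j i t) = setv q (Suc i) (setv x (fst t x - ?b) (setv j i t))"
        using dist x t(1) q by auto
      have "fst t x - ?b + Suc i * ?b = ?a"
        using x t(2) q by simp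
      then show ?thesis
        using t(1,4) dist True unfolding d P_def by auto
    next
      case False
      then have q: "fst t q = ?a div ?b"
        using t(3) by simp
      then have "fst t x = ?a mod ?b"
        using t(2) div_mult_mod_eq[of ?a ?b] by simp
      then have "\<not> ?b \<le> fst t x"
        using mod_less_divisor[OF y, of ?a] by simp
      then have "den ?body (setv j i t) = setv j i t"
        using dist t(1) by simp
      then show ?thesis
        using t q dist False unfolding P_def by auto
    qed
  qed
  then have *: "P (fst s z) (den (divmod x y q j z) s)"
    using dist by (auto simp: divmod_def)
  then have q: "fst (den (divmod x y q j z) s) q = ?a div ?b"
    using z by (simp add: P_def)
  then show "fst (den (divmod x y q j z) s) q = ?a div ?b" "snd (den (divmod x y q j z) s) = snd s"
    using * by (auto simp: P_def)
  show "fst (den (divmod x y q j z) s) x = ?a mod ?b"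
    using * q div_mult_mod_eq[of ?a ?b] by (simp add: P_def)
qed

lemma wr_divmod [simp]: "wr (divmod x y q j z) = {q, j, x}" "awr (divmod x y q j z) = {}"
  by (auto simp: divmod_def)

abbreviation (input) "vBASE \<equiv> 2 :: nat"
abbreviation (input) "vR \<equiv> 3 :: nat"
abbreviation (input) "vN \<equiv> 4 :: nat"
abbreviation (input) "vK \<equiv> 5 :: nat"
abbreviation (input) "vCAP \<equiv> 6 :: nat"
abbreviation (input) "vGB \<equiv> 7 :: nat"
abbreviation (input) "vL \<equiv> 8 :: nat"
abbreviation (input) "vLEN \<equiv> 9 :: nat"
abbreviation (input) "vQ \<equiv> 10 :: nat"
abbreviation (input) "vTOT \<equiv> 11 :: nat"
abbreviation (input) "vBETA \<equiv> 12 :: nat"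
abbreviation (input) "vP \<equiv> 13 :: nat"
abbreviation (input) "vIT \<equiv> 14 :: nat"
abbreviation (input) "vI \<equiv> 15 :: nat"
abbreviation (input) "vJ \<equiv> 16 :: nat"
abbreviation (input) "vX \<equiv> 17 :: nat"
abbreviation (input) "vQUO \<equiv> 18 :: nat"
abbreviation (input) "vTI \<equiv> 19 :: nat"
abbreviation (input) "vD \<equiv> 20 :: nat"
abbreviation (input) "vV \<equiv> 21 :: nat"
abbreviation (input) "vU \<equiv> 22 :: nat"
abbreviation (input) "vA \<equiv> 23 :: nat"
abbreviation (input) "vW \<equiv> 24 :: nat"
abbreviation (input) "vGC \<equiv> 25 :: nat"
abbreviation (input) "vNC \<equiv> 26 :: nat"
abbreviation (input) "vNS \<equiv> 27 :: nat"
abbreviation (input) "vNF \<equiv> 28 :: nat"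
abbreviation (input) "vOPEN \<equiv> 29 :: nat"
abbreviation (input) "vOK \<equiv> 30 :: nat"
abbreviation (input) "vFL \<equiv> 31 :: nat"
abbreviation (input) "vNEW \<equiv> 32 :: nat"
abbreviation (input) "vVIOL \<equiv> 33 :: nat"
abbreviation (input) "vS \<equiv> 34 :: nat"
abbreviation (input) "vANY \<equiv> 35 :: nat"
abbreviation (input) "vCT \<equiv> 36 :: nat"
abbreviation (input) "vCC \<equiv> 37 :: nat"
abbreviation (input) "vOLD \<equiv> 38 :: nat"
abbreviation (input) "vBAD \<equiv> 39 :: nat"

text \<open>Offsets into \<open>encode\<close>: six header cells, \<open>n\<close> depot flags,
  \<open>n\<close> demands and the matrix of shifted edge weights, row by row.\<close>

definition depE :: "exp \<Rightarrow> exp" where "depE v = Mem (Plus (N 6) v)"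
definition demE :: "exp \<Rightarrow> exp" where "demE v = Mem (Plus (Plus (N 6) (V vN)) v)"
definition adjE :: "exp \<Rightarrow> exp \<Rightarrow> exp" where
  "adjE u v = Mem (Plus (Plus (Plus (N 6) (V vN)) (V vN)) (Plus (Mul u vN) v))"
text \<open>The time is the leading digit, so row \<open>t\<close> can be read while row
  \<open>t + 1\<close> is written.\<close>

definition tabE :: "exp \<Rightarrow> exp \<Rightarrow> exp \<Rightarrow> exp" where
  "tabE t d v = Plus (Mul (Plus (Mul t vN) d) vN) v"
definition phiE :: "exp \<Rightarrow> exp \<Rightarrow> exp" where
  "phiE t v = Arr 2 (Plus (Mul t vN) v)"

text \<open>Every division is given \<open>vTOT\<close> rounds, enough for any quotient of
  \<open>vIT\<close>. This multiplies the time by the number of guesses once more, which only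
  affects the degree of the bound.\<close>

definition decode :: com where
  "decode =
     Assign vX (V vIT) ;;
     For vI vLEN (divmod vX vQ vQUO vJ vTOT ;; Put 0 (V vI) (V vX) ;; Assign vX (V vQUO))"

definition init_table :: com where
  "init_table = For vD vN (For vV vN
     (Put 1 (tabE (N 0) (V vD) (V vV)) (AndE (EqE (V vD) (V vV)) (depE (V vV)))))"

definition init_counts :: com where
  "init_counts = Assign vW (N 0) ;; Assign vGC (N 0) ;; Assign vOPEN (N 0) ;; Assign vOK (N 1) ;;
     Assign vNC (N 0) ;; Assign vNS (N 0) ;; Assign vNF (N 0)"

definition counts_step :: com where
  "counts_step =
     Assign vA (Arr 0 (V vTI)) ;;
     Assign vW (Plus (V vW) (Minus (V vA) (N 3))) ;;
     Cond (EqE (V vA) (N 1)) (Assign vGC (N 0) ;; Assign vOPEN (N 0))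
       (Assign vGC (Plus (V vGC) (Minus (V vA) (N 3))) ;;
        Assign vOPEN (Plus (V vOPEN) (Plus (EqE (V vA) (N 2)) (EqE (V vA) (N 3))))) ;;
     Assign vOK (AndE (V vOK) (LeE (V vGC) (V vGB))) ;;
     Assign vNC (Plus (V vNC) (EqE (V vA) (N 1))) ;;
     Assign vNS (Plus (V vNS) (Plus (EqE (V vA) (N 2)) (EqE (V vA) (N 3)))) ;;
     Assign vNF (Plus (V vNF) (EqE (V vA) (N 3)))"

text \<open>A sum of natural numbers is nonzero exactly if a summand is, so adding up table entries
  decides existence; \<open>any_entry\<close> does the same, and \<open>violations\<close> uses the
  negation for a universal statement.\<close>

definition closable :: com where
  "closable = Assign vFL (N 0) ;;
     For vD vN (Assign vFL (Plus (V vFL) (Arr 1 (tabE (V vTI) (V vD) (V vD)))))"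

definition violation_step :: com where
  "violation_step = Assign vX (Arr 0 (V vS)) ;;
     Cond (Plus (EqE (V vX) (N 2)) (EqE (V vX) (N 3)))
       (Cond (Minus (V vTI) (V vS))
         (Assign vVIOL (Plus (V vVIOL)
            (NotE (phiE (Arr 0 (Plus (V vL) (Plus (Mul (V vS) vL) (V vTI)))) (V vV)))))
         (Cond (Minus (V vS) (V vTI))
           (Assign vVIOL (Plus (V vVIOL)
              (phiE (Arr 0 (Plus (V vL) (Plus (Mul (V vTI) vL) (V vS)))) (V vV))))
           Skip))
       Skip"

definition violations :: com where
  "violations = Assign vVIOL (N 0) ;; For vS vL violation_step"

definition min_test :: com where
  "min_test = Cond (AndE (EqE (adjE (V vU) (V vV)) (Minus (V vA) (N 2)))
       (AndE (V vOLD) (Plus (NotE (V vNEW)) (Minus (V vNEW) (V vOLD)))))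
     (Assign vNEW (V vOLD)) Skip"

definition min_step :: com where
  "min_step = Assign vOLD (Arr 1 (tabE (V vTI) (V vD) (V vU))) ;; min_test"

definition new_entry :: com where
  "new_entry =
     Cond (EqE (V vA) (N 0)) (Assign vNEW (Arr 1 (tabE (V vTI) (V vD) (V vV))))
    (Cond (EqE (V vA) (N 1))
       (Assign vNEW (AndE (EqE (V vD) (V vV)) (AndE (depE (V vV)) (V vFL))))
    (Cond (LeE (V vA) (N 3))
       (Assign vOLD (Arr 1 (tabE (V vTI) (V vD) (V vV))) ;;
        Assign vX (demE (V vV)) ;;
        Cond (AndE (V vOLD) (AndE (V vX) (AndE (EqE (depE (V vV)) (EqE (V vA) (N 2)))
               (AndE (NotE (V vVIOL)) (LeE (Plus (V vOLD) (V vX)) (Plus (V vCAP) (N 1)))))))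
          (Assign vNEW (Plus (V vOLD) (V vX))) (Assign vNEW (N 0)))
       (Assign vNEW (N 0) ;;
        For vU vN min_step)))"

text \<open>The current vertex is the outer loop variable because \<open>sep\<close> depends on time
  and current vertex, but not on the first vertex of the walk.\<close>

definition table_step :: com where
  "table_step = For vV vN (violations ;;
     For vD vN (new_entry ;; Put 1 (tabE (Plus (V vTI) (N 1)) (V vD) (V vV)) (V vNEW)))"

definition any_entry :: com where
  "any_entry = Assign vANY (N 0) ;;
     For vD vN (For vV vN
       (Assign vANY (Plus (V vANY) (Arr 1 (tabE (V vL) (V vD) (V vV))))))"

definition verdict :: com where
  "verdict =
     Cond (AndE (V vOK) (AndE (LeE (V vW) (V vR)) (AndE (V vANY) (AndE (NotE (V vOPEN))
       (AndE (EqE (V vNF) (V vCT))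
       (AndE (LeE (Plus (V vCC) (V vNC)) (Plus (V vK) (V vNS))) (NotE (V vBAD))))))))
       (Assign 0 (N 1)) Skip"

definition try_guess :: com where
  "try_guess = decode ;; init_table ;; init_counts ;;
     For vTI vL (counts_step ;; closable ;; table_step) ;; any_entry ;; verdict"

definition search :: com where
  "search = Assign 0 (N 0) ;; For vIT vTOT try_guess"

context inst
begin

definition base :: nat where "base = 6 + n + n + n * n"

definition env_vars :: "nat set" where
  "env_vars = {vBASE, vR, vN, vK, vCAP, vGB, vL, vLEN, vQ, vTOT, vCT, vCC, vBAD}"

text \<open>What the search never modifies: parameters, input and separating functions. By
  \<open>env_den\<close> its preservation is a matter of the sets \<open>wr\<close> and
  \<open>awr\<close>.\<close>

definition env :: "state \<Rightarrow> bool" where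
  "env s \<longleftrightarrow> fst s vBASE = base \<and> fst s vR = r \<and> fst s vN = n \<and> fst s vK = k \<and> fst s vCAP = cap \<and>
     fst s vGB = gb \<and> fst s vL = L \<and> fst s vLEN = L + L * L \<and> fst s vQ = Q \<and>
     fst s vTOT = Q ^ (L + L * L) \<and> fst s vCT = card T \<and> fst s vCC = card C \<and>
     (fst s vBAD = 0 \<longleftrightarrow> (\<forall>v<n. dem v \<le> cap)) \<and>
     (\<forall>v<n. snd s (6 + v) = of_bool (dep v)) \<and>
     (\<forall>v<n. snd s (6 + n + v) = dem v) \<and>
     (\<forall>u<n. \<forall>v<n. snd s (6 + n + n + (u * n + v)) = adj u v) \<and>
     (\<forall>t. \<forall>v<n. snd s (cell base 2 (t * n + v)) = phi t v)"

lemma pair_index_less: "u < n \<Longrightarrow> v < n \<Longrightarrow> u * n + v < n * n"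
proof -
  assume "u < n" "v < n"
  then have "u * n + v < u * n + n"
    by simp
  also have "\<dots> = Suc u * n"
    by simp
  also have "\<dots> \<le> n * n"
    using \<open>u < n\<close> by (intro mult_le_mono1) simp
  finally show ?thesis .
qed

lemma env_simps:
  assumes "env s"
  shows "fst s vBASE = base" "fst s vR = r" "fst s vN = n" "fst s vK = k" "fst s vCAP = cap"
    "fst s vGB = gb" "fst s vL = L" "fst s vLEN = L + L * L" "fst s vQ = Q"
    "fst s vTOT = Q ^ (L + L * L)" "fst s vCT = card T" "fst s vCC = card C"
    "fst s vBAD = 0 \<longleftrightarrow> (\<forall>v<n. dem v \<le> cap)"
    "v < n \<Longrightarrow> snd s (6 + v) = of_bool (dep v)"
    "v < n \<Longrightarrow> snd s (6 + n + v) = dem v"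
    "u < n \<Longrightarrow> v < n \<Longrightarrow> snd s (6 + n + n + (u * n + v)) = adj u v"
    "v < n \<Longrightarrow> snd s (cell base 2 (t * n + v)) = phi t v"
  using assms unfolding env_def by blast+

lemma env_setv: "env s \<Longrightarrow> x \<notin> env_vars \<Longrightarrow> env (setv x i s)"
  unfolding env_def env_vars_def by simp

lemma env_den:
  assumes "env s" "wr c \<inter> env_vars = {}" "awr c \<subseteq> {0, 1}"
  shows "env (den c s)"
proof -
  have b: "fst s vBASE = base"
    using assms(1) by (rule env_simps)
  have f: "fst (den c s) x = fst s x" if "x \<in> env_vars" for x
    using assms(2) that by (intro den_wr) blast
  have "2 \<notin> wr c"
    using assms(2) by (auto simp: env_vars_def)
  moreover have "a < 3" if "a \<in> awr c" for a
    using that assms(3) by auto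
  moreover have "2 \<notin> awr c"
    using assms(3) by auto
  ultimately have m: "snd (den c s) (cell base 2 i) = snd s (cell base 2 i)"
    and i: "x < base \<Longrightarrow> snd (den c s) x = snd s x" for i x
    using den_awr(1)[of c base s 2 i] den_awr(2)[of c base s x] b assms(3) by auto
  have "6 + v < base" "6 + n + v < base" if "v < n" for v
    using that by (auto simp: base_def)
  moreover have "6 + n + n + (u * n + v) < base" if "u < n" "v < n" for u v
    using pair_index_less[OF that] by (simp add: base_def)
  moreover have regs:
    "fst (den c s) vBASE = fst s vBASE"
    "fst (den c s) vR = fst s vR"
    "fst (den c s) vN = fst s vN"
    "fst (den c s) vK = fst s vK"
    "fst (den c s) vCAP = fst s vCAP"
    "fst (den c s) vGB = fst s vGB"
    "fst (den c s) vL = fst s vL"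
    "fst (den c s) vLEN = fst s vLEN"
    "fst (den c s) vQ = fst s vQ"
    "fst (den c s) vTOT = fst s vTOT"
    "fst (den c s) vCT = fst s vCT"
    "fst (den c s) vCC = fst s vCC"
    "fst (den c s) vBAD = fst s vBAD"
    by (rule f, simp add: env_vars_def)+
  ultimately show ?thesis
    using assms(1) unfolding env_def regs m by (simp add: i)
qed

lemma ev_inputs:
  assumes "env s"
  shows "ev v s < n \<Longrightarrow> ev (depE v) s = of_bool (dep (ev v s))"
    "ev v s < n \<Longrightarrow> ev (demE v) s = dem (ev v s)"
    "ev u s < n \<Longrightarrow> ev v s < n \<Longrightarrow> ev (adjE u v) s = adj (ev u s) (ev v s)"
    "ev v s < n \<Longrightarrow> ev (phiE t v) s = phi (ev t s) (ev v s)"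
  using env_simps[OF assms] by (simp_all add: depE_def demE_def adjE_def phiE_def)

definition tix :: "nat \<Rightarrow> nat \<Rightarrow> nat \<Rightarrow> nat" where
  "tix t d v = (t * n + d) * n + v"

lemma ev_tabE: "env s \<Longrightarrow> ev (tabE t d v) s = tix (ev t s) (ev d s) (ev v s)"
  by (simp add: tabE_def tix_def env_simps)

lemma tix_inj:
  assumes "d < n" "v < n" "d' < n" "v' < n"
  shows "tix t d v = tix t' d' v' \<longleftrightarrow> t = t' \<and> d = d' \<and> v = v'"
proof -
  have dm: "(q * n + m) div n = q" "(q * n + m) mod n = m" if "m < n" for q m
    using that by auto
  show ?thesis
    unfolding tix_def using dm assms by metis
qed

definition guess :: "(nat \<Rightarrow> nat) \<Rightarrow> state \<Rightarrow> bool" where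
  "guess g s \<longleftrightarrow> (\<forall>i<L + L * L. snd s (cell base 0 i) = g i)"

definition table :: "(nat \<Rightarrow> nat) \<Rightarrow> nat \<Rightarrow> state \<Rightarrow> bool" where
  "table g t s \<longleftrightarrow> (\<forall>d<n. \<forall>v<n. snd s (cell base 1 (tix t d v)) = E g t d v)"

lemma guess_setv [simp]: "guess g (setv x i s) = guess g s"
  by (simp add: guess_def)

lemma table_setv [simp]: "table g t (setv x i s) = table g t s"
  by (simp add: table_def)

lemma den_cell:
  assumes "env s" "2 \<notin> wr c" "awr c \<subseteq> {0, 1}" "a < 3" "a \<notin> awr c"
  shows "snd (den c s) (cell base a i) = snd s (cell base a i)"
proof (rule den_awr(1)[OF assms(2) _ _ assms(4,5)])
  show "base = fst s 2"
    using env_simps(1)[OF assms(1)] by simp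
qed (use assms(3) in auto)

lemma guess_den:
  "env s \<Longrightarrow> guess g s \<Longrightarrow> 2 \<notin> wr c \<Longrightarrow> awr c \<subseteq> {1} \<Longrightarrow> guess g (den c s)"
  unfolding guess_def by (subst den_cell) auto

lemma table_den:
  "env s \<Longrightarrow> table g t s \<Longrightarrow> 2 \<notin> wr c \<Longrightarrow> awr c \<subseteq> {0} \<Longrightarrow> table g t (den c s)"
  unfolding table_def by (subst den_cell) auto

lemma tabD: "table g t s \<Longrightarrow> d < n \<Longrightarrow> v < n \<Longrightarrow> snd s (cell base 1 (tix t d v)) = E g t d v"
  by (simp add: table_def)

lemma guessD: "guess g s \<Longrightarrow> i < L + L * L \<Longrightarrow> snd s (cell base 0 i) = g i"
  by (simp add: guess_def)

lemma Q_pos: "0 < Q"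
  using Q_ge by simp

section \<open>Correctness of the parts of the search\<close>

lemma den_decode:
  assumes "env s" "fst s vIT < Q ^ (L + L * L)"
  shows "guess (\<lambda>i. fst s vIT div Q ^ i mod Q) (den decode s)"
proof -
  let ?body = "divmod vX vQ vQUO vJ vTOT ;; Put 0 (V vI) (V vX) ;; Assign vX (V vQUO)"
  let ?s = "setv vX (fst s vIT) s" and ?m = "fst s vIT"
  define P where "P i t \<longleftrightarrow> env t \<and> fst t vX = ?m div Q ^ i \<and>
     (\<forall>j<i. snd t (cell base 0 j) = ?m div Q ^ j mod Q)" for i t
  have "P (fst ?s vLEN) (den (For vI vLEN ?body) ?s)"
  proof (rule den_For_induct[where Q = P])
    show "P 0 ?s"
      using assms(1) by (simp add: P_def env_setv env_vars_def)
    fix i t assume P: "P i t"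
    let ?t = "setv vI i t"
    have t: "env ?t" "fst ?t vX = ?m div Q ^ i" "fst ?t vI = i"
      "\<forall>j<i. snd ?t (cell base 0 j) = ?m div Q ^ j mod Q"
      using P by (auto simp: P_def env_setv env_vars_def)
    note es = env_simps[OF t(1)]
    \<comment> \<open>Quotients do not exceed \<open>vIT\<close>, which is below
      \<open>vTOT\<close>, so the division loop is long enough.\<close>
    have le: "fst ?t vX div fst ?t vQ \<le> fst ?t vTOT"
      using assms(2) t(2) unfolding es
      by (metis div_le_dividend le_trans less_imp_le)
    note dm = den_divmod[where s = ?t, of vX vQ vQUO vJ vTOT, OF _ _ le]
    let ?u = "den (divmod vX vQ vQUO vJ vTOT) ?t"
    have u: "fst ?u vX = ?m div Q ^ i mod Q" "fst ?u vQUO = ?m div Q ^ Suc i" "snd ?u = snd ?t"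
      "fst ?u vI = i" "env ?u"
      using dm es(9) Q_pos t(2) den_wr[of vI "divmod vX vQ vQUO vJ vTOT" ?t]
      by (simp_all add: div_mult2_eq[symmetric] mult.commute t(3) env_den[OF t(1)] env_vars_def)
    have "env (den ?body ?t)"
      using t(1) by (rule env_den) (auto simp: env_vars_def)
    then show "P (Suc i) (den ?body ?t)"
      using u t(4) env_simps(1)[OF u(5)] by (auto simp: P_def less_Suc_eq)
  qed
  moreover have "fst ?s vLEN = L + L * L"
    using env_simps(8)[OF assms(1)] by simp
  ultimately show ?thesis
    by (simp add: decode_def guess_def P_def)
qed

lemma den_init_table:
  assumes "env s"
  shows "table g 0 (den init_table s)"
proof -
  let ?put = "Put 1 (tabE (N 0) (V vD) (V vV)) (AndE (EqE (V vD) (V vV)) (depE (V vV)))"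
  \<comment> \<open>Progress is ordered lexicographically. A finished row \<open>P d n\<close>
    coincides with the start \<open>P (Suc d) 0\<close> of the next one, which joins the two
    loops.\<close>
  define P where "P d v t \<longleftrightarrow> env t \<and> (\<forall>d'<n. \<forall>v'<n. d' < d \<or> d' = d \<and> v' < v \<longrightarrow>
    snd t (cell base 1 (tix 0 d' v')) = E g 0 d' v')" for d v t
  have inner: "P d n (den (For vV vN ?put) t)" if P: "P d 0 t" and d: "fst t vD = d" "d < n" for d t
  proof -
    have "(\<lambda>v u. P d v u \<and> fst u vD = d) (fst t vN) (den (For vV vN ?put) t)"
    proof (rule den_For_induct[where Q = "\<lambda>v u. P d v u \<and> fst u vD = d"])
      show "P d 0 t \<and> fst t vD = d"
        using that by simp
      fix v u assume v: "v < fst t vN" and u: "P d v u \<and> fst u vD = d"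
      let ?u = "setv vV v u"
      have e: "env ?u" "env t"
        using u P by (auto simp: P_def env_setv env_vars_def)
      then have vn: "v < n"
        using v env_simps(3) by simp
      have "env (den ?put ?u)"
        using e(1) by (rule env_den) (auto simp: env_vars_def)
      then show "P d (Suc v) (den ?put ?u) \<and> fst (den ?put ?u) vD = d"
        using u e vn d(2)
        by (auto simp: P_def less_Suc_eq ev_tabE ev_inputs env_simps tix_inj)
    qed
    moreover have "fst t vN = n"
      using P env_simps(3) by (auto simp: P_def)
    ultimately show ?thesis
      by simp
  qed
  have "P (fst s vN) 0 (den (For vD vN (For vV vN ?put)) s)"
  proof (rule den_For_induct[where Q = "\<lambda>d t. P d 0 t"])
    show "P 0 0 s"
      using assms by (simp add: P_def)
    fix d t assume d: "d < fst s vN" and P: "P d 0 t"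
    then have "P d 0 (setv vD d t)" "d < n"
      using env_simps(3)[OF assms] by (auto simp: P_def env_setv env_vars_def)
    then have "P d n (den (For vV vN ?put) (setv vD d t))"
      by (intro inner) auto
    then show "P (Suc d) 0 (den (For vV vN ?put) (setv vD d t))"
      by (auto simp: P_def less_Suc_eq)
  qed
  then show ?thesis
    using env_simps(3)[OF assms] unfolding init_table_def table_def P_def by simp
qed

end

lemma all_less_Suc: "(\<forall>s<Suc i. P s) \<longleftrightarrow> (\<forall>s<i. P s) \<and> P i"
  by (auto simp: less_Suc_eq)

context inst
begin

definition counts :: "(nat \<Rightarrow> nat) \<Rightarrow> nat \<Rightarrow> state \<Rightarrow> bool" where
  "counts g t s \<longleftrightarrow> fst s vW = wsum g t \<and> fst s vGC = fst (st g t) \<and> fst s vOPEN = snd (st g t) \<and>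
     (fst s vOK \<noteq> 0 \<longleftrightarrow> ok g t) \<and> fst s vNC = nclose g t \<and> fst s vNS = nserve g t \<and>
     fst s vNF = nfar g t"

lemma den_init_counts: "counts g 0 (den init_counts s)"
  by (simp add: counts_def init_counts_def)

lemma den_counts_step:
  assumes "env s" "guess g s" "fst s vTI = t" "t < L" "counts g t s"
  shows "counts g (Suc t) (den counts_step s)" "fst (den counts_step s) vA = g t"
    "snd (den counts_step s) = snd s"
proof -
  have A: "snd s (cell (fst s 2) 0 t) = g t"
    using guessD[OF assms(2), of t] assms(4) env_simps(1)[OF assms(1)] by simp
  show "fst (den counts_step s) vA = g t" "snd (den counts_step s) = snd s"
    using A assms(3) by (simp_all add: counts_step_def)
  show "counts g (Suc t) (den counts_step s)"
    using A assms(3,5) env_simps(6)[OF assms(1)]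
    by (auto simp: counts_step_def counts_def mst_def serve_def)
qed

lemma den_closable:
  assumes "env s" "table g t s" "fst s vTI = t"
  shows "fst (den closable s) vFL \<noteq> 0 \<longleftrightarrow> (\<exists>d<n. E g t d d \<noteq> 0)"
proof -
  let ?body = "Assign vFL (Plus (V vFL) (Arr 1 (tabE (V vTI) (V vD) (V vD))))"
  let ?s = "setv vFL 0 s"
  define P where "P i u \<longleftrightarrow> env u \<and> table g t u \<and> fst u vTI = t \<and>
    (fst u vFL \<noteq> 0 \<longleftrightarrow> (\<exists>d<i. E g t d d \<noteq> 0))" for i u
  have N: "fst ?s vN = n"
    using env_simps(3)[OF assms(1)] by simp
  have "P (fst ?s vN) (den (For vD vN ?body) ?s)"
  proof (rule den_For_induct[where Q = P])
    show "P 0 ?s"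
      using assms by (simp add: P_def env_setv env_vars_def)
    fix i u assume "i < fst ?s vN" "P i u"
    then have i: "i < n" and u: "env (setv vD i u)" "table g t u" "fst u vTI = t"
      "fst u vFL \<noteq> 0 \<longleftrightarrow> (\<exists>d<i. E g t d d \<noteq> 0)"
      using N by (auto simp: P_def env_setv env_vars_def)
    have "ev (Arr 1 (tabE (V vTI) (V vD) (V vD))) (setv vD i u) = E g t i i"
      using tabD[OF u(2) i i] u(3) env_simps(1)[OF u(1)] by (simp add: ev_tabE[OF u(1)])
    moreover have "env (den ?body (setv vD i u))"
      using u(1) by (rule env_den) (auto simp: env_vars_def)
    ultimately show "P (Suc i) (den ?body (setv vD i u))"
      using u by (auto simp: P_def less_Suc_eq)
  qed
  then show ?thesis
    using N unfolding closable_def by (simp add: P_def)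
qed

lemma wr_closable [simp]: "wr closable = {vFL, vD}" "awr closable = {}"
  by (auto simp: closable_def)

lemma pair_index_less_L: "u < L \<Longrightarrow> v < L \<Longrightarrow> L + (u * L + v) < L + L * L"
proof -
  assume "u < L" "v < L"
  then have "u * L + v < u * L + L" "Suc u * L \<le> L * L"
    by (simp_all only: add_less_cancel_left mult_le_mono1 Suc_leI)
  then show ?thesis
    by simp
qed

text \<open>For services at later times \<open>vVIOL\<close> grows by the value of
  \<open>phi\<close> itself, so it is not a count; only its being 0 carries meaning.\<close>

lemma den_violations:
  assumes "env s" "guess g s" "fst s vTI = t" "t < L" "fst s vV = v" "v < n"
  shows "fst (den violations s) vVIOL = 0 \<longleftrightarrow> sep g t v"
proof -
  let ?body = violation_step
  let ?s = "setv vVIOL 0 s"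
  let ?ok = "\<lambda>s. serve (g s) \<longrightarrow>
     (s < t \<longrightarrow> phi (g (L + (s * L + t))) v \<noteq> 0) \<and> (t < s \<longrightarrow> phi (g (L + (t * L + s))) v = 0)"
  define P where "P i u \<longleftrightarrow> env u \<and> guess g u \<and> fst u vTI = t \<and> fst u vV = v \<and>
    (fst u vVIOL = 0 \<longleftrightarrow> (\<forall>s<i. ?ok s))" for i u
  have N: "fst ?s vL = L"
    using env_simps(7)[OF assms(1)] by simp
  have "P (fst ?s vL) (den (For vS vL ?body) ?s)"
  proof (rule den_For_induct[where Q = P])
    show "P 0 ?s"
      using assms by (simp add: P_def env_setv env_vars_def)
    fix i u assume "i < fst ?s vL" "P i u"
    then have i: "i < L" and u: "env u" "guess g u" "fst u vTI = t" "fst u vV = v"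
      "fst u vVIOL = 0 \<longleftrightarrow> (\<forall>s<i. ?ok s)"
      using N by (auto simp: P_def)
    let ?u = "setv vX (g i) (setv vS i u)"
    have e: "env ?u"
      using u(1) by (simp add: env_setv env_vars_def)
    have gi: "snd u (cell (fst u 2) 0 i) = g i"
      using guessD[OF u(2), of i] i env_simps(1)[OF u(1)] by simp
    have p1: "ev (phiE (Arr 0 (Plus (V vL) (Plus (Mul (V vS) vL) (V vTI)))) (V vV)) ?u =
        phi (g (L + (i * L + t))) v"
      using assms(6) u guessD[OF u(2) pair_index_less_L[OF i assms(4)]] env_simps(1,7)[OF u(1)]
      by (subst ev_inputs[OF e]) simp_all
    have p2: "ev (phiE (Arr 0 (Plus (V vL) (Plus (Mul (V vTI) vL) (V vS)))) (V vV)) ?u =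
        phi (g (L + (t * L + i))) v"
      using assms(6) u guessD[OF u(2) pair_index_less_L[OF assms(4) i]] env_simps(1,7)[OF u(1)]
      by (subst ev_inputs[OF e]) simp_all
    have "env (den ?body (setv vS i u))"
      by (rule env_den) (auto simp: violation_step_def env_vars_def u env_setv)
    moreover have "guess g (den ?body (setv vS i u))"
      by (rule guess_den) (auto simp: violation_step_def env_vars_def u env_setv)
    moreover have "fst (den ?body (setv vS i u)) vTI = t" "fst (den ?body (setv vS i u)) vV = v"
      using u by (simp_all add: den_wr violation_step_def del: den.simps)
    moreover have "fst (den ?body (setv vS i u)) vVIOL = 0 \<longleftrightarrow> (\<forall>s<Suc i. ?ok s)"
    proof -
      obtain c where d: "violation_step =
          Assign vX (Arr 0 (V vS)) ;; Cond (Plus (EqE (V vX) (N 2)) (EqE (V vX) (N 3))) c Skip"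
        and c_def: "c = Cond (Minus (V vTI) (V vS))
         (Assign vVIOL (Plus (V vVIOL)
            (NotE (phiE (Arr 0 (Plus (V vL) (Plus (Mul (V vS) vL) (V vTI)))) (V vV)))))
         (Cond (Minus (V vS) (V vTI))
           (Assign vVIOL (Plus (V vVIOL)
              (phiE (Arr 0 (Plus (V vL) (Plus (Mul (V vTI) vL) (V vS)))) (V vV))))
           Skip)"
        unfolding violation_step_def by blast
      have d: "den ?body (setv vS i u) =
          den (Cond (Plus (EqE (V vX) (N 2)) (EqE (V vX) (N 3))) c Skip) ?u"
        unfolding d using gi by simp
      have "fst (den ?body (setv vS i u)) vVIOL = 0 \<longleftrightarrow> fst u vVIOL = 0 \<and> ?ok i"
      proof (cases "serve (g i)")
        case True
        then have c: "ev (Plus (EqE (V vX) (N 2)) (EqE (V vX) (N 3))) ?u \<noteq> 0"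
          by (auto simp: serve_def)
        consider "i < t" | "t < i" | "i = t"
          by linarith
        then show ?thesis
          unfolding d unfolding c_def den.simps(5) if_P[OF c]
          by cases (use True u(3) in \<open>simp_all add: p1 p2\<close>)
      next
        case False
        then show ?thesis
          unfolding d by (simp add: serve_def)
      qed
      then show ?thesis
        unfolding all_less_Suc u(5) .
    qed
    ultimately show "P (Suc i) (den ?body (setv vS i u))"
      unfolding P_def by blast
  qed
  then show ?thesis
    using N unfolding violations_def by (simp add: P_def sep_def)
qed

lemma wr_violations [simp]: "wr violations = {vVIOL, vS, vX}" "awr violations = {}"
  by (auto simp: violations_def violation_step_def)

lemma den_min_entry:
  assumes "env s" "table g t s" "fst s vTI = t" "fst s vA = g t" "fst s vV = v" "v < n"
    "fst s vD = d" "d < n" "fst s vNEW = 0"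
  shows "fst (den (For vU vN min_step) s) vNEW =
       mn (\<lambda>u. if adj u v = g t - 2 then E g t d u else 0) n"
proof -
  let ?body = min_step
  let ?h = "\<lambda>u. if adj u v = g t - 2 then E g t d u else 0"
  define P where "P i u \<longleftrightarrow> env u \<and> table g t u \<and> fst u vTI = t \<and> fst u vA = g t \<and> fst u vV = v \<and>
    fst u vD = d \<and> fst u vNEW = mn ?h i" for i u
  have N: "fst s vN = n"
    using env_simps(3)[OF assms(1)] .
  have "P (fst s vN) (den (For vU vN ?body) s)"
  proof (rule den_For_induct[where Q = P])
    show "P 0 s"
      using assms by (simp add: P_def)
    fix i u assume "i < fst s vN" "P i u"
    then have i: "i < n" and u: "env u" "table g t u" "fst u vTI = t" "fst u vA = g t" "fst u vV = v"
      "fst u vD = d" "fst u vNEW = mn ?h i"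
      using N by (auto simp: P_def)
    let ?w = "setv vU i u"
    let ?u = "setv vOLD (E g t d i) ?w"
    have e: "env ?w" "env ?u"
      using u(1) by (simp_all add: env_setv env_vars_def)
    have old: "ev (Arr 1 (tabE (V vTI) (V vD) (V vU))) ?w = E g t d i"
      using tabD[OF u(2) assms(8) i] u env_simps(1)[OF u(1)] by (simp add: ev_tabE[OF e(1)])
    have a: "ev (adjE (V vU) (V vV)) ?u = adj i v"
      using i assms(6) u by (subst ev_inputs[OF e(2)]) simp_all
    have "env (den ?body ?w)"
      using e(1) by (rule env_den) (auto simp: min_step_def min_test_def env_vars_def)
    moreover have "table g t (den ?body ?w)"
      using e(1) u(2) by (intro table_den) (auto simp: min_step_def min_test_def)
    moreover have "fst (den ?body ?w) vTI = t" "fst (den ?body ?w) vA = g t"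
        "fst (den ?body ?w) vV = v" "fst (den ?body ?w) vD = d"
      using u by (simp_all add: den_wr min_step_def min_test_def del: den.simps)
    moreover have "fst (den ?body ?w) vNEW = mn ?h (Suc i)"
    proof -
      have "den ?body ?w = den min_test ?u"
        using old by (simp add: min_step_def del: ev_Arr)
      then show ?thesis
        using u(4,7) a by (cases "adj i v = g t - 2") (auto simp: min_test_def)
    qed
    ultimately show "P (Suc i) (den ?body ?w)"
      unfolding P_def by blast
  qed
  then show ?thesis
    using N by (simp add: P_def)
qed

lemma den_new_entry:
  assumes "env s" "table g t s" "fst s vTI = t" "fst s vA = g t" "fst s vV = v" "v < n"
    "fst s vD = d" "d < n" "fst s vFL \<noteq> 0 \<longleftrightarrow> (\<exists>d<n. E g t d d \<noteq> 0)"
    "fst s vVIOL = 0 \<longleftrightarrow> sep g t v"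
  shows "fst (den new_entry s) vNEW = E g (Suc t) d v"
proof -
  have tab: "ev (Arr 1 (tabE (V vTI) (V vD) (V vV))) s = E g t d v"
    using tabD[OF assms(2,8,6)] assms env_simps(1)[OF assms(1)] by (simp add: ev_tabE)
  have dp: "ev (depE (V vV)) s = of_bool (dep v)"
    using assms by (subst ev_inputs) simp_all
  consider "g t = 0" | "g t = 1" | "g t = 2 \<or> g t = 3" | "g t > 3"
    by linarith
  then show ?thesis
  proof cases
    case 1
    then show ?thesis
      using assms(4) tab by (simp add: new_entry_def)
  next
    case 2
    then show ?thesis
      using assms(4,5,7,9) dp by (simp add: new_entry_def)
  next
    case 3
    let ?s1 = "setv vOLD (E g t d v) s"
    let ?s2 = "setv vX (dem v) ?s1"
    have e: "env ?s1" "env ?s2"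
      using assms(1) by (simp_all add: env_setv env_vars_def)
    have dm: "ev (demE (V vV)) ?s1 = dem v"
      using assms(5,6) by (subst ev_inputs[OF e(1)]) simp_all
    have dp2: "ev (depE (V vV)) ?s2 = of_bool (dep v)"
      using assms(5,6) by (subst ev_inputs[OF e(2)]) simp_all
    let ?c = "AndE (V vOLD) (AndE (V vX) (AndE (EqE (depE (V vV)) (EqE (V vA) (N 2)))
               (AndE (NotE (V vVIOL)) (LeE (Plus (V vOLD) (V vX)) (Plus (V vCAP) (N 1))))))"
    have A: "ev (EqE (V vA) (N 0)) s = 0" "ev (EqE (V vA) (N 1)) s = 0" "ev (LeE (V vA) (N 3)) s \<noteq> 0"
      using 3 assms(4) by auto
    have d: "den new_entry s = den (Cond ?c (Assign vNEW (Plus (V vOLD) (V vX))) (Assign vNEW (N 0))) ?s2"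
      unfolding new_entry_def den.simps(5) by (simp only: A tab dm den.simps simp_thms if_False if_True)
    have c: "ev ?c ?s2 \<noteq> 0 \<longleftrightarrow> E g t d v \<noteq> 0 \<and> dem v \<noteq> 0 \<and> (dep v \<longleftrightarrow> g t = 2) \<and>
        sep g t v \<and> E g t d v + dem v \<le> cap + 1"
      using assms(4,10) env_simps(5)[OF assms(1)]
      by (simp only: ev_bool dp2 ev.simps fst_setv fun_upd_apply)
        (simp add: conj_ac)
    have "E g (Suc t) d v = (if ev ?c ?s2 \<noteq> 0 then E g t d v + dem v else 0)"
      unfolding c using 3 by (elim disjE) simp_all
    then show ?thesis
      unfolding d by simp
  next
    case 4
    let ?s = "setv vNEW 0 s"
    have e: "env ?s"
      using assms(1) by (simp add: env_setv env_vars_def)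
    have "table g t ?s" "fst ?s vTI = t" "fst ?s vA = g t" "fst ?s vV = v" "fst ?s vD = d"
      "fst ?s vNEW = 0"
      using assms by simp_all
    note min = den_min_entry[OF e this(1-4) assms(6) this(5) assms(8) this(6)]
    have A: "ev (EqE (V vA) (N 0)) s = 0" "ev (EqE (V vA) (N 1)) s = 0" "ev (LeE (V vA) (N 3)) s = 0"
      using 4 assms(4) by simp_all
    have "E g (Suc t) d v = mn (\<lambda>u. if adj u v = g t - 2 then E g t d u else 0) n"
      using 4 by simp
    moreover have "fst (den new_entry s) vNEW = mn (\<lambda>u. if adj u v = g t - 2 then E g t d u else 0) n"
      unfolding min[symmetric] new_entry_def
      by (simp only: den.simps(1-5) A simp_thms if_False ev.simps(1))
    ultimately show ?thesis
      by simp
  qed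
qed

lemma wr_new_entry [simp]: "wr new_entry = {vNEW, vOLD, vX, vU}" "awr new_entry = {}"
  by (auto simp: new_entry_def min_step_def min_test_def)

text \<open>\<open>tix\<close> is injective on indices below \<open>n\<close>, so writing row
  \<open>Suc t\<close> leaves row \<open>t\<close> intact and destroys no entry already
  written.\<close>

lemma den_table_step:
  assumes "env s" "guess g s" "table g t s" "fst s vTI = t" "t < L" "fst s vA = g t"
    "fst s vFL \<noteq> 0 \<longleftrightarrow> (\<exists>d<n. E g t d d \<noteq> 0)"
  shows "table g (Suc t) (den table_step s)"
proof -
  let ?put = "Put 1 (tabE (Plus (V vTI) (N 1)) (V vD) (V vV)) (V vNEW)"
  let ?inner = "For vD vN (new_entry ;; ?put)"
  define P where "P v d u \<longleftrightarrow> env u \<and> guess g u \<and> table g t u \<and> fst u vTI = t \<and> fst u vA = g t \<and>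
    (fst u vFL \<noteq> 0 \<longleftrightarrow> (\<exists>d<n. E g t d d \<noteq> 0)) \<and>
    (\<forall>d'<n. \<forall>v'<n. v' < v \<or> v' = v \<and> d' < d \<longrightarrow>
      snd u (cell base 1 (tix (Suc t) d' v')) = E g (Suc t) d' v')" for v d u
  have entry: "P v (Suc d) (den (new_entry ;; ?put) (setv vD d u)) \<and>
      fst (den (new_entry ;; ?put) (setv vD d u)) vV = v \<and>
      (fst (den (new_entry ;; ?put) (setv vD d u)) vVIOL = 0 \<longleftrightarrow> sep g t v)"
    if P: "P v d u" and d: "d < n" and v: "fst u vV = v" "v < n" "fst u vVIOL = 0 \<longleftrightarrow> sep g t v" for v d u
  proof -
    let ?u = "setv vD d u" and ?c = "new_entry ;; ?put"
    let ?w = "den new_entry ?u"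
    have u: "env ?u" "guess g ?u" "table g t ?u" "fst ?u vTI = t" "fst ?u vA = g t"
      "fst ?u vFL \<noteq> 0 \<longleftrightarrow> (\<exists>d<n. E g t d d \<noteq> 0)" "fst ?u vV = v" "fst ?u vD = d"
      "fst ?u vVIOL = 0 \<longleftrightarrow> sep g t v"
      using P v by (auto simp: P_def env_setv env_vars_def)
    have w: "env ?w" "guess g ?w" "table g t ?w"
      using env_den[OF u(1), of new_entry] guess_den[OF u(1,2), of new_entry]
        table_den[OF u(1,3), of new_entry] by (simp_all add: env_vars_def)
    have wv: "fst ?w vTI = t" "fst ?w vV = v" "fst ?w vD = d" "fst ?w vA = g t"
      "fst ?w vFL = fst ?u vFL" "fst ?w vVIOL = fst ?u vVIOL"
      using u(4,5,7,8) by (simp_all add: den_wr)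
    have new: "fst ?w vNEW = E g (Suc t) d v"
      using u by (intro den_new_entry) (use v d in auto)
    have keep: "snd ?w (cell base 1 i) = snd u (cell base 1 i)" for i
      using den_cell[OF u(1), of new_entry 1 i] by simp
    have put: "den ?c ?u = (fst ?w, (snd ?w)(cell base 1 (tix (Suc t) d v) := E g (Suc t) d v))"
      using wv new env_simps(1)[OF w(1)] by (simp add: ev_tabE[OF w(1)])
    have "env (den ?c ?u)"
      using u(1) by (rule env_den) (auto simp: env_vars_def)
    moreover have "guess g (den ?c ?u)"
      using u(1,2) by (rule guess_den) auto
    moreover have "table g t (den ?c ?u)"
      using w(3) d v(2) unfolding put table_def by (simp add: tix_inj)
    moreover have "\<forall>d'<n. \<forall>v'<n. v' < v \<or> v' = v \<and> d' < Suc d \<longrightarrow>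
      snd (den ?c ?u) (cell base 1 (tix (Suc t) d' v')) = E g (Suc t) d' v'"
    proof (intro allI impI)
      fix d' v' assume b: "d' < n" "v' < n" and lt: "v' < v \<or> v' = v \<and> d' < Suc d"
      show "snd (den ?c ?u) (cell base 1 (tix (Suc t) d' v')) = E g (Suc t) d' v'"
      proof (cases "d' = d \<and> v' = v")
        case True
        then show ?thesis
          unfolding put by simp
      next
        case False
        then have "snd (den ?c ?u) (cell base 1 (tix (Suc t) d' v')) =
            snd u (cell base 1 (tix (Suc t) d' v'))"
          unfolding put keep[symmetric] using b d v(2) by (auto simp: tix_inj)
        moreover have "v' < v \<or> v' = v \<and> d' < d"
          using lt False by auto
        ultimately show ?thesis
          using P b unfolding P_def by metis
      qed
    qed
    ultimately show ?thesis
      using u(4-9) wv unfolding P_def put by simp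
  qed
  have row: "P v n (den ?inner u)"
    if P: "P v 0 u" and v: "fst u vV = v" "v < n" "fst u vVIOL = 0 \<longleftrightarrow> sep g t v" for v u
  proof -
    have N: "fst u vN = n"
      using P env_simps(3) by (auto simp: P_def)
    have "P v (fst u vN) (den ?inner u) \<and> fst (den ?inner u) vV = v \<and>
        (fst (den ?inner u) vVIOL = 0 \<longleftrightarrow> sep g t v)"
      by (rule den_For_induct[where Q = "\<lambda>d u. P v d u \<and> fst u vV = v \<and> (fst u vVIOL = 0 \<longleftrightarrow> sep g t v)"])
        (use entry P v N in auto)
    then show ?thesis
      using N by simp
  qed
  have N: "fst s vN = n"
    using env_simps(3)[OF assms(1)] .
  have "P (fst s vN) 0 (den table_step s)"
    unfolding table_step_def
  proof (rule den_For_induct[where Q = "\<lambda>v. P v 0"])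
    show "P 0 0 s"
      using assms by (simp add: P_def)
    fix v u assume v: "v < fst s vN" and P: "P v 0 u"
    let ?u = "setv vV v u"
    let ?w = "den violations ?u"
    have u: "env ?u" "guess g ?u" "table g t ?u" "fst ?u vTI = t"
      using P by (auto simp: P_def env_setv env_vars_def)
    have "fst ?w vVIOL = 0 \<longleftrightarrow> sep g t v"
      using v N assms(5) u by (intro den_violations) auto
    moreover have "P v 0 ?w"
      using P env_den[OF u(1), of violations] guess_den[OF u(1,2), of violations]
        table_den[OF u(1,3), of violations] den_cell[OF u(1), of violations 1]
      unfolding P_def by (simp add: den_wr env_vars_def)
    moreover have "fst ?w vV = v"
      by (simp add: den_wr)
    ultimately have "P v n (den ?inner ?w)"
      using v N by (intro row) auto
    then have "P (Suc v) 0 (den ?inner ?w)"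
      unfolding P_def by (auto simp: less_Suc_eq simp del: E.simps)
    then show "P (Suc v) 0 (den (violations ;; ?inner) ?u)"
      by simp
  qed
  then show ?thesis
    using N unfolding P_def table_def by (simp del: E.simps)
qed

lemma wr_table_step [simp]:
  "wr table_step = {vV, vVIOL, vS, vX, vD, vNEW, vOLD, vU}" "awr table_step = {1}"
  by (auto simp: table_step_def)

lemma wr_counts_step [simp]:
  "wr counts_step = {vA, vW, vGC, vOPEN, vOK, vNC, vNS, vNF}" "awr counts_step = {}"
  by (auto simp: counts_step_def)

end

text \<open>
  The guesses are enumerated as the digit sequences of the numbers below \<open>Q ^ (L + L * L)\<close>.
\<close>

lemma digits_exist:
  fixes Q :: nat
  assumes "\<And>i. g i < Q" "\<And>i. l \<le> i \<Longrightarrow> g i = 0"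
  shows "\<exists>m<Q ^ l. \<forall>i. m div Q ^ i mod Q = g i"
  using assms
proof (induction l arbitrary: g)
  case 0
  then show ?case
    by auto
next
  case (Suc l)
  obtain m where m: "m < Q ^ l" "\<And>i. m div Q ^ i mod Q = g (Suc i)"
    using Suc.IH[of "\<lambda>i. g (Suc i)"] Suc.prems by auto
  have Q: "0 < Q" "g 0 < Q"
    using Suc.prems(1)[of 0] by auto
  let ?m = "g 0 + Q * m"
  have "?m < Q + Q * m"
    using Q by simp
  also have "\<dots> = Q * Suc m"
    by simp
  also have "\<dots> \<le> Q * Q ^ l"
    using m(1) by (intro mult_le_mono2) simp
  finally have "?m < Q ^ Suc l"
    by simp
  moreover have "?m div Q ^ i mod Q = g i" for i
  proof (cases i)
    case 0
    then show ?thesis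
      using Q by simp
  next
    case (Suc j)
    have "?m div Q = m"
      using Q by simp
    then have "?m div Q ^ i = m div Q ^ j"
      by (simp add: Suc div_mult2_eq)
    then show ?thesis
      using m(2)[of j] Suc by simp
  qed
  ultimately show ?case
    by blast
qed

context inst
begin

lemma wr_simps [simp]:
  "wr decode = {vX, vI, vQUO, vJ}" "awr decode = {0}"
  "wr init_table = {vD, vV}" "awr init_table = {1}"
  "wr init_counts = {vW, vGC, vOPEN, vOK, vNC, vNS, vNF}" "awr init_counts = {}"
  "wr any_entry = {vANY, vD, vV}" "awr any_entry = {}"
  "wr verdict = {0}" "awr verdict = {}"
  by (auto simp: decode_def init_table_def init_counts_def any_entry_def verdict_def)

lemma den_any_entry:
  assumes "env s" "table g L s"
  shows "fst (den any_entry s) vANY \<noteq> 0 \<longleftrightarrow> (\<exists>d<n. \<exists>v<n. E g L d v \<noteq> 0)"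
proof -
  let ?body = "Assign vANY (Plus (V vANY) (Arr 1 (tabE (V vL) (V vD) (V vV))))"
  let ?s = "setv vANY 0 s"
  define P where "P d v u \<longleftrightarrow> env u \<and> table g L u \<and>
    (fst u vANY \<noteq> 0 \<longleftrightarrow> (\<exists>d'<d. \<exists>v<n. E g L d' v \<noteq> 0) \<or> (\<exists>v'<v. E g L d v' \<noteq> 0))" for d v u
  have row: "P d n (den (For vV vN ?body) u)" if P: "P d 0 u" and d: "fst u vD = d" "d < n" for d u
  proof -
    have N: "fst u vN = n"
      using P env_simps(3) by (auto simp: P_def)
    have "P d (fst u vN) (den (For vV vN ?body) u) \<and> fst (den (For vV vN ?body) u) vD = d"
    proof (rule den_For_induct[where Q = "\<lambda>v w. P d v w \<and> fst w vD = d"])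
      show "P d 0 u \<and> fst u vD = d"
        using that by simp
      fix v w assume v: "v < fst u vN" and w: "P d v w \<and> fst w vD = d"
      let ?w = "setv vV v w"
      have e: "env ?w" "table g L ?w"
        using w by (auto simp: P_def env_setv env_vars_def)
      have "snd ?w (cell base 1 (tix L d v)) = E g L d v"
        using tabD[OF e(2) d(2)] v N by simp
      then have b: "den ?body ?w = setv vANY (fst w vANY + E g L d v) ?w"
        using w env_simps(1,7)[OF e(1)] by (simp add: ev_tabE[OF e(1)])
      have "env (setv vANY (fst w vANY + E g L d v) ?w)"
        using e(1) by (rule env_setv) (simp add: env_vars_def)
      then show "P d (Suc v) (den ?body ?w) \<and> fst (den ?body ?w) vD = d"
        using w e unfolding b P_def by (auto simp: less_Suc_eq)
    qed
    then show ?thesis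
      using N by simp
  qed
  have N: "fst ?s vN = n"
    using env_simps(3)[OF assms(1)] by simp
  have "P (fst ?s vN) 0 (den (For vD vN (For vV vN ?body)) ?s)"
  proof (rule den_For_induct[where Q = "\<lambda>d. P d 0"])
    show "P 0 0 ?s"
      using assms by (simp add: P_def env_setv env_vars_def)
    fix d u assume "d < fst ?s vN" "P d 0 u"
    then have "P d 0 (setv vD d u)" "d < n"
      using N by (auto simp: P_def env_setv env_vars_def)
    then have "P d n (den (For vV vN ?body) (setv vD d u))"
      by (intro row) auto
    then show "P (Suc d) 0 (den (For vV vN ?body) (setv vD d u))"
      by (auto simp: P_def less_Suc_eq)
  qed
  then show ?thesis
    using N unfolding any_entry_def by (simp add: P_def)
qed

lemma den_verdict:
  assumes "env s" "counts g L s" "fst s vANY \<noteq> 0 \<longleftrightarrow> (\<exists>d<n. \<exists>v<n. E g L d v \<noteq> 0)"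
  shows "fst (den verdict s) 0 = (if accept g then 1 else fst s 0)"
proof -
  let ?c = "AndE (V vOK) (AndE (LeE (V vW) (V vR)) (AndE (V vANY) (AndE (NotE (V vOPEN))
       (AndE (EqE (V vNF) (V vCT))
       (AndE (LeE (Plus (V vCC) (V vNC)) (Plus (V vK) (V vNS))) (NotE (V vBAD)))))))"
  have "ev ?c s \<noteq> 0 \<longleftrightarrow> fst s vOK \<noteq> 0 \<and> fst s vW \<le> fst s vR \<and> fst s vANY \<noteq> 0 \<and>
      fst s vOPEN = 0 \<and> fst s vNF = fst s vCT \<and> fst s vCC + fst s vNC \<le> fst s vK + fst s vNS \<and>
      fst s vBAD = 0"
    by (simp add: conj_ac)
  also have "\<dots> \<longleftrightarrow> accept g"
    using assms(2) unfolding assms(3) env_simps[OF assms(1)] counts_def accept_def by (elim conjE) simp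
  finally show ?thesis
    by (simp add: verdict_def del: ev_bool)
qed

text \<open>Contents of the arrays left by an earlier guess do no harm: the guess and each row of
  the table are written completely before they are read.\<close>

lemma den_try_guess:
  assumes "env s" "fst s vIT < Q ^ (L + L * L)"
  shows "env (den try_guess s)"
    "fst (den try_guess s) 0 =
      (if accept (\<lambda>i. fst s vIT div Q ^ i mod Q) then 1 else fst s 0)"
proof -
  define g where "g i = fst s vIT div Q ^ i mod Q" for i
  let ?step = "counts_step ;; closable ;; table_step"
  define s1 where "s1 = den decode s"
  define s2 where "s2 = den init_table s1"
  define s3 where "s3 = den init_counts s2"
  define s4 where "s4 = den (For vTI vL ?step) s3"
  define s5 where "s5 = den any_entry s4"
  have s1: "env s1" "guess g s1" "fst s1 0 = fst s 0"
    using den_decode[OF assms] env_den[OF assms(1), of decode]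
    unfolding s1_def g_def[symmetric] by (simp_all add: env_vars_def den_wr)
  have s2: "env s2" "guess g s2" "table g 0 s2" "fst s2 0 = fst s 0"
    using env_den[OF s1(1), of init_table] guess_den[OF s1(1,2), of init_table]
      den_init_table[OF s1(1)] s1(3)
    unfolding s2_def by (simp_all add: env_vars_def den_wr)
  have s3: "env s3" "guess g s3" "table g 0 s3" "counts g 0 s3" "fst s3 0 = fst s 0"
    using env_den[OF s2(1), of init_counts] guess_den[OF s2(1,2), of init_counts]
      table_den[OF s2(1,3), of init_counts] den_init_counts s2(4)
    unfolding s3_def by (simp_all add: env_vars_def den_wr)
  define P where "P t u \<longleftrightarrow> env u \<and> guess g u \<and> table g t u \<and> counts g t u \<and> fst u 0 = fst s 0" for t u
  have L: "fst s3 vL = L"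
    using env_simps(7)[OF s3(1)] .
  have "P (fst s3 vL) s4"
    unfolding s4_def
  proof (rule den_For_induct[where Q = P])
    show "P 0 s3"
      using s3 by (simp add: P_def)
    fix t u assume t: "t < fst s3 vL" and P: "P t u"
    let ?u = "setv vTI t u"
    define u1 where "u1 = den counts_step ?u"
    define u2 where "u2 = den closable u1"
    define u3 where "u3 = den table_step u2"
    have tL: "t < L"
      using t L by simp
    have u: "env ?u" "guess g ?u" "table g t ?u" "counts g t ?u" "fst ?u vTI = t" "fst ?u 0 = fst s 0"
      using P by (auto simp: P_def counts_def env_setv env_vars_def)
    have u1: "env u1" "guess g u1" "table g t u1" "counts g (Suc t) u1" "fst u1 vTI = t"
      "fst u1 vA = g t" "fst u1 0 = fst s 0"
      using env_den[OF u(1), of counts_step] guess_den[OF u(1,2), of counts_step]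
        table_den[OF u(1,3), of counts_step] den_counts_step[OF u(1,2,5) tL u(4)] u(5,6)
      unfolding u1_def by (simp_all add: env_vars_def den_wr)
    have c2: "counts g (Suc t) u2"
      using u1(4) unfolding u2_def counts_def by (simp add: den_wr)
    have u2: "env u2" "guess g u2" "table g t u2" "fst u2 vTI = t" "fst u2 vA = g t"
      "fst u2 0 = fst s 0" "fst u2 vFL \<noteq> 0 \<longleftrightarrow> (\<exists>d<n. E g t d d \<noteq> 0)"
      using env_den[OF u1(1), of closable] guess_den[OF u1(1,2), of closable]
        table_den[OF u1(1,3), of closable] u1(5-7) den_closable[OF u1(1,3,5)]
      unfolding u2_def by (simp_all add: env_vars_def den_wr)
    have "counts g (Suc t) u3"
      using c2 unfolding u3_def counts_def by (simp add: den_wr)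
    moreover have "env u3" "guess g u3" "fst u3 0 = fst s 0"
      using env_den[OF u2(1), of table_step] guess_den[OF u2(1,2), of table_step] u2(6)
      unfolding u3_def by (simp_all add: env_vars_def den_wr)
    moreover have "table g (Suc t) u3"
      unfolding u3_def by (rule den_table_step[OF u2(1-4) tL u2(5,7)])
    ultimately show "P (Suc t) (den ?step ?u)"
      unfolding P_def u1_def u2_def u3_def by simp
  qed
  then have s4: "env s4" "table g L s4" "counts g L s4" "fst s4 0 = fst s 0"
    using L by (auto simp: P_def)
  have s5: "env s5" "counts g L s5" "fst s5 0 = fst s 0"
    "fst s5 vANY \<noteq> 0 \<longleftrightarrow> (\<exists>d<n. \<exists>v<n. E g L d v \<noteq> 0)"
    using env_den[OF s4(1), of any_entry] s4(3,4) den_any_entry[OF s4(1,2)]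
    unfolding s5_def counts_def by (simp_all add: env_vars_def den_wr)
  have eq: "den try_guess s = den verdict s5"
    by (simp add: try_guess_def s1_def s2_def s3_def s4_def s5_def)
  show "env (den try_guess s)"
    unfolding eq using s5(1) by (rule env_den) (simp_all add: env_vars_def)
  show "fst (den try_guess s) 0 =
      (if accept (\<lambda>i. fst s vIT div Q ^ i mod Q) then 1 else fst s 0)"
    unfolding eq using den_verdict[OF s5(1,2,4)] s5(3) unfolding g_def by simp
qed

lemma den_search:
  assumes "env s"
  shows "fst (den search s) 0 = (if \<exists>ps A. iroute ps A then 1 else 0)"
proof -
  let ?g = "\<lambda>m i. m div Q ^ i mod Q"
  let ?s = "setv 0 0 s"
  define P where "P m u \<longleftrightarrow> env u \<and> fst u 0 = (if \<exists>m'<m. accept (?g m') then 1 else 0)" for m u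
  have T: "fst ?s vTOT = Q ^ (L + L * L)"
    using env_simps(10)[OF assms] by simp
  have "P (fst ?s vTOT) (den (For vIT vTOT try_guess) ?s)"
  proof (rule den_For_induct[where Q = P])
    show "P 0 ?s"
      using assms by (simp add: P_def env_setv env_vars_def)
    fix m u assume "m < fst ?s vTOT" "P m u"
    then have m: "m < Q ^ (L + L * L)" and u: "env (setv vIT m u)"
      "fst u 0 = (if \<exists>m'<m. accept (?g m') then 1 else 0)"
      using T by (auto simp: P_def env_setv env_vars_def)
    have "fst (den try_guess (setv vIT m u)) 0 = (if accept (?g m) then 1 else fst u 0)"
      using den_try_guess(2)[OF u(1)] m by simp
    then show "P (Suc m) (den try_guess (setv vIT m u))"
      using den_try_guess(1)[OF u(1)] m u(2) by (auto simp: P_def less_Suc_eq)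
  qed
  then have "fst (den search s) 0 = (if \<exists>m<Q ^ (L + L * L). accept (?g m) then 1 else 0)"
    unfolding search_def T by (simp add: P_def)
  \<comment> \<open>Soundness holds for every function, so it applies to all numbers tried;
    completeness supplies a guess with digits below \<open>Q\<close> that vanish from
    \<open>L + L * L\<close> on, which is the digit sequence of one of them.\<close>
  moreover have "(\<exists>m<Q ^ (L + L * L). accept (?g m)) \<longleftrightarrow> (\<exists>ps A. iroute ps A)"
  proof
    assume "\<exists>ps A. iroute ps A"
    then obtain g where g: "\<And>i. g i < Q" "\<And>i. L + L * L \<le> i \<Longrightarrow> g i = 0" "accept g"
      using accept_complete by blast
    then obtain m where "m < Q ^ (L + L * L)" "?g m = g"
      using digits_exist[of g Q "L + L * L"] by blast
    then show "\<exists>m<Q ^ (L + L * L). accept (?g m)"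
      using g(3) by auto
  qed (use accept_sound in blast)
  ultimately show ?thesis
    by simp
qed

end

section \<open>Vertices as indices\<close>

lemma concat_map_nth:
  "i < length xs \<Longrightarrow> j < length ys \<Longrightarrow>
   concat (map (\<lambda>u. map (f u) ys) xs) ! (i * length ys + j) = f (xs ! i) (ys ! j)"
proof (induction xs arbitrary: i)
  case (Cons x xs)
  then show ?case
    by (cases i) (simp_all add: nth_append)
qed simp

lemma length_encode: "length (encode vs I r) = 6 + length vs + length vs + length vs * length vs"
  by (simp add: encode_def length_concat comp_def sum_list_triv split: option.split)

lemma encode_nth:
  fixes vs :: "'v list"
  defines "n \<equiv> length vs"
  shows "encode vs I r ! 0 = r" "encode vs I r ! 1 = n" "encode vs I r ! 2 = vehicles I"
    "encode vs I r ! 3 = capacity I"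
    "encode vs I r ! 4 = (if gas I = None then 0 else 1)"
    "gas I = Some g \<Longrightarrow> encode vs I r ! 5 = g"
    "i < n \<Longrightarrow> encode vs I r ! (6 + i) = of_bool (vs ! i \<in> depots I)"
    "i < n \<Longrightarrow> encode vs I r ! (6 + n + i) = (if vs ! i \<in> clients I then demand I (vs ! i) else 0)"
    "i < n \<Longrightarrow> j < n \<Longrightarrow> encode vs I r ! (6 + n + n + (i * n + j)) =
       (if {vs ! i, vs ! j} \<in> edges I then weight I {vs ! i, vs ! j} + 1 else 0)"
proof -
  define a where "a = [r, length vs, vehicles I, capacity I] @
     (case gas I of None \<Rightarrow> [0, 0] | Some g \<Rightarrow> [1, g])"
  define b :: "nat list" where "b = map (\<lambda>v. if v \<in> depots I then 1 else 0) vs"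
  define c where "c = map (\<lambda>v. if v \<in> clients I then demand I v else 0) vs"
  define d where "d = concat (map (\<lambda>u. map (\<lambda>v. if {u, v} \<in> edges I then weight I {u, v} + 1 else 0) vs) vs)"
  have e: "encode vs I r = a @ b @ c @ d"
    by (simp add: encode_def a_def b_def c_def d_def)
  have len: "length a = 6" "length b = n" "length c = n"
    by (simp_all add: a_def b_def c_def n_def split: option.split)
  show "encode vs I r ! 0 = r" "encode vs I r ! 1 = n" "encode vs I r ! 2 = vehicles I"
    "encode vs I r ! 3 = capacity I" "encode vs I r ! 4 = (if gas I = None then 0 else 1)"
    "gas I = Some g \<Longrightarrow> encode vs I r ! 5 = g"
    by (auto simp: encode_def n_def numeral_eq_Suc split: option.split)
  show "encode vs I r ! (6 + i) = of_bool (vs ! i \<in> depots I)" if "i < n"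
    using that len unfolding e by (simp add: nth_append b_def n_def)
  show "encode vs I r ! (6 + n + i) = (if vs ! i \<in> clients I then demand I (vs ! i) else 0)" if "i < n"
    using that len unfolding e by (simp add: nth_append c_def n_def)
  show "encode vs I r ! (6 + n + n + (i * n + j)) =
       (if {vs ! i, vs ! j} \<in> edges I then weight I {vs ! i, vs ! j} + 1 else 0)" if "i < n" "j < n"
  proof -
    have "encode vs I r ! (6 + n + n + (i * n + j)) = d ! (i * n + j)"
      unfolding e using len by (simp add: nth_append)
    also have "\<dots> = (if {vs ! i, vs ! j} \<in> edges I then weight I {vs ! i, vs ! j} + 1 else 0)"
      unfolding d_def n_def using that by (subst concat_map_nth) (simp_all add: n_def)
    finally show ?thesis .
  qed
qed

definition idep :: "'v list \<Rightarrow> 'v cvrp \<Rightarrow> nat \<Rightarrow> bool" where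
  "idep vs I i \<longleftrightarrow> vs ! i \<in> depots I"
definition idem :: "'v list \<Rightarrow> 'v cvrp \<Rightarrow> nat \<Rightarrow> nat" where
  "idem vs I i = (if vs ! i \<in> clients I then demand I (vs ! i) else 0)"
definition iadj :: "'v list \<Rightarrow> 'v cvrp \<Rightarrow> nat \<Rightarrow> nat \<Rightarrow> nat" where
  "iadj vs I i j = (if {vs ! i, vs ! j} \<in> edges I then weight I {vs ! i, vs ! j} + 1 else 0)"
text \<open>
  Without a gas capacity, \<open>r\<close> is a limit on each walk that changes nothing.
\<close>

definition igas :: "'v cvrp \<Rightarrow> nat \<Rightarrow> nat" where
  "igas I r = (case gas I of None \<Rightarrow> r | Some g \<Rightarrow> g)"

lemma walk_indices:
  assumes "inst (length vs) r (idep vs I) (iadj vs I) phi Q" "set vs = verts I" "set p \<subseteq> {..<length vs}"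
  shows "walk I (map ((!) vs) p) \<longleftrightarrow> inst.iwalk (length vs) (iadj vs I) p"
    "inst.iwalk (length vs) (iadj vs I) p \<Longrightarrow>
      walk_weight I (map ((!) vs) p) = inst.iweight (iadj vs I) p"
proof -
  interpret inst "length vs" "vehicles I" "capacity I" "igas I r" r "idep vs I" "idem vs I" "iadj vs I" phi Q
    by fact
  have "set (map ((!) vs) p) \<subseteq> verts I"
    using assms(3) unfolding assms(2)[symmetric] by auto
  then show "walk I (map ((!) vs) p) \<longleftrightarrow> iwalk p"
    using assms(3) by (simp add: walk_def iwalk_def successively_map iadj_def)
  assume w: "iwalk p"
  show "walk_weight I (map ((!) vs) p) = iweight p"
    unfolding walk_weight_def iweight_def
  proof (rule sum.cong)
    fix i assume i: "i \<in> {..<length p - 1}"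
    then have "iadj vs I (p ! i) (p ! Suc i) \<noteq> 0"
      using w by (auto simp: iwalk_def successively_conv_nth)
    then show "weight I {map ((!) vs) p ! i, map ((!) vs) p ! Suc i} = iadj vs I (p ! i) (p ! Suc i) - 1"
      using i by (auto simp: iadj_def split: if_splits)
  qed simp
qed

text \<open>As \<open>vs\<close> is distinct, reading positions as vertices is injective on the
  range of the walks, so closedness, membership and sums of demands agree on both sides.\<close>

lemma routing_indices:
  assumes I: "inst (length vs) r (idep vs I) (iadj vs I) phi Q" "wf_cvrp I" "set vs = verts I" "distinct vs"
    and ps: "\<forall>p\<in>set ps. set p \<subseteq> {..<length vs}" and A: "\<forall>i<length vs. A' i = A (vs ! i)"
  shows "inst.iroute (length vs) (vehicles I) (capacity I) (igas I r) r (idep vs I) (idem vs I) (iadj vs I) ps A' \<longleftrightarrow>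
    routing I (map (map ((!) vs)) ps) A \<and> routing_weight I (map (map ((!) vs)) ps) \<le> r"
proof -
  interpret inst "length vs" "vehicles I" "capacity I" "igas I r" r "idep vs I" "idem vs I" "iadj vs I" phi Q
    by fact
  let ?f = "map ((!) vs)"
  have clients: "clients I \<subseteq> set vs" "\<forall>c\<in>clients I. 0 < demand I c"
    using I(2) I(3) by (auto simp: wf_cvrp_def)
  have C2: "idem vs I i = demand I (vs ! i) \<and> i < length vs \<and> vs ! i \<in> clients I" if "i \<in> C" for i
    using that by (auto simp: C_def idem_def split: if_splits)
  have C1: "(!) vs ` C = clients I"
  proof (intro equalityI subsetI)
    fix c assume c: "c \<in> clients I"
    then obtain i where "i < length vs" "vs ! i = c"
      using clients(1) by (metis in_set_conv_nth subsetD)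
    moreover from this have "i \<in> C"
      using c clients(2) by (simp add: C_def idem_def)
    ultimately show "c \<in> (!) vs ` C"
      by blast
  qed (use C2 in blast)
  have inj: "inj_on ((!) vs) {..<length vs}"
    using I(4) by (auto simp: inj_on_def nth_eq_iff_index_eq)
  have closed: "iclosed p \<longleftrightarrow> closed_walk I (?f p) \<and> hd (?f p) \<in> depots I" if "p \<in> set ps" for p
  proof (cases "p = []")
    case False
    have "hd p < length vs" "last p < length vs"
      using ps that False by (auto simp: subset_iff)
    then show ?thesis
      using walk_indices(1)[OF I(1,3), of p] ps that False inj
      by (auto simp: iclosed_def closed_walk_def hd_map last_map idep_def nth_eq_iff_index_eq[OF I(4)])
  qed (auto simp: iclosed_def iwalk_def closed_walk_def walk_def)
  have weight: "walk_weight I (?f p) = iweight p" if "p \<in> set ps" "iclosed p" for p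
    using walk_indices(2)[OF I(1,3), of p] ps that by (auto simp: iclosed_def)
  have mem: "c \<in> set (ps ! A' c) \<longleftrightarrow> vs ! c \<in> set (map ?f ps ! A' c)"
    if "A' c < length ps" "c < length vs" for c
  proof -
    have "set (ps ! A' c) \<subseteq> {..<length vs}"
      using ps that(1) by auto
    then show ?thesis
      using that inj by (auto simp: inj_on_def)
  qed
  have loads: "(\<Sum>c\<in>{c \<in> C. A' c = i}. idem vs I c) = (\<Sum>c\<in>{c \<in> clients I. A c = i}. demand I c)" for i
  proof -
    have AA: "A' c = A (vs ! c)" if "c \<in> C" for c
      using A C2[OF that] by blast
    have "{c \<in> clients I. A c = i} = (!) vs ` {c \<in> C. A' c = i}"
    proof (intro equalityI subsetI)
      fix c assume "c \<in> {c \<in> clients I. A c = i}"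
      then obtain j where "j \<in> C" "c = vs ! j" "A c = i"
        unfolding C1[symmetric] by blast
      then show "c \<in> (!) vs ` {c \<in> C. A' c = i}"
        using AA[of j] by blast
    next
      fix c assume "c \<in> (!) vs ` {c \<in> C. A' c = i}"
      then obtain j where "j \<in> C" "c = vs ! j" "A' j = i"
        by blast
      then show "c \<in> {c \<in> clients I. A c = i}"
        using AA[of j] C2[of j] by simp
    qed
    moreover have "inj_on ((!) vs) {c \<in> C. A' c = i}"
      by (rule inj_on_subset[OF inj]) (use C2 in auto)
    note sum.reindex[OF this, of "demand I"]
    moreover have "(\<Sum>c\<in>{c \<in> C. A' c = i}. idem vs I c) = (\<Sum>c\<in>{c \<in> C. A' c = i}. demand I (vs ! c))"
      by (rule sum.cong) (use C2 in auto)
    ultimately show ?thesis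
      by (simp only: comp_def)
  qed
  have sum: "routing_weight I (map ?f ps) = (\<Sum>p\<leftarrow>ps. iweight p)" if "\<forall>p\<in>set ps. iclosed p"
    unfolding routing_weight_def using that weight by (simp add: comp_def cong: map_cong)
  have gas: "(\<forall>p\<in>set ps. iweight p \<le> igas I r) \<longleftrightarrow> (\<forall>g. gas I = Some g \<longrightarrow> (\<forall>p\<in>set ps. iweight p \<le> g))"
    if "(\<Sum>p\<leftarrow>ps. iweight p) \<le> r"
  proof -
    have "iweight p \<le> r" if "p \<in> set ps" for p
      using member_le_sum_list[of "iweight p" "map iweight ps"] that \<open>_ \<le> r\<close> by simp
    then show ?thesis
      by (auto simp: igas_def split: option.split)
  qed
  have cl: "(\<forall>c\<in>C. A' c < length ps \<and> c \<in> set (ps ! A' c)) \<longleftrightarrow>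
      (\<forall>c\<in>clients I. A c < length (map ?f ps) \<and> c \<in> set (map ?f ps ! A c))"
  proof -
    have "A' c < length ps \<and> c \<in> set (ps ! A' c) \<longleftrightarrow>
        A (vs ! c) < length (map ?f ps) \<and> vs ! c \<in> set (map ?f ps ! A (vs ! c))" if "c \<in> C" for c
      using mem[of c] C2[OF that] A by auto
    then show ?thesis
      unfolding C1[symmetric] ball_simps by blast
  qed
  have all_closed: "(\<forall>p\<in>set ps. iclosed p) \<longleftrightarrow>
      (\<forall>p\<in>set (map ?f ps). closed_walk I p \<and> hd p \<in> depots I)"
    using closed by auto
  have gas_weight: "(\<forall>p\<in>set (map ?f ps). walk_weight I p \<le> g) \<longleftrightarrow> (\<forall>p\<in>set ps. iweight p \<le> g)"
    if "\<forall>p\<in>set ps. iclosed p" for g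
    using weight that by simp
  show ?thesis
  proof (cases "\<forall>p\<in>set ps. iclosed p")
    case True
    then have "iroute ps A' \<longleftrightarrow> length ps \<le> vehicles I \<and>
        (\<forall>c\<in>C. A' c < length ps \<and> c \<in> set (ps ! A' c)) \<and>
        (\<forall>i<length ps. (\<Sum>c\<in>{c \<in> C. A' c = i}. idem vs I c) \<le> capacity I) \<and>
        (\<forall>p\<in>set ps. iweight p \<le> igas I r) \<and> (\<Sum>p\<leftarrow>ps. iweight p) \<le> r"
      unfolding iroute_def by blast
    then show ?thesis
      unfolding routing_def all_closed[symmetric] gas_weight[OF True] cl loads sum[OF True] length_map
      using True gas by blast
  next
    case False
    then show ?thesis
      unfolding iroute_def routing_def all_closed[symmetric] by blast
  qed
qed

text \<open>Walks of a routing stay inside \<open>verts I\<close>, so they can be translated back to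
  positions; in the other direction the range is part of \<open>iwalk\<close>.\<close>

lemma routing_iff_iroute:
  assumes I: "inst (length vs) r (idep vs I) (iadj vs I) phi Q" "wf_cvrp I" "set vs = verts I" "distinct vs"
  shows "(\<exists>ps A. routing I ps A \<and> routing_weight I ps \<le> r) \<longleftrightarrow>
    (\<exists>ps A. inst.iroute (length vs) (vehicles I) (capacity I) (igas I r) r (idep vs I) (idem vs I) (iadj vs I) ps A)"
proof -
  interpret inst "length vs" "vehicles I" "capacity I" "igas I r" r "idep vs I" "idem vs I" "iadj vs I" phi Q
    by fact
  define ix where "ix = the_inv_into {..<length vs} ((!) vs)"
  have inj: "inj_on ((!) vs) {..<length vs}"
    using I(4) by (auto simp: inj_on_def nth_eq_iff_index_eq)
  have img: "(!) vs ` {..<length vs} = verts I"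
    unfolding I(3)[symmetric] set_conv_nth by blast
  have ix: "ix (vs ! i) = i" if "i < length vs" for i
    unfolding ix_def by (rule the_inv_into_f_f[OF inj]) (use that in simp)
  have ix': "ix v < length vs \<and> vs ! ix v = v" if v: "v \<in> verts I" for v
  proof -
    obtain i where "i < length vs" "v = vs ! i"
      using v unfolding img[symmetric] by blast
    then show ?thesis
      using ix[of i] by simp
  qed
  show ?thesis
  proof
    assume "\<exists>ps A. routing I ps A \<and> routing_weight I ps \<le> r"
    then obtain ps A where R: "routing I ps A" "routing_weight I ps \<le> r"
      by blast
    have sub: "set p \<subseteq> verts I" if "p \<in> set ps" for p
      using R(1) that unfolding routing_def closed_walk_def walk_def by blast
    have "map ((!) vs) (map ix p) = p" if "p \<in> set ps" for p
      using sub[OF that] ix' by (simp add: map_idI subset_iff)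
    then have "map (map ((!) vs)) (map (map ix) ps) = ps"
      by (simp add: map_idI)
    moreover have "\<forall>p\<in>set (map (map ix) ps). set p \<subseteq> {..<length vs}"
    proof
      fix p assume "p \<in> set (map (map ix) ps)"
      then obtain q where q: "q \<in> set ps" "p = map ix q"
        by auto
      show "set p \<subseteq> {..<length vs}"
        using sub[OF q(1)] ix' unfolding q(2) by (auto simp: subset_iff)
    qed
    ultimately have "iroute (map (map ix) ps) (\<lambda>i. A (vs ! i))"
      using routing_indices[OF I, of "map (map ix) ps" "\<lambda>i. A (vs ! i)" A] R by metis
    then show "\<exists>ps A. iroute ps A"
      by blast
  next
    assume "\<exists>ps A. iroute ps A"
    then obtain ps A where R: "iroute ps A"
      by blast
    have "\<forall>p\<in>set ps. set p \<subseteq> {..<length vs}"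
      using R unfolding iroute_def iclosed_def iwalk_def by blast
    moreover have "\<forall>i<length vs. A i = A (ix (vs ! i))"
      using ix by simp
    ultimately have "routing I (map (map ((!) vs)) ps) (\<lambda>v. A (ix v)) \<and>
        routing_weight I (map (map ((!) vs)) ps) \<le> r"
      using routing_indices[OF I, of ps A "\<lambda>v. A (ix v)"] R by blast
    then show "\<exists>ps A. routing I ps A \<and> routing_weight I ps \<le> r"
      by blast
  qed
qed

section \<open>Setting up the search\<close>

definition setup1 :: com where
  "setup1 = Assign vR (Mem (N 0)) ;; Assign vN (Mem (N 1)) ;; Assign vK (Mem (N 2)) ;;
     Assign vCAP (Mem (N 3)) ;;
     Cond (Mem (N 4)) (Assign vGB (Mem (N 5))) (Assign vGB (V vR)) ;;
     Assign vL (Plus (Plus (V vR) (V vR)) (Plus (V vR) (V vR)))"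

text \<open>\<open>vP\<close> is doubled until it reaches \<open>n\<close>, and \<open>vBETA\<close>
  counts the doublings: with \<beta> bits the indices can be told apart, and
  \<open>2 ^ \<beta>\<close> is at most \<open>2 * n\<close>. The base \<open>vQ\<close> has to
  exceed the move codes, at most \<open>r + 3\<close>, and the rows of array 2 needed as
  certificates, which are below \<open>2 * \<beta>\<close>; \<open>r + 4 + 2 * \<beta>\<close>
  serves both.\<close>

definition setup2 :: com where
  "setup2 = Assign vBASE (Plus (Plus (Plus (N 6) (V vN)) (V vN)) (Mul (V vN) vN)) ;;
     Assign vLEN (Plus (V vL) (Mul (V vL) vL)) ;;
     Assign vP (N 1) ;; Assign vBETA (N 0) ;;
     For vI vN (Cond (Minus (V vN) (V vP))
       (Assign vP (Plus (V vP) (V vP)) ;; Assign vBETA (Plus (V vBETA) (N 1))) Skip) ;;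
     Assign vQ (Plus (Plus (V vR) (N 4)) (Plus (V vBETA) (V vBETA))) ;;
     Assign vTOT (N 1)"

text \<open>Kept apart from \<open>setup2\<close>, which assigns \<open>vLEN\<close> and
  \<open>vQ\<close>: here they bound a loop and a multiplication, and \<open>cbounded\<close>
  forbids assigning such variables.\<close>

definition setup3 :: com where
  "setup3 = For vI vLEN (Assign vTOT (Mul (V vTOT) vQ))"

text \<open>
  Rows \<open>2 * t\<close> and \<open>2 * t + 1\<close> of array 2 hold bit \<open>t\<close> of the vertex indices and its complement.
\<close>

definition setup4 :: com where
  "setup4 = Assign vP (N 1) ;; Assign vA (N 2) ;;
     For vTI vN
      (For vV vN
        (Assign vX (V vV) ;; divmod vX vP vQUO vJ vN ;;
         Assign vX (V vQUO) ;; divmod vX vA vQUO vJ vN ;;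
         Put 2 (Plus (Mul (Plus (V vTI) (V vTI)) vN) (V vV)) (V vX) ;;
         Put 2 (Plus (Mul (Plus (Plus (V vTI) (V vTI)) (N 1)) vN) (V vV)) (NotE (V vX))) ;;
       Assign vP (Plus (V vP) (V vP)))"

definition setup5 :: com where
  "setup5 = Assign vCC (N 0) ;; Assign vCT (N 0) ;; Assign vBAD (N 0) ;;
     For vV vN
      (Assign vX (demE (V vV)) ;;
       Cond (V vX)
        (Assign vCC (Plus (V vCC) (N 1)) ;;
         Assign vCT (Plus (V vCT) (NotE (depE (V vV)))) ;;
         Assign vBAD (Plus (V vBAD) (Minus (V vX) (V vCAP))))
        Skip)"

definition solver :: com where
  "solver = setup1 ;; setup2 ;; setup3 ;; setup4 ;; setup5 ;; search"

lemma wr_setup [simp]: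
  "wr setup1 = {vR, vN, vK, vCAP, vGB, vL}" "awr setup1 = {}"
  "wr setup2 = {vBASE, vLEN, vP, vBETA, vI, vQ, vTOT}" "awr setup2 = {}"
  "wr setup3 = {vI, vTOT}" "awr setup3 = {}"
  "wr setup4 = {vP, vA, vTI, vV, vX, vQUO, vJ}" "awr setup4 = {2}"
  "wr setup5 = {vCC, vCT, vBAD, vV, vX}" "awr setup5 = {}"
  by (auto simp: setup1_def setup2_def setup3_def setup4_def setup5_def)

lemma snd_den_no_Put: "awr c = {} \<Longrightarrow> snd (den c s) = snd s"
proof (induction c arbitrary: s)
  case (For x z c)
  have "snd (iter (\<lambda>i s. den c (setv x i s)) m s) = snd s" for m
    using For by (induction m) auto
  then show ?case
    by (simp add: den.simps(6))
qed auto

section \<open>Correctness of the setup\<close>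

lemma den_setup1:
  "fst (den setup1 s) vR = snd s 0" "fst (den setup1 s) vN = snd s 1"
  "fst (den setup1 s) vK = snd s 2" "fst (den setup1 s) vCAP = snd s 3"
  "fst (den setup1 s) vGB = (if snd s 4 = 0 then snd s 0 else snd s 5)"
  "fst (den setup1 s) vL = 4 * snd s 0"
  by (simp_all add: setup1_def)

lemma den_setup2:
  assumes "0 < fst s vN"
  defines "t \<equiv> den setup2 s"
  shows "fst t vBASE = 6 + fst s vN + fst s vN + fst s vN * fst s vN"
    "fst t vLEN = fst s vL + fst s vL * fst s vL"
    "fst t vQ = fst s vR + 4 + 2 * fst t vBETA"
    "fst t vTOT = 1" "fst t vBETA \<le> fst s vN"
    "fst s vN \<le> 2 ^ fst t vBETA" "2 ^ fst t vBETA \<le> 2 * fst s vN"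
proof -
  let ?c0 = "Assign vBASE (Plus (Plus (Plus (N 6) (V vN)) (V vN)) (Mul (V vN) vN)) ;;
     Assign vLEN (Plus (V vL) (Mul (V vL) vL)) ;; Assign vP (N 1) ;; Assign vBETA (N 0)"
  let ?body = "Cond (Minus (V vN) (V vP))
       (Assign vP (Plus (V vP) (V vP)) ;; Assign vBETA (Plus (V vBETA) (N 1))) Skip"
  define s1 where "s1 = den ?c0 s"
  define s2 where "s2 = den (For vI vN ?body) s1"
  have s1: "fst s1 vN = fst s vN" "fst s1 vP = 1" "fst s1 vBETA = 0" "fst s1 vR = fst s vR"
    "fst s1 vBASE = 6 + fst s vN + fst s vN + fst s vN * fst s vN"
    "fst s1 vLEN = fst s vL + fst s vL * fst s vL"
    by (simp_all add: s1_def)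
  define P where "P i u \<longleftrightarrow> fst u vN = fst s vN \<and> fst u vP = 2 ^ fst u vBETA \<and> fst u vBETA \<le> i \<and>
    fst u vP \<le> 2 * fst s vN \<and> (fst s vN \<le> fst u vP \<or> fst u vBETA = i)" for i and u :: state
  have "P (fst s1 vN) s2"
    unfolding s2_def
  proof (rule den_For_induct[where Q = P])
    show "P 0 s1"
      using s1 assms(1) by (simp add: P_def)
    fix i u assume "P i u"
    then show "P (Suc i) (den ?body (setv vI i u))"
      by (cases "fst s vN \<le> fst u vP") (auto simp: P_def)
  qed
  then have s2: "fst s2 vP = 2 ^ fst s2 vBETA" "fst s2 vP \<le> 2 * fst s vN" "fst s2 vBETA \<le> fst s vN"
    "fst s vN \<le> fst s2 vP"
    \<comment> \<open>A loop of \<open>n\<close> rounds is long enough, since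
      \<open>n < 2 ^ n\<close>.\<close>
    using s1(1) less_exp[of "fst s vN"] by (auto simp: P_def)
  have t: "t = den (Assign vQ (Plus (Plus (V vR) (N 4)) (Plus (V vBETA) (V vBETA))) ;; Assign vTOT (N 1)) s2"
    by (simp add: t_def setup2_def s2_def s1_def)
  have keep: "fst s2 vR = fst s vR" "fst s2 vBASE = fst s1 vBASE" "fst s2 vLEN = fst s1 vLEN"
    using s1(4) unfolding s2_def by (simp_all add: den_wr)
  show "fst t vBASE = 6 + fst s vN + fst s vN + fst s vN * fst s vN"
    "fst t vLEN = fst s vL + fst s vL * fst s vL"
    "fst t vQ = fst s vR + 4 + 2 * fst t vBETA"
    "fst t vTOT = 1" "fst t vBETA \<le> fst s vN"
    "fst s vN \<le> 2 ^ fst t vBETA" "2 ^ fst t vBETA \<le> 2 * fst s vN"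
    using s1 s2 keep unfolding t by simp_all
qed

lemma den_setup3:
  "fst s vTOT = 1 \<Longrightarrow> fst (den setup3 s) vTOT = fst s vQ ^ fst s vLEN"
proof -
  assume 1: "fst s vTOT = 1"
  let ?body = "Assign vTOT (Mul (V vTOT) vQ)"
  define P where "P i u \<longleftrightarrow> fst u vQ = fst s vQ \<and> fst u vTOT = fst s vQ ^ i" for i and u :: state
  have "P (fst s vLEN) (den setup3 s)"
    unfolding setup3_def
    by (rule den_For_induct[where Q = P]) (use 1 in \<open>auto simp: P_def\<close>)
  then show ?thesis
    by (simp add: P_def)
qed

lemma row_inj:
  fixes n :: nat
  assumes "v < n" "v' < n"
  shows "a * n + v = a' * n + v' \<longleftrightarrow> a = a' \<and> v = v'"
proof -
  have "(q * n + m) div n = q" "(q * n + m) mod n = m" if "m < n" for q m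
    using that by auto
  then show ?thesis
    using assms by metis
qed

text \<open>Bit \<open>t\<close> is found by dividing by \<open>2 ^ t\<close>, held in
  \<open>vP\<close>, and reducing the quotient modulo 2. Rows are filled for all
  \<open>t < n\<close>, which includes the \<beta> bits because \<beta> is at most
  \<open>n\<close>.\<close>

lemma den_setup4:
  assumes n: "fst s vN = n" and b: "fst s vBASE = b" and tv: "t < n" "v < n"
  shows "snd (den setup4 s) (cell b 2 (2 * t * n + v)) = v div 2 ^ t mod 2"
    "snd (den setup4 s) (cell b 2 ((2 * t + 1) * n + v)) = 1 - v div 2 ^ t mod 2"
proof -
  let ?c1 = "Assign vX (V vV) ;; divmod vX vP vQUO vJ vN"
  let ?c2 = "Assign vX (V vQUO) ;; divmod vX vA vQUO vJ vN"
  let ?p1 = "Put 2 (Plus (Mul (Plus (V vTI) (V vTI)) vN) (V vV)) (V vX)"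
  let ?p2 = "Put 2 (Plus (Mul (Plus (Plus (V vTI) (V vTI)) (N 1)) vN) (V vV)) (NotE (V vX))"
  let ?body = "Assign vX (V vV) ;; divmod vX vP vQUO vJ vN ;;
         Assign vX (V vQUO) ;; divmod vX vA vQUO vJ vN ;; ?p1 ;; ?p2"
  let ?step = "For vV vN ?body ;; Assign vP (Plus (V vP) (V vP))"
  define bit where "bit i v = v div 2 ^ i mod 2" for i v :: nat
  define F where "F u i v \<longleftrightarrow> snd u (cell b 2 ((i + i) * n + v)) = bit i v \<and>
     snd u (cell b 2 ((i + i + 1) * n + v)) = 1 - bit i v" for u :: state and i v
  define P where "P i v u \<longleftrightarrow> fst u vN = n \<and> fst u vBASE = b \<and> fst u vA = 2 \<and> fst u vP = 2 ^ i \<and>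
     (\<forall>i'<n. \<forall>v'<n. i' < i \<or> i' = i \<and> v' < v \<longrightarrow> F u i' v')" for i v u
  have entry: "P i (Suc v) (den ?body (setv vV v u)) \<and> fst (den ?body (setv vV v u)) vTI = i"
    if P: "P i v u" and i: "fst u vTI = i" "i < n" and v: "v < n" for i v u
  proof -
    define u0 where "u0 = setv vX v (setv vV v u)"
    define u1 where "u1 = den (divmod vX vP vQUO vJ vN) u0"
    define u2 where "u2 = setv vX (fst u1 vQUO) u1"
    define u3 where "u3 = den (divmod vX vA vQUO vJ vN) u2"
    have u0: "fst u0 vX = v" "fst u0 vV = v" "fst u0 vN = n" "fst u0 vBASE = b" "fst u0 vA = 2"
      "fst u0 vP = 2 ^ i" "fst u0 vTI = i" "snd u0 = snd u"
      using P i by (auto simp: u0_def P_def)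
    have "v div 2 ^ i \<le> n"
      using div_le_dividend[of v "2 ^ i"] v by linarith
    then have u1: "fst u1 vQUO = v div 2 ^ i" "snd u1 = snd u"
      using den_divmod(2,3)[of vX vP vQUO vJ vN u0] u0 unfolding u1_def by simp_all
    have u1': "fst u1 vV = v" "fst u1 vN = n" "fst u1 vBASE = b" "fst u1 vA = 2"
      "fst u1 vP = 2 ^ i" "fst u1 vTI = i"
      using u0 unfolding u1_def by (simp_all add: den_wr)
    have u2: "fst u2 vX = v div 2 ^ i" "fst u2 vV = v" "fst u2 vN = n" "fst u2 vBASE = b" "fst u2 vA = 2"
      "fst u2 vP = 2 ^ i" "fst u2 vTI = i" "snd u2 = snd u"
      using u1 u1' by (simp_all add: u2_def)
    have "v div 2 ^ i div 2 \<le> n"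
      using \<open>v div 2 ^ i \<le> n\<close> by linarith
    then have u3: "fst u3 vX = bit i v" "snd u3 = snd u"
      using den_divmod(1,3)[of vX vA vQUO vJ vN u2] u2 unfolding u3_def bit_def by simp_all
    have u3': "fst u3 vV = v" "fst u3 vN = n" "fst u3 vBASE = b" "fst u3 vA = 2"
      "fst u3 vP = 2 ^ i" "fst u3 vTI = i"
      using u2 unfolding u3_def by (simp_all add: den_wr)
    have bit01: "of_bool (bit i v = 0) = 1 - bit i v"
      by (auto simp: bit_def)
    have w: "den ?body (setv vV v u) = (fst u3, (snd u)(cell b 2 ((i + i) * n + v) := bit i v,
        cell b 2 ((i + i + 1) * n + v) := 1 - bit i v))"
    proof -
      have "den ?body (setv vV v u) = den (?p1 ;; ?p2) u3"
        using u0(2) by (simp add: u3_def u2_def u1_def u0_def)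
      also have "\<dots> = (fst u3, (snd u)(cell b 2 ((i + i) * n + v) := bit i v,
        cell b 2 ((i + i + 1) * n + v) := 1 - bit i v))"
        unfolding den.simps ev.simps ev_bool fst_conv snd_conv u3 u3' bit01 ..
      finally show ?thesis .
    qed
    have "F (den ?body (setv vV v u)) i v"
      unfolding w F_def using row_inj[OF v v, of "i + i" "i + i + 1"] by simp
    moreover have "F (den ?body (setv vV v u)) i' v'"
      if "F u i' v'" "v' < n" "i' \<noteq> i \<or> v' \<noteq> v" for i' v'
    proof -
      \<comment> \<open>Parity: a bit row is never a complement row.\<close>
      have "i' + i' \<noteq> i + i + 1" "i' + i' + 1 \<noteq> i + i" "i' + i' = i + i \<longleftrightarrow> i' = i"
        by presburger+
      then show ?thesis
        using that v unfolding w F_def by (simp add: row_inj del: add_Suc_right add_mult_distrib mult_Suc)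
    qed
    ultimately have "\<forall>i'<n. \<forall>v'<n. i' < i \<or> i' = i \<and> v' < Suc v \<longrightarrow> F (den ?body (setv vV v u)) i' v'"
      using P unfolding P_def by (metis less_Suc_eq less_irrefl)
    moreover have "fst (den ?body (setv vV v u)) = fst u3"
      unfolding w by simp
    ultimately show ?thesis
      unfolding P_def using u3' by simp
  qed
  have step: "P (Suc i) 0 (den ?step (setv vTI i u))" if P: "P i 0 u" and i: "i < n" for i u
  proof -
    let ?u = "setv vTI i u"
    let ?w = "den (For vV vN ?body) ?u"
    have u: "P i 0 ?u" "fst ?u vTI = i" "fst ?u vN = n"
      using P by (auto simp: P_def F_def)
    have "P i (fst ?u vN) ?w \<and> fst ?w vTI = i"
    proof (rule den_For_induct[where Q = "\<lambda>v w. P i v w \<and> fst w vTI = i"])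
      show "P i 0 ?u \<and> fst ?u vTI = i"
        using u by simp
    qed (use entry i u(3) in blast)
    then have "P i n ?w"
      using u(3) by simp
    then show ?thesis
      unfolding P_def F_def by (auto simp: less_Suc_eq)
  qed
  let ?s = "setv vA 2 (setv vP 1 s)"
  have "P (fst ?s vN) 0 (den (For vTI vN ?step) ?s)"
  proof (rule den_For_induct[where Q = "\<lambda>i. P i 0"])
    show "P 0 0 ?s"
      using n b by (simp add: P_def)
  qed (use step n in simp)
  then have "P n 0 (den setup4 s)"
    using n by (simp add: setup4_def)
  then have "F (den setup4 s) t v"
    using tv unfolding P_def by blast
  then show "snd (den setup4 s) (cell b 2 (2 * t * n + v)) = v div 2 ^ t mod 2"
    "snd (den setup4 s) (cell b 2 ((2 * t + 1) * n + v)) = 1 - v div 2 ^ t mod 2"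
    unfolding F_def bit_def mult_2 by blast+
qed

lemma card_less_Suc: "card {v. v < Suc i \<and> P v} = card {v. v < i \<and> P v} + of_bool (P i)"
proof -
  have "{v. v < Suc i \<and> P v} = (if P i then insert i {v. v < i \<and> P v} else {v. v < i \<and> P v})"
    by (auto simp: less_Suc_eq)
  then show ?thesis
    by simp
qed

lemma den_setup5:
  assumes n: "fst s vN = n" and dem: "\<And>v. v < n \<Longrightarrow> snd s (6 + n + v) = dem v"
    and dep: "\<And>v. v < n \<Longrightarrow> snd s (6 + v) = of_bool (dep v)"
  shows "fst (den setup5 s) vCC = card {v. v < n \<and> dem v \<noteq> 0}"
    "fst (den setup5 s) vCT = card {v. v < n \<and> dem v \<noteq> 0 \<and> \<not> dep v}"
    "fst (den setup5 s) vBAD = 0 \<longleftrightarrow> (\<forall>v<n. dem v \<le> fst s vCAP)"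
proof -
  let ?body = "Assign vX (demE (V vV)) ;;
       Cond (V vX)
        (Assign vCC (Plus (V vCC) (N 1)) ;;
         Assign vCT (Plus (V vCT) (NotE (depE (V vV)))) ;;
         Assign vBAD (Plus (V vBAD) (Minus (V vX) (V vCAP))))
        Skip"
  let ?s = "setv vBAD 0 (setv vCT 0 (setv vCC 0 s))"
  define P where "P i u \<longleftrightarrow> fst u vN = n \<and> fst u vCAP = fst s vCAP \<and> snd u = snd s \<and>
    fst u vCC = card {v. v < i \<and> dem v \<noteq> 0} \<and>
    fst u vCT = card {v. v < i \<and> dem v \<noteq> 0 \<and> \<not> dep v} \<and>
    (fst u vBAD = 0 \<longleftrightarrow> (\<forall>v<i. dem v \<le> fst s vCAP))" for i u
  have "P (fst ?s vN) (den (For vV vN ?body) ?s)"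
  proof (rule den_For_induct[where Q = P])
    show "P 0 ?s"
      using n by (simp add: P_def)
    fix i u assume "i < fst ?s vN" and P: "P i u"
    then have i: "i < n"
      using n by simp
    have u: "fst u vN = n" "snd u = snd s"
      using P by (auto simp: P_def)
    have e: "ev (demE (V vV)) (setv vV i u) = dem i"
      "ev (depE (V vV)) (setv vCC y (setv vX x (setv vV i u))) = of_bool (dep i)" for x y
      using u dem[OF i] dep[OF i] by (simp_all add: demE_def depE_def)
    show "P (Suc i) (den ?body (setv vV i u))"
    proof (cases "dem i = 0")
      case True
      then have "den ?body (setv vV i u) = setv vX 0 (setv vV i u)"
        by (simp add: e)
      then show ?thesis
        using P True unfolding P_def card_less_Suc all_less_Suc by simp
    next
      case False
      then have "den ?body (setv vV i u) =
          setv vBAD (fst u vBAD + (dem i - fst u vCAP))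
          (setv vCT (fst u vCT + of_bool (\<not> dep i))
          (setv vCC (fst u vCC + 1) (setv vX (dem i) (setv vV i u))))"
        by (simp add: e)
      then show ?thesis
        using P False unfolding P_def card_less_Suc all_less_Suc by simp
    qed
  qed
  then have "P n (den setup5 s)"
    using n by (simp add: setup5_def)
  then show "fst (den setup5 s) vCC = card {v. v < n \<and> dem v \<noteq> 0}"
    "fst (den setup5 s) vCT = card {v. v < n \<and> dem v \<noteq> 0 \<and> \<not> dep v}"
    "fst (den setup5 s) vBAD = 0 \<longleftrightarrow> (\<forall>v<n. dem v \<le> fst s vCAP)"
    by (simp_all add: P_def)
qed

lemma bits_differ:
  fixes u v :: nat
  assumes "u < 2 ^ b" "v < 2 ^ b" "u \<noteq> v"
  shows "\<exists>i<b. u div 2 ^ i mod 2 \<noteq> v div 2 ^ i mod 2"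
  using assms
proof (induction b arbitrary: u v)
  case (Suc b)
  show ?case
  proof (cases "u mod 2 = v mod 2")
    case True
    then have "u div 2 \<noteq> v div 2"
      using Suc.prems(3) by (metis div_mult_mod_eq)
    moreover have "u div 2 < 2 ^ b" "v div 2 < 2 ^ b"
      using Suc.prems(1,2) by auto
    ultimately obtain i where "i < b" "u div 2 div 2 ^ i mod 2 \<noteq> v div 2 div 2 ^ i mod 2"
      using Suc.IH by blast
    then show ?thesis
      by (intro exI[of _ "Suc i"]) (simp add: div_mult2_eq)
  next
    case False
    then show ?thesis
      by (intro exI[of _ 0]) simp
  qed
qed simp

text \<open>
  With \<open>x\<close> about \<open>2 * log n\<close> and \<open>m\<close> depending on \<open>r\<close> only, this bounds the number of guesses by
  a function of \<open>r\<close> times \<open>n\<^sup>2\<close>.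
\<close>

lemma power_le_exp: "(x::nat) ^ m \<le> m ^ m * 2 ^ x"
proof (cases "m = 0")
  case False
  \<comment> \<open>The idea is to bound \<open>x\<close> by \<open>m * 2 ^ (x div m)\<close>;
    raising this to the power \<open>m\<close> leaves an exponent of 2 that is at most
    \<open>x\<close>.\<close>
  have "x \<le> m * (x div m + 1)"
    using False dividend_less_times_div[of m x] by simp
  also have "\<dots> \<le> m * 2 ^ (x div m)"
    using less_exp[of "x div m"] by (intro mult_le_mono2) (simp add: Suc_leI)
  finally have "x ^ m \<le> (m * 2 ^ (x div m)) ^ m"
    by (rule power_mono) simp
  also have "\<dots> = m ^ m * 2 ^ (x div m * m)"
    by (simp add: power_mult_distrib power_mult)
  also have "\<dots> \<le> m ^ m * 2 ^ x"
    by (intro mult_le_mono2 power_increasing) simp_all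
  finally show ?thesis .
qed simp

text \<open>Joins the bounds of program parts that satisfy \<open>cbounded\<close> for different
  sets of variables.\<close>

lemma tm_Seq_le:
  assumes "tm a s \<le> ccost a * B ^ depth a" "tm b (den a s) \<le> ccost b * B ^ depth b" "0 < B"
  shows "tm (a ;; b) s \<le> ccost (a ;; b) * B ^ depth (a ;; b)"
proof -
  have "B ^ depth a \<le> B ^ depth (a ;; b)" "B ^ depth b \<le> B ^ depth (a ;; b)"
    using assms(3) by (auto intro!: power_increasing)
  then have "ccost a * B ^ depth a + ccost b * B ^ depth b \<le> ccost (a ;; b) * B ^ depth (a ;; b)"
    by (simp add: add_mult_distrib add_mono)
  then show ?thesis
    using assms(1,2) by simp
qed

lemma cbounded_divmod [simp]:
  "cbounded Z (divmod x y q j z) \<longleftrightarrow> x \<notin> Z \<and> q \<notin> Z \<and> j \<notin> Z \<and> z \<in> Z"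
  by (auto simp: divmod_def LeE_def NotE_def)

lemma ebounded_exps [simp]:
  "ebounded Z (NotE a) = ebounded Z a"
  "ebounded Z (AndE a b) = (ebounded Z a \<and> ebounded Z b)"
  "ebounded Z (EqE a b) = (ebounded Z a \<and> ebounded Z b)"
  "ebounded Z (LeE a b) = (ebounded Z a \<and> ebounded Z b)"
  "ebounded Z (adr i a) = ebounded Z a"
  "ebounded Z (Arr i a) = ebounded Z a"
  "ebounded Z (depE a) = ebounded Z a"
  "ebounded Z (demE a) = ebounded Z a"
  "ebounded Z (adjE a b) = (vN \<in> Z \<and> ebounded Z a \<and> ebounded Z b)"
  "ebounded Z (tabE c a b) = (vN \<in> Z \<and> ebounded Z c \<and> ebounded Z a \<and> ebounded Z b)"
  "ebounded Z (phiE a b) = (vN \<in> Z \<and> ebounded Z a \<and> ebounded Z b)"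
  by (auto simp: NotE_def AndE_def EqE_def LeE_def adr_def Arr_def depE_def demE_def adjE_def
      tabE_def phiE_def)

lemma cbounded_solver:
  "cbounded {} setup1" "cbounded {vN, vL} setup2" "cbounded {vLEN, vQ} setup3"
  "cbounded {vN} setup4" "cbounded {vN} setup5" "cbounded {vN, vL, vLEN, vTOT} search"
  by (simp_all add: setup1_def setup2_def setup3_def setup4_def setup5_def search_def try_guess_def
      decode_def init_table_def init_counts_def counts_step_def closable_def table_step_def
      violations_def violation_step_def new_entry_def min_step_def min_test_def any_entry_def verdict_def)

section \<open>The running time\<close>

text \<open>\<open>l\<close> is the length \<open>L + L * L\<close> of a guess. By
  \<open>power_le_exp\<close> there are at most \<open>l ^ l * 2 ^ Q\<close> guesses, and
  \<open>2 ^ Q\<close> is at most \<open>2 ^ (r + 6) * n ^ 2\<close> because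
  \<open>Q = r + 4 + 2 * \<beta>\<close> and \<open>2 ^ \<beta>\<close> is at most
  \<open>2 * n\<close>. The summands \<open>l\<close> and 1 let the same base cover the other loop
  bounds.\<close>

definition bound_base :: "nat \<Rightarrow> nat" where
  "bound_base r = (let l = 4 * r + 4 * r * (4 * r) in (l ^ l + l + 1) * 2 ^ (r + 6))"

text \<open>As a loop program the bound is computable by compilation; \<open>a\<close> and
  \<open>d\<close> become constants of the program text.\<close>

definition bound_prog :: "nat \<Rightarrow> nat \<Rightarrow> com" where
  "bound_prog a d =
     Assign 3 (Mem (N 0)) ;;
     Assign 4 (Plus (Plus (V 3) (V 3)) (Plus (V 3) (V 3))) ;;
     Assign 5 (Plus (V 4) (Mul (V 4) 4)) ;;
     Assign 6 (N 1) ;;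
     For 20 5 (Assign 6 (Mul (V 6) 5)) ;;
     Assign 6 (Plus (Plus (V 6) (V 5)) (N 1)) ;;
     Assign 7 (Plus (V 3) (N 6)) ;;
     For 20 7 (Assign 6 (Plus (V 6) (V 6))) ;;
     Assign 8 (N d) ;;
     Assign 9 (N a) ;;
     For 20 8 (Assign 9 (Mul (V 9) 6)) ;;
     Assign 0 (V 9)"

lemma den_For_mul:
  assumes "x \<noteq> y" "x \<noteq> j" "y \<noteq> j"
  shows "fst (den (For j z (Assign x (Mul (V x) y))) s) x = fst s x * fst s y ^ fst s z"
proof -
  define P where "P i u \<longleftrightarrow> fst u y = fst s y \<and> fst u x = fst s x * fst s y ^ i" for i and u :: state
  have "P (fst s z) (den (For j z (Assign x (Mul (V x) y))) s)"
    by (rule den_For_induct[where Q = P]) (use assms in \<open>auto simp: P_def\<close>)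
  then show ?thesis
    by (simp add: P_def)
qed

lemma den_For_double:
  assumes "x \<noteq> j"
  shows "fst (den (For j z (Assign x (Plus (V x) (V x)))) s) x = fst s x * 2 ^ fst s z"
proof -
  define P where "P i u \<longleftrightarrow> fst u x = fst s x * 2 ^ i" for i and u :: state
  have "P (fst s z) (den (For j z (Assign x (Plus (V x) (V x)))) s)"
    by (rule den_For_induct[where Q = P]) (use assms in \<open>auto simp: P_def\<close>)
  then show ?thesis
    by (simp add: P_def)
qed

lemma den_bound_prog: "fst (den (bound_prog a d) s) 0 = a * bound_base (snd s 0) ^ d"
proof -
  let ?r = "snd s 0"
  let ?l = "4 * ?r + 4 * ?r * (4 * ?r)"
  let ?c1 = "Assign 3 (Mem (N 0)) ;; Assign 4 (Plus (Plus (V 3) (V 3)) (Plus (V 3) (V 3))) ;;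
     Assign 5 (Plus (V 4) (Mul (V 4) 4)) ;; Assign 6 (N 1)"
  let ?c2 = "For 20 5 (Assign 6 (Mul (V 6) 5))"
  let ?c3 = "Assign 6 (Plus (Plus (V 6) (V 5)) (N 1)) ;; Assign 7 (Plus (V 3) (N 6))"
  let ?c4 = "For 20 7 (Assign 6 (Plus (V 6) (V 6)))"
  let ?c5 = "Assign 8 (N d) ;; Assign 9 (N a)"
  let ?c6 = "For 20 8 (Assign 9 (Mul (V 9) 6))"
  define s1 where "s1 = den ?c1 s"
  define s2 where "s2 = den ?c2 s1"
  define s3 where "s3 = den ?c3 s2"
  define s4 where "s4 = den ?c4 s3"
  define s5 where "s5 = den ?c5 s4"
  define s6 where "s6 = den ?c6 s5"
  have s1: "fst s1 3 = ?r" "fst s1 5 = ?l" "fst s1 6 = 1"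
    by (simp_all add: s1_def algebra_simps)
  have s2: "fst s2 3 = ?r" "fst s2 5 = ?l" "fst s2 6 = ?l ^ ?l"
    using s1 den_For_mul[of 6 5 20 5 s1] unfolding s2_def by (simp_all add: den_wr)
  have s3: "fst s3 7 = ?r + 6" "fst s3 6 = ?l ^ ?l + ?l + 1"
    using s2 unfolding s3_def by simp_all
  have "fst s4 6 = (?l ^ ?l + ?l + 1) * 2 ^ (?r + 6)"
    using s3 den_For_double[of 6 20 7 s3] unfolding s4_def by simp
  then have s4: "fst s4 6 = bound_base ?r"
    unfolding bound_base_def Let_def .
  have s5: "fst s5 6 = bound_base ?r" "fst s5 8 = d" "fst s5 9 = a"
    using s4 unfolding s5_def by simp_all
  have "fst s6 9 = a * bound_base ?r ^ d"
    using s5 den_For_mul[of 9 6 20 8 s5] unfolding s6_def by simp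
  moreover have "den (bound_prog a d) s = den (Assign 0 (V 9)) s6"
    by (simp add: bound_prog_def s6_def s5_def s4_def s3_def s2_def s1_def)
  ultimately show ?thesis
    by simp
qed

lemma computable_bound: "computable (\<lambda>r. a * bound_base r ^ d)"
proof -
  have "\<exists>t. outputs_within (ccom (bound_prog a d) 0 0) [r] t (a * bound_base r ^ d)" for r
    using outputs_within_ccom[OF refl order_refl, of "bound_prog a d" "[r]"] by (auto simp: den_bound_prog)
  then show ?thesis
    unfolding computable_def by blast
qed

text \<open>All loop bounds and multipliers are at most \<open>bound_base r * n ^ 2\<close>; raised
  to the nesting depth, this gives \<open>n\<close> the exponent \<open>2 * depth solver\<close>,
  which does not depend on the instance.\<close>

lemma solver_correct:
  fixes I :: "'v cvrp"
  assumes I: "wf_cvrp I" "no_zero_weight_edges I" "distinct vs" "set vs = verts I"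
  shows "decides_within (ccom solver 0 0) (encode vs I r)
    (ccost solver * bound_base r ^ depth solver * card (verts I) ^ (2 * depth solver))
    (\<exists>ps A. routing I ps A \<and> routing_weight I ps \<le> r)"
proof -
  define n where "n = length vs"
  define M where "M i = (if i < length (encode vs I r) then encode vs I r ! i else 0)" for i
  define s0 :: state where "s0 = ((\<lambda>_. 0), M)"
  define s1 where "s1 = den setup1 s0"
  define s2 where "s2 = den setup2 s1"
  define s3 where "s3 = den setup3 s2"
  define s4 where "s4 = den setup4 s3"
  define s5 where "s5 = den setup5 s4"
  define \<beta> where "\<beta> = fst s2 vBETA"
  define b where "b = 6 + n + n + n * n"
  define l where "l = 4 * r"
  have card: "card (verts I) = n"
    using distinct_card[OF I(3)] I(4) by (simp add: n_def)
  \<comment> \<open>A depot exists, so \<open>n\<close> is positive; \<open>setup2\<close> and the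
    bound \<open>B\<close> rely on it.\<close>
  obtain d where "d \<in> depots I" "d \<in> set vs"
    using I(1,4) by (auto simp: wf_cvrp_def)
  then obtain d where d: "d < n" "vs ! d \<in> depots I"
    by (auto simp: in_set_conv_nth n_def)
  have len: "length (encode vs I r) = b"
    by (simp add: length_encode b_def n_def)
  have six: "i < 6 \<Longrightarrow> i < b" for i
    by (simp add: b_def)
  have M: "M 0 = r" "M 1 = n" "M 2 = vehicles I" "M 3 = capacity I"
    "(if M 4 = 0 then r else M 5) = igas I r"
    using encode_nth(1-5)[of vs I r] encode_nth(6)[of I _ vs r]
    by (auto simp: M_def len six n_def igas_def split: option.split)
  have M_dep: "M (6 + v) = of_bool (idep vs I v)" if "v < n" for v
    using encode_nth(7)[of v vs I r] that by (simp add: M_def len n_def b_def idep_def)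
  have M_dem: "M (6 + n + v) = idem vs I v" if "v < n" for v
    using encode_nth(8)[of v vs I r] that by (simp add: M_def len n_def b_def idem_def)
  have M_adj: "M (6 + n + n + (u * n + v)) = iadj vs I u v" if uv: "u < n" "v < n" for u v
  proof -
    have "u * n + v < Suc u * n" "Suc u * n \<le> n * n"
      using uv by (simp, intro mult_le_mono1, simp)
    then have "u * n + v < n * n"
      by linarith
    then show ?thesis
      using encode_nth(9)[of u vs v I r] uv by (simp add: M_def len n_def b_def iadj_def)
  qed
  have s0_snd: "snd s0 = M"
    by (simp add: s0_def)
  have mem: "snd s1 = M" "snd s2 = M" "snd s3 = M" "snd s5 = snd s4"
    by (simp_all add: s1_def s2_def s3_def s5_def s0_def snd_den_no_Put)
  have s1: "fst s1 vR = r" "fst s1 vN = n" "fst s1 vK = vehicles I" "fst s1 vCAP = capacity I"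
    "fst s1 vGB = igas I r" "fst s1 vL = l"
    using M unfolding s1_def l_def den_setup1 s0_snd by (auto split: if_splits)
  have s2: "fst s2 vBASE = b" "fst s2 vLEN = l + l * l" "fst s2 vQ = r + 4 + 2 * \<beta>" "fst s2 vTOT = 1"
    "\<beta> \<le> n" "n \<le> 2 ^ \<beta>" "2 ^ \<beta> \<le> 2 * n"
    using den_setup2[of s1] s1 d(1) by (simp_all add: s2_def b_def \<beta>_def)
  have s2': "fst s2 vR = r" "fst s2 vN = n" "fst s2 vK = vehicles I" "fst s2 vCAP = capacity I"
    "fst s2 vGB = igas I r" "fst s2 vL = l"
    using s1 by (simp_all add: s2_def den_wr)
  define q where "q = r + 4 + 2 * \<beta>"
  have s3: "fst s3 vTOT = q ^ (l + l * l)"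
    using den_setup3[OF s2(4)] s2 by (simp add: s3_def q_def)
  have s3': "fst s3 vBASE = b" "fst s3 vLEN = l + l * l" "fst s3 vQ = q"
    "fst s3 vR = r" "fst s3 vN = n" "fst s3 vK = vehicles I" "fst s3 vCAP = capacity I"
    "fst s3 vGB = igas I r" "fst s3 vL = l"
    using s2 s2' by (simp_all add: s3_def den_wr q_def)
  have s4: "fst s4 vBASE = b" "fst s4 vLEN = l + l * l" "fst s4 vQ = q"
    "fst s4 vR = r" "fst s4 vN = n" "fst s4 vK = vehicles I" "fst s4 vCAP = capacity I"
    "fst s4 vGB = igas I r" "fst s4 vL = l" "fst s4 vTOT = q ^ (l + l * l)"
    using s3 s3' by (simp_all add: s4_def den_wr)
  have s5: "fst s5 vBASE = b" "fst s5 vLEN = l + l * l" "fst s5 vQ = q"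
    "fst s5 vR = r" "fst s5 vN = n" "fst s5 vK = vehicles I" "fst s5 vCAP = capacity I"
    "fst s5 vGB = igas I r" "fst s5 vL = l" "fst s5 vTOT = q ^ (l + l * l)"
    using s4 by (simp_all add: s5_def den_wr)
  \<comment> \<open>The arrays start at \<open>b\<close>, so \<open>setup4\<close> leaves the input
    as it is.\<close>
  have low: "snd s4 x = M x" if "x < b" for x
    using den_awr(2)[of setup4 b s3 x] that s3'(1) mem(3) by (simp add: s4_def)
  have low_dep: "snd s4 (6 + v) = of_bool (idep vs I v)" if "v < n" for v
    using low[of "6 + v"] M_dep[OF that] that by (simp add: b_def)
  have low_dem: "snd s4 (6 + n + v) = idem vs I v" if "v < n" for v
    using low[of "6 + n + v"] M_dem[OF that] that by (simp add: b_def)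
  note c5 = den_setup5[OF s4(5) low_dem low_dep, folded s5_def]
  define phi where "phi t v = snd s4 (cell b 2 (t * n + v))" for t v
  have "inst n r (idep vs I) (iadj vs I) phi q"
  proof
    show "\<exists>d<n. idep vs I d"
      using d by (auto simp: idep_def)
    show "iadj vs I u v \<noteq> 1" for u v
      using I(2) by (simp add: iadj_def no_zero_weight_edges_def)
    show "r + 4 \<le> q"
      by (simp add: q_def)
    fix u v assume uv: "u < n" "v < n" "u \<noteq> v"
    obtain i where i: "i < \<beta>" "u div 2 ^ i mod 2 \<noteq> v div 2 ^ i mod 2"
      using bits_differ[of u \<beta> v] uv s2(6) by auto
    have ph: "phi (2 * i) w = w div 2 ^ i mod 2" "phi (2 * i + 1) w = 1 - w div 2 ^ i mod 2" if "w < n" for w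
      using den_setup4[OF s3'(5,1) _ that, of i] i(1) s2(5) unfolding phi_def s4_def by simp_all
    \<comment> \<open>Depending on which of the two indices has bit 0 there, the bit row or its
      complement vanishes on \<open>u\<close>.\<close>
    show "\<exists>t<q. phi t u = 0 \<and> phi t v \<noteq> 0"
    proof (cases "u div 2 ^ i mod 2 = 0")
      case True
      then have "phi (2 * i) u = 0" "phi (2 * i) v \<noteq> 0" "2 * i < q"
        using i ph uv by (simp_all add: q_def)
      then show ?thesis
        by blast
    next
      case False
      then have "u div 2 ^ i mod 2 = 1"
        by (simp only: not_mod_2_eq_0_eq_1)
      moreover from this have "v div 2 ^ i mod 2 = 0"
        using i(2) by (metis not_mod_2_eq_1_eq_0)
      ultimately have "phi (2 * i + 1) u = 0" "phi (2 * i + 1) v \<noteq> 0" "2 * i + 1 < q"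
        using i(1) ph uv by (simp_all add: q_def)
      then show ?thesis
        by blast
    qed
  qed
  note inst = this
  interpret inst n "vehicles I" "capacity I" "igas I r" r "idep vs I" "idem vs I" "iadj vs I" phi q
    by (rule inst)
  have T: "T = {v. v < n \<and> idem vs I v \<noteq> 0 \<and> \<not> idep vs I v}"
    by (auto simp: T_def C_def)
  have L: "L = l"
    by (simp add: L_def l_def)
  have low_adj: "snd s4 (6 + n + n + (u * n + v)) = iadj vs I u v" if uv: "u < n" "v < n" for u v
    using low[of "6 + n + n + (u * n + v)"] M_adj[OF uv] pair_index_less[OF uv] by (simp add: b_def)
  have "env s5"
    unfolding env_def L T C_def base_def b_def[symmetric] mem(4)
    using s5 c5 low_dep low_dem low_adj s4(7) by (simp add: phi_def)
  then have out: "fst (den solver s0) 0 = (if \<exists>ps A. iroute ps A then 1 else 0)"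
    using den_search[of s5] by (simp add: solver_def s1_def s2_def s3_def s4_def s5_def)
  define B where "B = bound_base r * n ^ 2"
  have time: "tm solver s0 \<le> ccost solver * B ^ depth solver"
  proof -
    define m where "m = l + l * l"
    have B: "B = (m ^ m + m + 1) * (2 ^ (r + 6) * n ^ 2)"
      unfolding B_def bound_base_def Let_def m_def l_def by (simp only: mult.assoc)
    \<comment> \<open>The 6 in \<open>bound_base\<close>: 4 comes from \<open>q\<close>, and 2 from
      \<open>(2 * n) ^ 2 = 2 ^ 2 * n ^ 2\<close>.\<close>
    have "(2::nat) ^ q = 2 ^ (r + 4) * (2 ^ \<beta>) ^ 2"
      unfolding q_def power_add power_mult[symmetric] by (simp only: mult.commute)
    also have "\<dots> \<le> 2 ^ (r + 4) * (2 * n) ^ 2"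
      using s2(7) by (intro mult_le_mono2 power_mono) simp_all
    also have "\<dots> = 2 ^ (r + 6) * n ^ 2"
      by (simp add: power_add power_mult_distrib)
    finally have 2: "2 ^ q \<le> 2 ^ (r + 6) * n ^ 2" .
    have n2: "n \<le> n ^ 2" "1 \<le> 2 ^ (r + 6) * n ^ 2"
      using d(1) by (simp_all add: power2_eq_square)
    have "x \<le> B" if "x \<le> y * (2 ^ (r + 6) * n ^ 2)" "y \<le> m ^ m + m + 1" for x y
      using that unfolding B by (meson le_trans mult_le_mono1)
    note le_B = this
    have "q ^ m \<le> m ^ m * (2 ^ (r + 6) * n ^ 2)"
      using power_le_exp[of q m] 2 by (meson le_trans mult_le_mono2)
    then have bT: "q ^ m \<le> B"
      by (rule le_B) simp
    have "q \<le> 1 * (2 ^ (r + 6) * n ^ 2)"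
      using 2 less_exp[of q] by linarith
    then have bQ: "q \<le> B"
      by (rule le_B) simp
    have "m \<le> m * (2 ^ (r + 6) * n ^ 2)"
      using n2(2) by simp
    then have bm: "m \<le> B"
      by (rule le_B) simp
    then have bl: "l \<le> B"
      by (simp add: m_def)
    have "n ^ 2 \<le> 1 * (2 ^ (r + 6) * n ^ 2)"
      by simp
    then have bn: "n \<le> B"
      using n2(1) le_B[of "n ^ 2" 1] by linarith
    have pos: "0 < B"
      using bn d(1) by linarith
    have t1: "tm setup1 s0 \<le> ccost setup1 * B ^ depth setup1"
      by (rule tm_le[OF cbounded_solver(1) _ pos]) simp
    have t2: "tm setup2 s1 \<le> ccost setup2 * B ^ depth setup2"
      by (rule tm_le[OF cbounded_solver(2) _ pos]) (simp add: s1 bn bl)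
    have t3: "tm setup3 s2 \<le> ccost setup3 * B ^ depth setup3"
      by (rule tm_le[OF cbounded_solver(3) _ pos]) (use s2 bm bQ in \<open>simp add: m_def q_def\<close>)
    have t4: "tm setup4 s3 \<le> ccost setup4 * B ^ depth setup4"
      by (rule tm_le[OF cbounded_solver(4) _ pos]) (simp add: s3' bn)
    have t5: "tm setup5 s4 \<le> ccost setup5 * B ^ depth setup5"
      by (rule tm_le[OF cbounded_solver(5) _ pos]) (simp add: s4 bn)
    have t6: "tm search s5 \<le> ccost search * B ^ depth search"
      by (rule tm_le[OF cbounded_solver(6) _ pos]) (use s5 bn bl bm bT in \<open>simp add: m_def\<close>)
    show ?thesis
      unfolding solver_def
      by (rule tm_Seq_le[OF t1 tm_Seq_le[OF t2[unfolded s1_def] tm_Seq_le[OF t3[unfolded s2_def s1_def]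
          tm_Seq_le[OF t4[unfolded s3_def s2_def s1_def] tm_Seq_le[OF t5[unfolded s4_def s3_def s2_def s1_def]
          t6[unfolded s5_def s4_def s3_def s2_def s1_def] pos] pos] pos] pos] pos])
  qed
  have "tm solver s0 \<le> ccost solver * bound_base r ^ depth solver * card (verts I) ^ (2 * depth solver)"
    using time by (simp add: B_def card power_mult_distrib power_mult mult.assoc)
  moreover have "s0 = ((\<lambda>_. 0), (\<lambda>i. if i < length (encode vs I r) then encode vs I r ! i else 0))"
    by (simp add: s0_def M_def fun_eq_iff)
  ultimately have "outputs_within (ccom solver 0 0) (encode vs I r)
    (ccost solver * bound_base r ^ depth solver * card (verts I) ^ (2 * depth solver))
    (fst (den solver s0) 0)"
    by (intro outputs_within_ccom)
  then show ?thesis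
    using routing_iff_iroute[OF inst[unfolded n_def] I(1,4,3)]
    unfolding decides_within_def out n_def by simp
qed

theorem corollary4p3:
  "\<exists>P f c. computable f \<and>
     (\<forall>(I :: nat cvrp) vs r.
        (LoadCVRP I \<or> LoadGasCVRP I) \<and> no_zero_weight_edges I \<and>
        distinct vs \<and> set vs = verts I \<longrightarrow>
        decides_within P (encode vs I r) (f r * card (verts I) ^ c)
          (\<exists>ps A. routing I ps A \<and> routing_weight I ps \<le> r))"
proof (intro exI conjI allI impI)
  show "computable (\<lambda>r. ccost solver * bound_base r ^ depth solver)"
    by (rule computable_bound)
  fix I :: "nat cvrp" and vs r
  assume "(LoadCVRP I \<or> LoadGasCVRP I) \<and> no_zero_weight_edges I \<and> distinct vs \<and> set vs = verts I"
  then show "decides_within (ccom solver 0 0) (encode vs I r)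
      (ccost solver * bound_base r ^ depth solver * card (verts I) ^ (2 * depth solver))
      (\<exists>ps A. routing I ps A \<and> routing_weight I ps \<le> r)"
    by (intro solver_correct) (auto simp: LoadCVRP_def LoadGasCVRP_def)
qed

end
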